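(* Let $\mathbb{F}$ be a subfield of $\mathbb{C}$ closed under complex conjugation with $\mathbb{A}\cap\mathbb{R}\subseteq\mathbb{F}\subseteq\mathbb{C}$, and let $\mathsf{QL}(\mathcal N)=\bigcap_{d<\omega}\mathsf{QL}(\mathsf L(\mathbb{C}^d))$. Then: (1) $\mathsf{QL}(\mathcal N)=\bigcap_{d<\omega}\mathsf{QL}(\mathsf L(\mathbb{F}^d))$; (2) $\mathsf{QL}(\mathcal N)=\mathsf{QL}(L)$ for every ortholattice $L$ which is the direct limit of a direct system of ortholattices $\mathsf L(\mathbb{F}^{d_n})$, $n<\omega$, with ortholattice embeddings as connecting maps and $d_n\to\infty$; (3) $\mathsf{QL}(\mathcal N)=\mathsf{QL}(CG(\mathbb{F}))$.
   Context: $\mathbb{A}$ denotes the field of algebraic complex numbers. For a conjugation-closed subfield $\mathbb{F}\subseteq\mathbb{C}$, $\mathbb{F}^d$ carries the canonical inner product $\langle x,y\rangle=\sum_i x_i\overline{y_i}$, and $\mathsf L(\mathbb{F}^d)$ is the ortholattice of all linear subspaces of $\mathbb{F}^d$ with intersection, sum, and orthogonal complement $X\mapsto X^\perp$; it is a modular ortholattice. For a class (or single member) $\mathcal C$ of ortholattices, $\mathsf{QL}(\mathcal C)$ denotes the set of ortholattice identities (in $\vee,\wedge,{}',0,1$) valid in all members of $\mathcal C$. $CG(\mathbb{F})$ is von Neumann's continuous geometry over $\mathbb{F}$: take the direct system $\mathsf L(\mathbb{F}^{2^n})$ with the ortholattice embeddings $X\mapsto X\oplus X\subseteq \mathbb{F}^{2^n}\oplus\mathbb{F}^{2^n}=\mathbb{F}^{2^{n+1}}$,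 let $L_\infty$ be its direct limit equipped with the metric $\delta(X,Y)=2^{-n}(\dim(X+Y)-\dim(X\cap Y))$ for $X,Y\in\mathsf L(\mathbb{F}^{2^n})$ (compatible with the embeddings), and let $CG(\mathbb{F})$ be the metric completion of $L_\infty$ with the operations extended by continuity. *)

theory Defs
  imports Complex_Main "HOL-Computational_Algebra.Polynomial"
begin

record 'a ortholattice =
  ocarrier :: "'a set"
  ojoin :: "'a \<Rightarrow> 'a \<Rightarrow> 'a"
  omeet :: "'a \<Rightarrow> 'a \<Rightarrow> 'a"
  ocompl :: "'a \<Rightarrow> 'a"
  ozero :: 'a
  oone :: 'a

definition is_ortholattice :: "'a ortholattice \<Rightarrow> bool" where
  "is_ortholattice L \<longleftrightarrow>
     ozero L \<in> ocarrier L \<and> oone L \<in> ocarrier L \<and>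
     (\<forall>x\<in>ocarrier L. \<forall>y\<in>ocarrier L. ojoin L x y \<in> ocarrier L \<and> omeet L x y \<in> ocarrier L) \<and>
     (\<forall>x\<in>ocarrier L. ocompl L x \<in> ocarrier L) \<and>
     (\<forall>x\<in>ocarrier L. \<forall>y\<in>ocarrier L. ojoin L x y = ojoin L y x \<and> omeet L x y = omeet L y x) \<and>
     (\<forall>x\<in>ocarrier L. \<forall>y\<in>ocarrier L. \<forall>z\<in>ocarrier L.
        ojoin L (ojoin L x y) z = ojoin L x (ojoin L y z) \<and>
        omeet L (omeet L x y) z = omeet L x (omeet L y z)) \<and>
     (\<forall>x\<in>ocarrier L. \<forall>y\<in>ocarrier L.
        ojoin L x (omeet L x y) = x \<and> omeet L x (ojoin L x y) = x) \<and>
     (\<forall>x\<in>ocarrier L. ojoin L x (ozero L) = x \<and> omeet L x (oone L) = x) \<and>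
     (\<forall>x\<in>ocarrier L. ocompl L (ocompl L x) = x) \<and>
     (\<forall>x\<in>ocarrier L. \<forall>y\<in>ocarrier L. omeet L x y = x \<longrightarrow> omeet L (ocompl L y) (ocompl L x) = ocompl L y) \<and>
     (\<forall>x\<in>ocarrier L. omeet L x (ocompl L x) = ozero L \<and> ojoin L x (ocompl L x) = oone L)"

datatype olterm = OVar nat | OJoin olterm olterm | OMeet olterm olterm | OCompl olterm | OZero | OOne

primrec oeval :: "'a ortholattice \<Rightarrow> (nat \<Rightarrow> 'a) \<Rightarrow> olterm \<Rightarrow> 'a" where
  "oeval L a (OVar i) = a i"
| "oeval L a (OJoin s t) = ojoin L (oeval L a s) (oeval L a t)"
| "oeval L a (OMeet s t) = omeet L (oeval L a s) (oeval L a t)"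
| "oeval L a (OCompl s) = ocompl L (oeval L a s)"
| "oeval L a OZero = ozero L"
| "oeval L a OOne = oone L"

definition holds_in :: "'a ortholattice \<Rightarrow> olterm \<times> olterm \<Rightarrow> bool" where
  "holds_in L e \<longleftrightarrow> (\<forall>a. (\<forall>i. a i \<in> ocarrier L) \<longrightarrow> oeval L a (fst e) = oeval L a (snd e))"

definition QL :: "'a ortholattice \<Rightarrow> (olterm \<times> olterm) set" where
  "QL L = {e. holds_in L e}"

definition ol_hom :: "'a ortholattice \<Rightarrow> 'b ortholattice \<Rightarrow> ('a \<Rightarrow> 'b) \<Rightarrow> bool" where
  "ol_hom L M f \<longleftrightarrow>
     (\<forall>x\<in>ocarrier L. f x \<in> ocarrier M) \<and>
     (\<forall>x\<in>ocarrier L. \<forall>y\<in>ocarrier L. f (ojoin L x y) = ojoin M (f x) (f y) \<and> f (omeet L x y) = omeet M (f x) (f y)) \<and>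
     (\<forall>x\<in>ocarrier L. f (ocompl L x) = ocompl M (f x)) \<and>
     f (ozero L) = ozero M \<and> f (oone L) = oone M"

definition ol_emb :: "'a ortholattice \<Rightarrow> 'b ortholattice \<Rightarrow> ('a \<Rightarrow> 'b) \<Rightarrow> bool" where
  "ol_emb L M f \<longleftrightarrow> ol_hom L M f \<and> inj_on f (ocarrier L)"

definition conj_closed_subfield :: "complex set \<Rightarrow> bool" where
  "conj_closed_subfield F \<longleftrightarrow>
     0 \<in> F \<and> 1 \<in> F \<and> (\<forall>x\<in>F. \<forall>y\<in>F. x + y \<in> F \<and> x - y \<in> F \<and> x * y \<in> F) \<and>
     (\<forall>x\<in>F. x \<noteq> 0 \<longrightarrow> inverse x \<in> F) \<and> (\<forall>x\<in>F. cnj x \<in> F)"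

definition Fvec :: "complex set \<Rightarrow> nat \<Rightarrow> (nat \<Rightarrow> complex) set" where
  "Fvec F d = {v. (\<forall>i. v i \<in> F) \<and> (\<forall>i\<ge>d. v i = 0)}"

definition vzero :: "nat \<Rightarrow> complex" where "vzero = (\<lambda>i. 0)"

definition vadd :: "(nat \<Rightarrow> complex) \<Rightarrow> (nat \<Rightarrow> complex) \<Rightarrow> nat \<Rightarrow> complex" where
  "vadd v w = (\<lambda>i. v i + w i)"

definition vsmul :: "complex \<Rightarrow> (nat \<Rightarrow> complex) \<Rightarrow> nat \<Rightarrow> complex" where
  "vsmul c v = (\<lambda>i. c * v i)"

definition Fsubspace :: "complex set \<Rightarrow> nat \<Rightarrow> (nat \<Rightarrow> complex) set \<Rightarrow> bool" where
  "Fsubspace F d X \<longleftrightarrow> X \<subseteq> Fvec F d \<and> vzero \<in> X \<and>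
     (\<forall>x\<in>X. \<forall>y\<in>X. vadd x y \<in> X) \<and> (\<forall>c\<in>F. \<forall>x\<in>X. vsmul c x \<in> X)"

definition vinner :: "nat \<Rightarrow> (nat \<Rightarrow> complex) \<Rightarrow> (nat \<Rightarrow> complex) \<Rightarrow> complex" where
  "vinner d x y = (\<Sum>i<d. x i * cnj (y i))"

definition Fperp :: "complex set \<Rightarrow> nat \<Rightarrow> (nat \<Rightarrow> complex) set \<Rightarrow> (nat \<Rightarrow> complex) set" where
  "Fperp F d X = {y \<in> Fvec F d. \<forall>x\<in>X. vinner d x y = 0}"

definition ssum :: "(nat \<Rightarrow> complex) set \<Rightarrow> (nat \<Rightarrow> complex) set \<Rightarrow> (nat \<Rightarrow> complex) set" where
  "ssum X Y = {vadd x y | x y. x \<in> X \<and> y \<in> Y}"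

definition LF :: "complex set \<Rightarrow> nat \<Rightarrow> (nat \<Rightarrow> complex) set ortholattice" where
  "LF F d = \<lparr> ocarrier = {X. Fsubspace F d X}, ojoin = ssum, omeet = (\<inter>),
             ocompl = Fperp F d, ozero = {vzero}, oone = Fvec F d \<rparr>"

definition Fspan :: "complex set \<Rightarrow> (nat \<Rightarrow> complex) set \<Rightarrow> (nat \<Rightarrow> complex) set" where
  "Fspan F S = {v. \<exists>T c. finite T \<and> T \<subseteq> S \<and> (\<forall>x\<in>T. c x \<in> F) \<and> v = (\<lambda>i. \<Sum>x\<in>T. c x * x i)}"

definition Findep :: "complex set \<Rightarrow> (nat \<Rightarrow> complex) set \<Rightarrow> bool" where
  "Findep F S \<longleftrightarrow> (\<forall>T c. finite T \<and> T \<subseteq> S \<and> (\<forall>x\<in>T. c x \<in> F) \<and> (\<forall>i. (\<Sum>x\<in>T. c x * x i) = 0)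
       \<longrightarrow> (\<forall>x\<in>T. c x = 0))"

definition Fdim :: "complex set \<Rightarrow> (nat \<Rightarrow> complex) set \<Rightarrow> nat" where
  "Fdim F X = (LEAST k. \<exists>B. finite B \<and> card B = k \<and> B \<subseteq> X \<and> Findep F B \<and> Fspan F B = X)"

text \<open>Doubling embedding L(F^(2^n)) -> L(F^(2^(n+1))), X |-> X (+) X.\<close>

definition dbl :: "complex set \<Rightarrow> nat \<Rightarrow> (nat \<Rightarrow> complex) set \<Rightarrow> (nat \<Rightarrow> complex) set" where
  "dbl F n X = {v \<in> Fvec F (2 ^ Suc n).
      (\<lambda>i. if i < 2 ^ n then v i else 0) \<in> X \<and> (\<lambda>i. if i < 2 ^ n then v (i + 2 ^ n) else 0) \<in> X}"

primrec liftk :: "complex set \<Rightarrow> nat \<Rightarrow> nat \<Rightarrow> (nat \<Rightarrow> complex) set \<Rightarrow> (nat \<Rightarrow> complex) set" where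
  "liftk F n 0 X = X"
| "liftk F n (Suc k) X = dbl F (n + k) (liftk F n k X)"

text \<open>Points of the direct system: pairs (n, X) with X in L(F^(2^n)); the direct limit L_infinity is
  obtained by identifying (n, X) with its images, i.e. points at distance 0.\<close>

type_synonym lpt = "nat \<times> (nat \<Rightarrow> complex) set"

definition Linf_pts :: "complex set \<Rightarrow> lpt set" where
  "Linf_pts F = {p. Fsubspace F (2 ^ fst p) (snd p)}"

definition up :: "complex set \<Rightarrow> nat \<Rightarrow> lpt \<Rightarrow> (nat \<Rightarrow> complex) set" where
  "up F m p = liftk F (fst p) (m - fst p) (snd p)"

definition delta :: "complex set \<Rightarrow> lpt \<Rightarrow> lpt \<Rightarrow> real" where
  "delta F p q = (let k = max (fst p) (fst q); A = up F k p; B = up F k q in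
     (real (Fdim F (ssum A B)) - real (Fdim F (A \<inter> B))) / 2 ^ k)"

definition pjoin :: "complex set \<Rightarrow> lpt \<Rightarrow> lpt \<Rightarrow> lpt" where
  "pjoin F p q = (let k = max (fst p) (fst q) in (k, ssum (up F k p) (up F k q)))"

definition pmeet :: "complex set \<Rightarrow> lpt \<Rightarrow> lpt \<Rightarrow> lpt" where
  "pmeet F p q = (let k = max (fst p) (fst q) in (k, up F k p \<inter> up F k q))"

definition pcompl :: "complex set \<Rightarrow> lpt \<Rightarrow> lpt" where
  "pcompl F p = (fst p, Fperp F (2 ^ fst p) (snd p))"

definition pzero :: lpt where "pzero = (0, {vzero})"

definition pone :: "complex set \<Rightarrow> lpt" where "pone F = (0, Fvec F 1)"

definition dcauchy :: "complex set \<Rightarrow> (nat \<Rightarrow> lpt) \<Rightarrow> bool" where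
  "dcauchy F s \<longleftrightarrow> (\<forall>k. s k \<in> Linf_pts F) \<and>
     (\<forall>e>0. \<exists>N. \<forall>i\<ge>N. \<forall>j\<ge>N. delta F (s i) (s j) < e)"

definition dclass :: "complex set \<Rightarrow> (nat \<Rightarrow> lpt) \<Rightarrow> (nat \<Rightarrow> lpt) set" where
  "dclass F s = {t. dcauchy F t \<and> (\<lambda>k. delta F (s k) (t k)) \<longlonglongrightarrow> 0}"

definition drep :: "(nat \<Rightarrow> lpt) set \<Rightarrow> nat \<Rightarrow> lpt" where
  "drep A = (SOME s. s \<in> A)"

definition CG :: "complex set \<Rightarrow> (nat \<Rightarrow> lpt) set ortholattice" where
  "CG F = \<lparr> ocarrier = {dclass F s | s. dcauchy F s},
     ojoin = (\<lambda>A B. dclass F (\<lambda>k. pjoin F (drep A k) (drep B k))),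
     omeet = (\<lambda>A B. dclass F (\<lambda>k. pmeet F (drep A k) (drep B k))),
     ocompl = (\<lambda>A. dclass F (\<lambda>k. pcompl F (drep A k))),
     ozero = dclass F (\<lambda>k. pzero),
     oone = dclass F (\<lambda>k. pone F) \<rparr>"

text \<open>L (with cocone maps phi) is the direct limit of the direct system (LF F (d n), f n):
  all connecting maps and cocone maps are ortholattice embeddings, the cocone is compatible,
  and L is the union of the images. For systems of embeddings this characterizes the
  direct limit up to isomorphism.\<close>

definition is_LF_direct_limit ::
  "complex set \<Rightarrow> (nat \<Rightarrow> nat) \<Rightarrow> (nat \<Rightarrow> (nat \<Rightarrow> complex) set \<Rightarrow> (nat \<Rightarrow> complex) set)
    \<Rightarrow> 'b ortholattice \<Rightarrow> (nat \<Rightarrow> (nat \<Rightarrow> complex) set \<Rightarrow> 'b) \<Rightarrow> bool" where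
  "is_LF_direct_limit F d f L \<phi> \<longleftrightarrow>
     is_ortholattice L \<and>
     (\<forall>n. ol_emb (LF F (d n)) (LF F (d (Suc n))) (f n)) \<and>
     (\<forall>n. ol_emb (LF F (d n)) L (\<phi> n)) \<and>
     (\<forall>n. \<forall>X\<in>ocarrier (LF F (d n)). \<phi> (Suc n) (f n X) = \<phi> n X) \<and>
     ocarrier L = (\<Union>n. \<phi> n ` ocarrier (LF F (d n)))"

end

theory Submission
  imports Defs "HOL-Library.Function_Algebras"
begin

text \<open>
  By orthomodularity an identity \<open>s = t\<close> fails at some subspaces iff \<open>(s \<or> t) \<and> (s \<and> t)'\<close> contains a
  nonzero vector \<open>v\<close>. Pushing complements to the variables, this says that there are finitely many
  vectors, subject to additive relations and to the orthogonality of those taken from \<open>X\<^sub>i\<close> to those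
  taken from \<open>X\<^sub>i'\<close>, from which \<open>v\<close> is built. Such a configuration survives enlarging the field or
  the dimension, and passing from \<open>\<complex>\<^sup>d\<close> to \<open>\<real>\<^bsup>2d\<^esup>\<close>.

  To move it from the reals to the real algebraic numbers, finitely many reals are approximated by
  sequences of algebraic numbers that satisfy eventually all polynomial relations of their limits:
  the reals are treated one after the other; one that is transcendental over the previous ones may
  be approximated by any rationals, and otherwise it is a simple root of its minimal relation, so
  the perturbed relations have nearby roots by the intermediate value theorem.

  For the continuous geometry, the lattice operations are Lipschitz for the dimension metric, so terms
  can be evaluated on representing Cauchy sequences, and two terms agreeing at every finite level have
  distance \<open>0\<close>.
\<close>

section \<open>Real algebraic numbers\<close>

text \<open>A complement is a condition on all vectors of a subspace, which a map defined on
  finitely many vectors cannot preserve. At the variables it is therefore weakened to orthogonality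
  of two sets; genuine complementary subspaces reappear by taking orthogonal complements of these
  sets. What remains is existential and speaks only of sums, vanishing inner products and one
  nonzero vector. Scalars do not occur, so a transferring map need only be additive on the vectors
  involved.

  The detour through the reals is forced: \<open>F\<close> may lack the imaginary unit, and
  conjugation in the inner product is not polynomial in complex coordinates. In real and imaginary
  parts orthogonality becomes polynomial, at the price of doubling the dimension.

  A failure in one dimension persists in all larger ones, so any unbounded family of dimensions
  decides an identity. This reduces (2) and (3) to comparison with finite levels, where the finitely
  many variables of an identity are brought to a common level.\<close>

interpretation rat_vs: vector_space "\<lambda>(r::rat) (x::real). of_rat r * x"
  by unfold_locales (simp_all add: algebra_simps of_rat_add of_rat_mult)

text \<open>Finite-dimensional rational subalgebras of the reals. A real is algebraic exactly when
  it lies in one, so closure properties of algebraic numbers reduce to enlarging such an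
  algebra.\<close>

definition finite_dim_algebra :: "real set \<Rightarrow> bool" where
  "finite_dim_algebra E \<longleftrightarrow>
     1 \<in> E \<and> (\<forall>x\<in>E. \<forall>y\<in>E. x * y \<in> E) \<and> (\<exists>T. finite T \<and> E = rat_vs.span T)"

lemma subspace_mult_preimage: "rat_vs.subspace {u. u * v \<in> rat_vs.span T}"
  unfolding rat_vs.subspace_def
  using rat_vs.span_scale[of "_ * v" T]
  by (auto simp: distrib_right mult.assoc intro: rat_vs.span_zero rat_vs.span_add)

text \<open>Multiplication is bilinear, so minimality of the span is applied to one factor after the
  other.\<close>

lemma span_mult_closed:
  fixes T :: "real set"
  assumes "\<And>a b. a \<in> T \<Longrightarrow> b \<in> T \<Longrightarrow> a * b \<in> rat_vs.span T"
    and "x \<in> rat_vs.span T" "y \<in> rat_vs.span T"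
  shows "x * y \<in> rat_vs.span T"
proof -
  note sub = subspace_mult_preimage[of _ T]
  have 1: "u * b \<in> rat_vs.span T" if "b \<in> T" "u \<in> rat_vs.span T" for u b
    using rat_vs.span_minimal[OF _ sub[of b], of T] that assms(1) by auto
  have "rat_vs.span T \<subseteq> {u. u * x \<in> rat_vs.span T}"
    by (rule rat_vs.span_minimal[OF _ sub]) (use 1 assms(2) in \<open>auto simp: mult.commute\<close>)
  then show ?thesis using assms(3) by (auto simp: mult.commute)
qed

text \<open>A monic relation rewrites every power of \<open>z\<close> through those below
  \<open>n\<close>, so the products of generators of \<open>E\<close> with these powers span a
  ring.\<close>

lemma finite_dim_algebra_extend:
  assumes E: "finite_dim_algebra E" and e: "\<And>i. i < n \<Longrightarrow> e i \<in> E"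
    and z: "z ^ n = (\<Sum>i<n. e i * z ^ i)"
  shows "\<exists>E'. finite_dim_algebra E' \<and> E \<subseteq> E' \<and> z \<in> E'"
proof -
  obtain T where T: "finite T" "E = rat_vs.span T" using E by (auto simp: finite_dim_algebra_def)
  define T' where "T' = (\<lambda>(t, i). t * z ^ i) ` (T \<times> {..<n})"
  have mem: "x * z ^ i \<in> rat_vs.span T'" if "x \<in> E" for x i
    using that
  proof (induction i arbitrary: x rule: less_induct)
    case (less i)
    show ?case
    proof (cases "i < n")
      case True
      note subspace_mult_preimage[of "z ^ i" T']
      moreover have "T \<subseteq> {u. u * z ^ i \<in> rat_vs.span T'}"
        using True by (auto simp: T'_def intro!: rat_vs.span_base)
      ultimately show ?thesis using rat_vs.span_minimal less.prems T(2) by blast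
    next
      case False
      \<comment> \<open>The exponents drop below \<open>i\<close> at the cost of new coefficients
        \<open>x * e j\<close>, hence the induction with arbitrary \<open>x\<close> in
        \<open>E\<close>.\<close>
      have "x * z ^ i = x * z ^ (i - n) * z ^ n"
        using False by (simp add: mult.assoc flip: power_add)
      also have "\<dots> = (\<Sum>j<n. (x * e j) * z ^ (i - n + j))"
        unfolding z by (simp add: sum_distrib_left power_add algebra_simps)
      also have "\<dots> \<in> rat_vs.span T'"
      proof (rule rat_vs.span_sum)
        fix j assume "j \<in> {..<n}"
        then show "(x * e j) * z ^ (i - n + j) \<in> rat_vs.span T'"
          using False less.prems e E by (intro less.IH) (auto simp: finite_dim_algebra_def)
      qed
      finally show ?thesis .
    qed
  qed
  have TE: "T \<subseteq> E" using T(2) rat_vs.span_superset by blast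
  have "a * b \<in> rat_vs.span T'" if ab: "a \<in> T'" "b \<in> T'" for a b
  proof -
    obtain t i u j where "a = t * z ^ i" "b = u * z ^ j" "t \<in> E" "u \<in> E"
      using ab TE unfolding T'_def by fast
    then have "a * b = (t * u) * z ^ (i + j)" "t * u \<in> E"
      using E by (auto simp: power_add finite_dim_algebra_def)
    then show ?thesis using mem[of "t * u" "i + j"] by (simp only:)
  qed
  from span_mult_closed[OF this] have "finite_dim_algebra (rat_vs.span T')"
    unfolding finite_dim_algebra_def using mem[of 1 0] E T(1)
    by (intro conjI ballI exI[of _ T']) (auto simp: T'_def finite_dim_algebra_def)
  moreover have "E \<subseteq> rat_vs.span T'" using mem[of _ 0] by auto
  moreover have "z \<in> rat_vs.span T'" using mem[of 1 1] E by (auto simp: finite_dim_algebra_def)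
  ultimately show ?thesis by blast
qed

lemma finite_dim_algebra_power:
  "finite_dim_algebra E \<Longrightarrow> x \<in> E \<Longrightarrow> x ^ n \<in> E"
  by (induction n) (auto simp: finite_dim_algebra_def)

text \<open>One more power of \<open>x\<close> than there are generators must be linearly dependent,
  and a dependence is an annihilating polynomial.\<close>

lemma finite_dim_algebra_algebraic:
  assumes E: "finite_dim_algebra E" and x: "x \<in> E"
  shows "algebraic x"
proof -
  obtain T where T: "finite T" "E = rat_vs.span T" using E by (auto simp: finite_dim_algebra_def)
  define S where "S = (\<lambda>i. x ^ i) ` {..card T}"
  show ?thesis
  proof (cases "inj_on (\<lambda>i. x ^ i) {..card T}")
    case True
    then have "card S = Suc (card T)" by (simp add: S_def card_image)
    moreover have "S \<subseteq> rat_vs.span T" using finite_dim_algebra_power[OF E x] T(2) by (auto simp: S_def)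
    ultimately have "rat_vs.dependent S" using rat_vs.independent_span_bound[OF T(1), of S] by auto
    moreover have "finite S" by (simp add: S_def)
    ultimately obtain u v where u: "v \<in> S" "u v \<noteq> 0" "(\<Sum>v\<in>S. of_rat (u v) * v) = 0"
      using rat_vs.dependent_finite by auto
    have s: "(\<Sum>i\<le>card T. of_rat (u (x ^ i)) * x ^ i) = 0"
      using u(3) unfolding S_def by (simp add: sum.reindex[OF True])
    define p where "p = (\<Sum>i\<le>card T. monom (of_rat (u (x ^ i)) :: real) i)"
    have c: "coeff p i = (if i \<le> card T then of_rat (u (x ^ i)) else 0)" for i
      by (simp add: p_def coeff_sum if_distrib sum.delta cong: if_cong)
    have "poly p x = 0" using s by (simp add: p_def poly_sum poly_monom)
    moreover have "p \<noteq> 0"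
    proof -
      obtain i where "i \<le> card T" "v = x ^ i" using u(1) by (auto simp: S_def)
      then have "coeff p i \<noteq> 0" using u(2) c by simp
      then show ?thesis by auto
    qed
    ultimately show ?thesis by (intro algebraicI'[of p]) (auto simp: c)
  next
    case False
    \<comment> \<open>Coinciding powers collapse in the set \<open>S\<close>, but their difference
      already annihilates \<open>x\<close>.\<close>
    then obtain i j where ij: "x ^ i = x ^ j" "i \<noteq> j" by (auto simp: inj_on_def)
    show ?thesis
    proof (rule algebraicI'[of "monom 1 i - monom 1 j"])
      have "coeff (monom 1 i - monom 1 j :: real poly) i = 1" using ij by (simp add: coeff_monom)
      then show "monom 1 i - monom (1::real) j \<noteq> 0" by (metis coeff_0 zero_neq_one)
    qed (use ij in \<open>auto simp: poly_monom coeff_monom\<close>)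
  qed
qed

lemma finite_dim_algebra_Rats: "finite_dim_algebra E \<Longrightarrow> r \<in> \<rat> \<Longrightarrow> r \<in> E"
  unfolding finite_dim_algebra_def Rats_def
  using rat_vs.span_scale[of 1] by fastforce

text \<open>Division by the leading coefficient makes the relation monic. Its inverse is required in
  \<open>E\<close> because \<open>finite_dim_algebra\<close> only provides a ring.\<close>

lemma finite_dim_algebra_root:
  assumes E: "finite_dim_algebra E" and "\<And>i. i \<le> n \<Longrightarrow> c i \<in> E" and "inverse (c n) \<in> E"
    and "c n \<noteq> 0" and r: "(\<Sum>i\<le>n. c i * x ^ i) = 0"
  shows "\<exists>E'. finite_dim_algebra E' \<and> E \<subseteq> E' \<and> x \<in> E'"
proof (rule finite_dim_algebra_extend[OF E, where n = n and e = "\<lambda>i. (-1) * (c i * inverse (c n))"])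
  show "(-1) * (c i * inverse (c n)) \<in> E" if "i < n" for i
    using assms that finite_dim_algebra_Rats[OF E, of "-1"]
    unfolding finite_dim_algebra_def by (meson Rats_1 Rats_minus_iff less_imp_le)
  have "c n * x ^ n = - (\<Sum>i<n. c i * x ^ i)"
    using r by (simp add: lessThan_Suc_atMost[symmetric])
  then have "x ^ n = inverse (c n) * - (\<Sum>i<n. c i * x ^ i)"
    using assms(4) by (simp add: field_simps)
  then show "x ^ n = (\<Sum>i<n. (-1) * (c i * inverse (c n)) * x ^ i)"
    by (simp add: sum_distrib_left sum_negf[symmetric] algebra_simps)
qed

lemma finite_dim_algebra_insert_algebraic:
  assumes E: "finite_dim_algebra E" and "algebraic x"
  shows "\<exists>E'. finite_dim_algebra E' \<and> E \<subseteq> E' \<and> x \<in> E'"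
proof -
  obtain p where p: "\<And>i. coeff p i \<in> \<rat>" "p \<noteq> 0" "poly p x = 0"
    using \<open>algebraic x\<close> unfolding algebraic_altdef by blast
  show ?thesis
    using finite_dim_algebra_root[OF E, of "degree p" "coeff p" x] p
      finite_dim_algebra_Rats[OF E p(1)] finite_dim_algebra_Rats[OF E Rats_inverse[OF p(1)]]
    by (simp add: poly_altdef)
qed

lemma finite_dim_algebra_finite_algebraic:
  assumes "finite S" "\<And>x. x \<in> S \<Longrightarrow> algebraic x"
  shows "\<exists>E. finite_dim_algebra E \<and> S \<subseteq> E"
  using assms
proof (induction S rule: finite_induct)
  case empty
  have "finite_dim_algebra (rat_vs.span {1})"
    unfolding finite_dim_algebra_def using span_mult_closed[of "{1}"]
    by (auto intro: rat_vs.span_base)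
  then show ?case by blast
next
  case (insert x S)
  then obtain E where E: "finite_dim_algebra E" "S \<subseteq> E" by auto
  then show ?case using finite_dim_algebra_insert_algebraic[OF E(1), of x] insert.prems by blast
qed

lemma algebraic_real_add: fixes x y :: real assumes "algebraic x" "algebraic y" shows "algebraic (x + y)"
proof -
  obtain E where E: "finite_dim_algebra E" "{x, y} \<subseteq> E"
    using finite_dim_algebra_finite_algebraic[of "{x, y}"] assms by auto
  then have "x + y \<in> E" by (auto simp: finite_dim_algebra_def intro: rat_vs.span_add)
  then show ?thesis using E finite_dim_algebra_algebraic by blast
qed

lemma algebraic_real_mult: fixes x y :: real assumes "algebraic x" "algebraic y" shows "algebraic (x * y)"
proof -
  obtain E where E: "finite_dim_algebra E" "{x, y} \<subseteq> E"
    using finite_dim_algebra_finite_algebraic[of "{x, y}"] assms by auto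
  then have "x * y \<in> E" by (auto simp: finite_dim_algebra_def)
  then show ?thesis using E finite_dim_algebra_algebraic by blast
qed

text \<open>The coefficients together with the inverse of the leading one lie in a common
  finite-dimensional algebra, which the root enlarges. This keeps the roots of perturbed relations
  algebraic.\<close>

lemma algebraic_real_root:
  fixes c :: "nat \<Rightarrow> real"
  assumes "\<And>i. i \<le> n \<Longrightarrow> algebraic (c i)" "c n \<noteq> 0" "(\<Sum>i\<le>n. c i * x ^ i) = 0"
  shows "algebraic x"
proof -
  obtain E where E: "finite_dim_algebra E" "insert (inverse (c n)) (c ` {..n}) \<subseteq> E"
    using finite_dim_algebra_finite_algebraic[of "insert (inverse (c n)) (c ` {..n})"] assms(1)
    by fastforce
  then obtain E' where "finite_dim_algebra E'" "x \<in> E'"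
    using finite_dim_algebra_root[OF E(1), of n c x] assms by auto
  then show ?thesis using finite_dim_algebra_algebraic by blast
qed

section \<open>Specialising real numbers to algebraic ones\<close>

lemma fun_power_apply: "(f ^ n) x = (f x :: 'a :: comm_monoid_mult) ^ n"
  by (induction n) auto

lemma fun_sum_apply: "(\<Sum>i\<in>I. f i) x = (\<Sum>i\<in>I. f i x :: 'a :: comm_monoid_add)"
  by (induction I rule: infinite_finite_induct) auto

text \<open>Rings of sequences whose limits determine them up to finitely many terms: every polynomial
  relation between the limits of such sequences then holds at all late indices.\<close>

definition faithful_limit_ring :: "(nat \<Rightarrow> real) set \<Rightarrow> bool" where
  "faithful_limit_ring A \<longleftrightarrow>
     1 \<in> A \<and> (\<forall>a\<in>A. \<forall>b\<in>A. a + b \<in> A \<and> a - b \<in> A \<and> a * b \<in> A) \<and>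
     (\<forall>a\<in>A. (\<forall>k. algebraic (a k)) \<and> convergent a \<and>
        (lim a = 0 \<longrightarrow> (\<forall>\<^sub>F k in sequentially. a k = 0)))"

lemma faithful_limit_ringD:
  assumes "faithful_limit_ring A"
  shows "1 \<in> A" "a \<in> A \<Longrightarrow> b \<in> A \<Longrightarrow> a + b \<in> A" "a \<in> A \<Longrightarrow> b \<in> A \<Longrightarrow> a - b \<in> A"
    "a \<in> A \<Longrightarrow> b \<in> A \<Longrightarrow> a * b \<in> A" "a \<in> A \<Longrightarrow> algebraic (a k)"
    "a \<in> A \<Longrightarrow> a \<longlonglongrightarrow> lim a"
    "a \<in> A \<Longrightarrow> lim a = 0 \<Longrightarrow> \<forall>\<^sub>F k in sequentially. a k = 0"
  using assms by (auto simp: faithful_limit_ring_def convergent_LIMSEQ_iff)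

lemma faithful_limit_ring_closed:
  assumes A: "faithful_limit_ring A"
  shows "0 \<in> A" "of_nat n \<in> A" "(\<And>i. i \<in> I \<Longrightarrow> f i \<in> A) \<Longrightarrow> sum f I \<in> A"
proof -
  show 0: "0 \<in> A" using faithful_limit_ringD(3)[OF A, of 1 1] faithful_limit_ringD(1)[OF A] by simp
  show "of_nat n \<in> A"
    by (induction n) (simp_all only: of_nat_0 of_nat_Suc 0 faithful_limit_ringD(1,2)[OF A])
  show "(\<And>i. i \<in> I \<Longrightarrow> f i \<in> A) \<Longrightarrow> sum f I \<in> A"
    by (induction I rule: infinite_finite_induct) (use 0 faithful_limit_ringD(2)[OF A] in auto)
qed

lemma faithful_limit_ring_base: "faithful_limit_ring (range (\<lambda>n k. real_of_int n))"
  unfolding faithful_limit_ring_def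
proof (intro conjI ballI)
  let ?A = "range (\<lambda>n (k::nat). real_of_int n)"
  show "1 \<in> ?A" by (auto simp: image_iff fun_eq_iff intro!: exI[of _ 1])
  fix a b assume "a \<in> ?A" "b \<in> ?A"
  then obtain m n where "a = (\<lambda>k. of_int m)" "b = (\<lambda>k. of_int n)" by auto
  then show "a + b \<in> ?A" "a - b \<in> ?A" "a * b \<in> ?A"
    by (auto simp: image_iff fun_eq_iff intro: exI[of _ "m + n"] exI[of _ "m - n"] exI[of _ "m * n"])
next
  fix a :: "nat \<Rightarrow> real" assume "a \<in> range (\<lambda>n k. real_of_int n)"
  then obtain m where "a = (\<lambda>k. of_int m)" by auto
  then show "\<forall>k. algebraic (a k)" "convergent a" "lim a = 0 \<longrightarrow> (\<forall>\<^sub>F k in sequentially. a k = 0)"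
    by (auto intro: rat_imp_algebraic convergent_const)
qed

text \<open>The ring \<open>A[g]\<close> consists of the values at \<open>g\<close> of polynomials
  whose coefficients are sequences in \<open>A\<close>. Convergence and algebraicity are inherited,
  so faithfulness is the only real condition; it is the assumption \<open>vanish\<close>.\<close>

lemma faithful_limit_ring_adjoin:
  assumes A: "faithful_limit_ring A" and g: "\<And>k. algebraic (g k)" "g \<longlonglongrightarrow> y"
    and vanish: "\<And>m d. (\<And>i. d i \<in> A) \<Longrightarrow> (\<Sum>i\<le>m. lim (d i) * y ^ i) = 0 \<Longrightarrow>
            \<forall>\<^sub>F k in sequentially. (\<Sum>i\<le>m. d i k * g k ^ i) = 0"
  shows "\<exists>A'. faithful_limit_ring A' \<and> A \<subseteq> A' \<and> g \<in> A'"
proof -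
  define A' where "A' = {poly p g | p. \<forall>i. coeff p i \<in> A}"
  note D = faithful_limit_ringD[OF A] and C = faithful_limit_ring_closed[OF A]
  have app: "poly p g k = (\<Sum>i\<le>degree p. coeff p i k * g k ^ i)" for p k
    by (simp add: poly_altdef fun_sum_apply fun_power_apply)
  have A'I: "\<And>p. \<forall>i. coeff p i \<in> A \<Longrightarrow> poly p g \<in> A'" by (auto simp: A'_def)
  have "faithful_limit_ring A'"
    unfolding faithful_limit_ring_def
  proof (intro conjI ballI)
    show "1 \<in> A'" using A'I[of 1] D(1) C(1) by (simp add: coeff_1)
  next
    fix a b assume "a \<in> A'" "b \<in> A'"
    then obtain p q where p: "a = poly p g" "\<forall>i. coeff p i \<in> A" and q: "b = poly q g" "\<forall>i. coeff q i \<in> A"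
      by (auto simp: A'_def)
    show "a + b \<in> A'" using A'I[of "p + q"] p q D(2) by simp
    show "a - b \<in> A'" using A'I[of "p - q"] p q D(3) by simp
    show "a * b \<in> A'" using A'I[of "p * q"] p q D(4) by (simp add: coeff_mult C(3))
  next
    fix a assume "a \<in> A'"
    then obtain p where p: "a = poly p g" "\<forall>i. coeff p i \<in> A" by (auto simp: A'_def)
    have alg_sum: "algebraic (\<Sum>i\<in>I. f i :: real)" if "\<And>i. i \<in> I \<Longrightarrow> algebraic (f i)" for f and I :: "nat set"
      using that by (induction I rule: infinite_finite_induct) (auto intro: algebraic_real_add)
    have alg_pow: "algebraic (x ^ n)" if "algebraic x" for x :: real and n
      using that by (induction n) (auto intro: algebraic_real_mult rat_imp_algebraic)
    show "\<forall>k. algebraic (a k)"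
      using p D(5) g(1) by (auto simp: app intro!: alg_sum algebraic_real_mult alg_pow)
    have "(\<lambda>k. poly p g k) \<longlonglongrightarrow> (\<Sum>i\<le>degree p. lim (coeff p i) * y ^ i)"
      unfolding app using p D(6) g(2) by (intro tendsto_intros) auto
    then have l: "a \<longlonglongrightarrow> (\<Sum>i\<le>degree p. lim (coeff p i) * y ^ i)" by (simp add: p)
    then show "convergent a" by (auto simp: convergent_def)
    show "lim a = 0 \<longrightarrow> (\<forall>\<^sub>F k in sequentially. a k = 0)"
      using vanish[of "coeff p" "degree p"] p limI[OF l] by (auto simp: app)
  qed
  moreover have "a \<in> A'" if "a \<in> A" for a
    using A'I[of "[:a:]"] that C(1) by (auto simp: coeff_pCons split: nat.splits)
  moreover have "g \<in> A'"
    using A'I[of "[:0, 1:]"] D(1) C(1) by (auto simp: coeff_pCons split: nat.splits)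
  ultimately show ?thesis by blast
qed

section \<open>Approximating sequences and perturbed roots\<close>

lemma choose_convergent_near:
  fixes y :: real
  assumes "\<And>e. e > 0 \<Longrightarrow> \<forall>\<^sub>F k in sequentially. \<exists>x. \<bar>x - y\<bar> < e \<and> R k x"
  shows "\<exists>g. g \<longlonglongrightarrow> y \<and> (\<forall>k. R k (g k) \<or> g k = 0) \<and> (\<forall>\<^sub>F k in sequentially. R k (g k))"
proof -
  \<comment> \<open>A best choice of \<open>x\<close> for index \<open>k\<close> may not exist,
    since the infimum of the distances need not be attained; a choice optimal up to
    \<open>1 / Suc k\<close> works for every tolerance at once.\<close>
  have ex: "\<exists>x. R k x \<and> (\<forall>x'. R k x' \<longrightarrow> \<bar>x - y\<bar> \<le> \<bar>x' - y\<bar> + 1 / real (Suc k))" if "\<exists>x. R k x" for k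
  proof -
    define S where "S = {\<bar>x - y\<bar> | x. R k x}"
    have S: "S \<noteq> {}" "bdd_below S" using that by (auto simp: S_def intro!: bdd_belowI[of _ 0])
    have "Inf S < Inf S + 1 / real (Suc k)" by simp
    from cInf_lessD[OF S(1) this] obtain x where "R k x" "\<bar>x - y\<bar> < Inf S + 1 / real (Suc k)"
      by (auto simp: S_def)
    moreover have "Inf S \<le> \<bar>x' - y\<bar>" if "R k x'" for x'
      using that S(2) by (intro cInf_lower) (auto simp: S_def)
    ultimately show ?thesis by (intro exI[of _ x]) force
  qed
  \<comment> \<open>The default 0 at indices without a solution is algebraic, so a sequence of
    algebraic solutions is algebraic at every index and not just eventually.\<close>
  define g where "g k = (if \<exists>x. R k x
     then SOME x. R k x \<and> (\<forall>x'. R k x' \<longrightarrow> \<bar>x - y\<bar> \<le> \<bar>x' - y\<bar> + 1 / real (Suc k)) else 0)" for k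
  have g: "R k (g k)" "R k x' \<Longrightarrow> \<bar>g k - y\<bar> \<le> \<bar>x' - y\<bar> + 1 / real (Suc k)" if "\<exists>x. R k x" for k x'
    using someI_ex[OF ex[OF that]] that by (auto simp: g_def)
  have "g \<longlonglongrightarrow> y"
  proof (rule tendstoI)
    fix e :: real assume e: "e > 0"
    have "\<forall>\<^sub>F k in sequentially. 1 / real (Suc k) < e / 2"
      using e order_tendstoD(2)[OF LIMSEQ_inverse_real_of_nat, of "e/2"] by (simp add: inverse_eq_divide)
    with assms[of "e/2"] e have "\<forall>\<^sub>F k in sequentially.
        (\<exists>x. \<bar>x - y\<bar> < e/2 \<and> R k x) \<and> 1 / real (Suc k) < e / 2"
      by (simp add: eventually_conj_iff)
    then show "\<forall>\<^sub>F k in sequentially. dist (g k) y < e"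
    proof eventually_elim
      case (elim k)
      then obtain x where "\<bar>x - y\<bar> < e/2" "R k x" by blast
      then show ?case using g(2)[of k x] elim by (force simp: dist_real_def)
    qed
  qed
  moreover have "\<forall>k. R k (g k) \<or> g k = 0"
    using g(1) by (auto simp: g_def)
  moreover have "\<forall>\<^sub>F k in sequentially. R k (g k)"
    using assms[of 1] by (auto elim!: eventually_mono intro: g(1))
  ultimately show ?thesis by blast
qed

lemma rational_sequence_exists: "\<exists>g. g \<longlonglongrightarrow> (y::real) \<and> (\<forall>k. g k \<in> \<rat>)"
proof -
  have "\<exists>x. \<bar>x - y\<bar> < e \<and> x \<in> \<rat>" if "e > 0" for e
    using Rats_dense_in_real[of "y" "y + e"] that by force
  then show ?thesis using choose_convergent_near[of y "\<lambda>k x. x \<in> \<rat>"] by force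
qed

text \<open>A positive derivative makes the limit polynomial change sign between
  \<open>y - t\<close> and \<open>y + t\<close>. The two strict signs survive small perturbations of
  the coefficients, and the intermediate value theorem gives a root in between.\<close>

lemma perturbed_increasing_root:
  fixes c :: "nat \<Rightarrow> nat \<Rightarrow> real"
  assumes c: "\<And>i. c i \<longlonglongrightarrow> l i" and root: "(\<Sum>i\<le>n. l i * y ^ i) = 0"
    and simple: "(\<Sum>i\<le>n. l i * (of_nat i * y ^ (i - 1))) > 0" and e: "e > 0"
  shows "\<forall>\<^sub>F k in sequentially. \<exists>x. \<bar>x - y\<bar> < e \<and> (\<Sum>i\<le>n. c i k * x ^ i) = 0"
proof -
  define h where "h x = (\<Sum>i\<le>n. l i * x ^ i)" for x
  have h': "(h has_field_derivative (\<Sum>i\<le>n. l i * (of_nat i * y ^ (i - 1)))) (at y)"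
    unfolding h_def by (auto intro!: derivative_eq_intros sum.cong)
  obtain d1 where d1: "d1 > 0" "\<And>t. t > 0 \<Longrightarrow> t < d1 \<Longrightarrow> h y < h (y + t)"
    using DERIV_pos_inc_right[OF h' simple] by auto
  obtain d2 where d2: "d2 > 0" "\<And>t. t > 0 \<Longrightarrow> t < d2 \<Longrightarrow> h (y - t) < h y"
    using DERIV_pos_inc_left[OF h' simple] by auto
  define t where "t = min e (min d1 d2) / 2"
  have t: "0 < t" "t < d1" "t < d2" "t < e" using d1(1) d2(1) e by (auto simp: t_def)
  have hy: "h y = 0" using root by (simp add: h_def)
  have lim: "(\<lambda>k. \<Sum>i\<le>n. c i k * x ^ i) \<longlonglongrightarrow> h x" for x
    unfolding h_def by (intro tendsto_intros c)
  have "\<forall>\<^sub>F k in sequentially. (\<Sum>i\<le>n. c i k * (y - t) ^ i) < 0"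
    using order_tendstoD(2)[OF lim] d2(2)[of t] t hy by auto
  moreover have "\<forall>\<^sub>F k in sequentially. (\<Sum>i\<le>n. c i k * (y + t) ^ i) > 0"
    using order_tendstoD(1)[OF lim] d1(2)[of t] t hy by auto
  ultimately show ?thesis
  proof eventually_elim
    case (elim k)
    have "\<exists>x\<ge>y - t. x \<le> y + t \<and> (\<Sum>i\<le>n. c i k * x ^ i) = 0"
      by (rule IVT') (use elim t in \<open>auto intro!: continuous_intros\<close>)
    then show ?case using t by force
  qed
qed

lemma perturbed_simple_root:
  fixes c :: "nat \<Rightarrow> nat \<Rightarrow> real"
  assumes c: "\<And>i. c i \<longlonglongrightarrow> l i" and root: "(\<Sum>i\<le>n. l i * y ^ i) = 0"
    and simple: "(\<Sum>i\<le>n. l i * (of_nat i * y ^ (i - 1))) \<noteq> 0" and e: "e > 0"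
  shows "\<forall>\<^sub>F k in sequentially. \<exists>x. \<bar>x - y\<bar> < e \<and> (\<Sum>i\<le>n. c i k * x ^ i) = 0"
proof (cases "(\<Sum>i\<le>n. l i * (of_nat i * y ^ (i - 1))) > 0")
  case True
  then show ?thesis using perturbed_increasing_root[OF c root _ e] by blast
next
  case False
  have "\<forall>\<^sub>F k in sequentially. \<exists>x. \<bar>x - y\<bar> < e \<and> (\<Sum>i\<le>n. - c i k * x ^ i) = 0"
    by (rule perturbed_increasing_root[of "\<lambda>i k. - c i k" "\<lambda>i. - l i"])
      (use False simple root e in \<open>auto simp: sum_negf intro: tendsto_minus[OF c]\<close>)
  then show ?thesis by (simp add: sum_negf)
qed

text \<open>If the top coefficient had a nonzero limit, \<open>d\<close> itself would be an excluded
  relation; so it drops out and the degree decreases.\<close>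

lemma lim_coeffs_zero_if_no_relation:
  assumes "\<And>j. j \<le> m \<Longrightarrow>
      \<not> (\<exists>c. (\<forall>i. c i \<in> A) \<and> lim (c j) \<noteq> 0 \<and> (\<Sum>i\<le>j. lim (c i) * (y::real) ^ i) = 0)"
    and "\<And>i. d i \<in> A" and "(\<Sum>i\<le>m. lim (d i) * y ^ i) = 0"
  shows "\<forall>i\<le>m. lim (d i) = 0"
  using assms
proof (induction m)
  case 0
  then show ?case by auto
next
  case (Suc m)
  have z: "lim (d (Suc m)) = 0" using Suc.prems(1)[of "Suc m"] Suc.prems(2,3) by blast
  then have "\<forall>i\<le>m. lim (d i) = 0" using Suc.prems by (intro Suc.IH) auto
  then show ?case using z le_Suc_eq by auto
qed

text \<open>A relation of minimal degree plays the role of the minimal polynomial of \<open>y\<close>; pseudo-division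
  by it reduces every vanishing polynomial expression in \<open>y\<close> to one of smaller degree.\<close>

lemma faithful_limit_ring_extend:
  assumes A: "faithful_limit_ring A"
  shows "\<exists>A' g. faithful_limit_ring A' \<and> A \<subseteq> A' \<and> g \<in> A' \<and> g \<longlonglongrightarrow> y"
proof -
  note D = faithful_limit_ringD[OF A] and C = faithful_limit_ring_closed[OF A]
  define P where "P n \<longleftrightarrow> (\<exists>c. (\<forall>i. c i \<in> A) \<and> lim (c n) \<noteq> 0 \<and> (\<Sum>i\<le>n. lim (c i) * y ^ i) = 0)" for n
  have low: "\<forall>\<^sub>F k in sequentially. (\<Sum>i\<le>m. d i k * g k ^ i) = 0"
    if "\<And>j. j \<le> m \<Longrightarrow> \<not> P j" "\<And>i. d i \<in> A" "(\<Sum>i\<le>m. lim (d i) * y ^ i) = 0" for m d g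
  proof -
    have "\<forall>i\<le>m. lim (d i) = 0"
      using lim_coeffs_zero_if_no_relation[of m A y d] that unfolding P_def by blast
    then have "\<forall>i\<in>{..m}. \<forall>\<^sub>F k in sequentially. d i k = 0" using D(7) that(2) by auto
    then have "\<forall>\<^sub>F k in sequentially. \<forall>i\<in>{..m}. d i k = 0" by (intro eventually_ball_finite) auto
    then show ?thesis by eventually_elim simp
  qed
  show ?thesis
  proof (cases "\<exists>n. P n")
    case False
    obtain g where "g \<longlonglongrightarrow> y" "\<forall>k. g k \<in> \<rat>" using rational_sequence_exists by blast
    moreover from this have "\<exists>A'. faithful_limit_ring A' \<and> A \<subseteq> A' \<and> g \<in> A'"
      by (intro faithful_limit_ring_adjoin[OF A, of g y])
        (use low False in \<open>auto intro: rat_imp_algebraic\<close>)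
    ultimately show ?thesis by blast
  next
    case True
    define n where "n = (LEAST n. P n)"
    have Pn: "P n" and min: "\<And>j. j < n \<Longrightarrow> \<not> P j"
      using True LeastI_ex not_less_Least unfolding n_def by blast+
    obtain c where c: "\<And>i. c i \<in> A" "lim (c n) \<noteq> 0" "(\<Sum>i\<le>n. lim (c i) * y ^ i) = 0"
      using Pn by (auto simp: P_def)
    have n0: "n > 0" using c by (cases n) auto
    \<comment> \<open>Otherwise the formal derivative would be a relation of degree
      \<open>n - 1\<close>, with leading limit \<open>n\<close> times a nonzero number, against
      minimality.\<close>
    have simple: "(\<Sum>i\<le>n. lim (c i) * (of_nat i * y ^ (i - 1))) \<noteq> 0"
    proof
      assume z: "(\<Sum>i\<le>n. lim (c i) * (of_nat i * y ^ (i - 1))) = 0"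
      define c' where "c' i = of_nat (Suc i) * c (Suc i)" for i
      have "(\<lambda>k. of_nat (Suc i) * c (Suc i) k) \<longlonglongrightarrow> of_nat (Suc i) * lim (c (Suc i))" for i
        by (intro tendsto_intros D(6) c)
      then have lim': "lim (c' i) = of_nat (Suc i) * lim (c (Suc i))" for i
        by (intro limI) (simp add: c'_def times_fun_def of_nat_fun)
      obtain m where m: "n = Suc m" using n0 by (cases n) auto
      have "(\<Sum>i\<le>m. lim (c' i) * y ^ i) = 0"
        using z unfolding m by (subst (asm) sum.atMost_Suc_shift) (simp add: lim' algebra_simps)
      moreover have "lim (c' m) \<noteq> 0" using c(2) m by (simp add: lim')
      moreover have "\<And>i. c' i \<in> A" unfolding c'_def by (intro D(4) C(2) c)
      ultimately have "P m" by (auto simp: P_def)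
      then show False using min m by simp
    qed
    \<comment> \<open>Nonvanishing of the leading coefficient at late indices serves twice: the
      chosen roots become algebraic, and the factor \<open>c n k\<close> can be cancelled after
      pseudo-division.\<close>
    have nz: "\<forall>\<^sub>F k in sequentially. c n k \<noteq> 0"
      using tendsto_imp_eventually_ne[OF D(6)[OF c(1)] c(2)] .
    have "\<forall>\<^sub>F k in sequentially. \<exists>x. \<bar>x - y\<bar> < e \<and> c n k \<noteq> 0 \<and> (\<Sum>i\<le>n. c i k * x ^ i) = 0"
      if "e > 0" for e
      using perturbed_simple_root[OF D(6)[OF c(1)] c(3) simple that] nz
      by eventually_elim auto
    from choose_convergent_near[of y "\<lambda>k x. c n k \<noteq> 0 \<and> (\<Sum>i\<le>n. c i k * x ^ i) = 0", OF this]
    obtain g where g: "g \<longlonglongrightarrow> y" "\<And>k. (c n k \<noteq> 0 \<and> (\<Sum>i\<le>n. c i k * g k ^ i) = 0) \<or> g k = 0"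
      "\<forall>\<^sub>F k in sequentially. c n k \<noteq> 0 \<and> (\<Sum>i\<le>n. c i k * g k ^ i) = 0" by blast
    have alg: "algebraic (g k)" for k
      using g(2)[of k] algebraic_real_root[of n "\<lambda>i. c i k" "g k"] D(5)[OF c(1)] by auto
    have "\<forall>\<^sub>F k in sequentially. (\<Sum>i\<le>m. d i k * g k ^ i) = 0"
      if "\<And>i. d i \<in> A" "(\<Sum>i\<le>m. lim (d i) * y ^ i) = 0" for m d
      using that
    proof (induction m arbitrary: d)
      case 0
      then show ?case using low[of 0 d g] min n0 by auto
    next
      case (Suc m)
      show ?case
      proof (cases "Suc m < n")
        case True
        then show ?thesis using low[of "Suc m" d g] min Suc.prems by force
      next
        case False
        define s where "s = Suc m - n"
        \<comment> \<open>\<open>sh\<close> is the minimal relation shifted so that its leading term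
          has degree \<open>Suc m\<close>. Multiplying \<open>d\<close> by \<open>c n\<close>,
          instead of dividing by it, keeps the coefficients of \<open>d'\<close> in
          \<open>A\<close>.\<close>
        define sh where "sh i = (if i \<ge> s then c (i - s) else 0)" for i
        define d' where "d' i = c n * d i - d (Suc m) * sh i" for i
        have sh: "sh i \<in> A" for i using c(1) C(1) by (simp add: sh_def)
        have d'A: "d' i \<in> A" for i
          unfolding d'_def by (intro D(3,4) c Suc.prems sh)
        have "(\<lambda>k. c n k * d i k - d (Suc m) k * sh i k) \<longlonglongrightarrow>
            lim (c n) * lim (d i) - lim (d (Suc m)) * lim (sh i)" for i
          by (intro tendsto_intros D(6) c Suc.prems sh)
        then have lim': "lim (d' i) = lim (c n) * lim (d i) - lim (d (Suc m)) * lim (sh i)" for i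
          by (intro limI) (simp add: d'_def times_fun_def fun_diff_def)
        have lim0: "lim (0 :: nat \<Rightarrow> real) = 0" by (simp add: zero_fun_def)
        \<comment> \<open>Arbitrary \<open>f\<close>, because the identity is used once with
          \<open>lim\<close> and once with evaluation at an index \<open>k\<close>.\<close>
        have split: "(\<Sum>i\<le>Suc m. f (sh i) * x ^ i) = x ^ s * (\<Sum>i\<le>n. f (c i) * x ^ i)"
          if "f 0 = 0" for f and x :: real
        proof -
          have "(\<Sum>i\<le>Suc m. f (sh i) * x ^ i) = (\<Sum>i\<in>{s..Suc m}. f (sh i) * x ^ i)"
            by (rule sum.mono_neutral_right) (auto simp: sh_def that)
          also have "\<dots> = (\<Sum>i\<le>n. f (sh (i + s)) * x ^ (i + s))"
            using False by (intro sum.reindex_bij_witness[of _ "\<lambda>i. i + s" "\<lambda>i. i - s"]) (auto simp: s_def)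
          also have "\<dots> = x ^ s * (\<Sum>i\<le>n. f (c i) * x ^ i)"
            by (simp add: sh_def sum_distrib_left power_add algebra_simps)
          finally show ?thesis .
        qed
        have top: "sh (Suc m) = c n" using False by (simp add: sh_def s_def)
        have "(\<Sum>i\<le>Suc m. lim (d' i) * y ^ i) =
            lim (c n) * (\<Sum>i\<le>Suc m. lim (d i) * y ^ i) - lim (d (Suc m)) * (\<Sum>i\<le>Suc m. lim (sh i) * y ^ i)"
          unfolding lim' left_diff_distrib sum_subtractf by (simp only: sum_distrib_left mult.assoc)
        also have "\<dots> = 0" using Suc.prems split[of lim y, OF lim0] c(3) by simp
        finally have "(\<Sum>i\<le>m. lim (d' i) * y ^ i) = 0" by (simp add: lim' top)
        from Suc.IH[OF d'A this] g(3) show ?thesis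
        proof eventually_elim
          case (elim k)
          have "(\<Sum>i\<le>Suc m. d' i k * g k ^ i) =
            c n k * (\<Sum>i\<le>Suc m. d i k * g k ^ i) - d (Suc m) k * (\<Sum>i\<le>Suc m. sh i k * g k ^ i)"
            unfolding d'_def fun_diff_def times_fun_apply left_diff_distrib sum_subtractf
            by (simp only: sum_distrib_left mult.assoc)
          moreover have "(\<Sum>i\<le>Suc m. sh i k * g k ^ i) = 0"
            using split[of "\<lambda>a. a k" "g k"] elim by simp
          moreover have "(\<Sum>i\<le>Suc m. d' i k * g k ^ i) = 0"
            using elim by (simp add: d'_def top)
          ultimately show ?case using elim by auto
        qed
      qed
    qed
    then show ?thesis
      using faithful_limit_ring_adjoin[OF A alg g(1)] g(1) by blast
  qed
qed

text \<open>\<open>\<psi>\<close> evaluates the approximating sequences at one late index. Finitely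
  many relations are at stake, so a single index satisfies all of them. Preserving nonzero values
  keeps a nonzero vector nonzero later on.\<close>

lemma finite_real_specialization:
  assumes "finite C"
  shows "\<exists>\<psi> :: real \<Rightarrow> real. (\<forall>x\<in>C. algebraic (\<psi> x)) \<and> (\<forall>x\<in>C. \<psi> x = 0 \<longleftrightarrow> x = 0) \<and>
     (\<forall>x\<in>C. \<forall>y\<in>C. x + y \<in> C \<longrightarrow> \<psi> (x + y) = \<psi> x + \<psi> y) \<and>
     (\<forall>x\<in>C. \<forall>y\<in>C. x * y \<in> C \<longrightarrow> \<psi> (x * y) = \<psi> x * \<psi> y)"
proof -
  have "\<exists>A s. faithful_limit_ring A \<and> (\<forall>x\<in>C. s x \<in> A \<and> s x \<longlonglongrightarrow> x)"
    using assms
  proof (induction C rule: finite_induct)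
    case empty
    then show ?case using faithful_limit_ring_base by blast
  next
    case (insert y C)
    then obtain A s where A: "faithful_limit_ring A" "\<forall>x\<in>C. s x \<in> A \<and> s x \<longlonglongrightarrow> x" by blast
    obtain A' g where A': "faithful_limit_ring A'" "A \<subseteq> A'" "g \<in> A'" "g \<longlonglongrightarrow> y"
      using faithful_limit_ring_extend[OF A(1)] by blast
    show ?case
      by (rule exI[of _ A'], rule exI[of _ "s(y := g)"]) (use A A' in auto)
  qed
  then obtain A s where A: "faithful_limit_ring A" and s: "\<And>x. x \<in> C \<Longrightarrow> s x \<in> A" "\<And>x. x \<in> C \<Longrightarrow> s x \<longlonglongrightarrow> x"
    by blast
  note D = faithful_limit_ringD[OF A]
  have ev: "\<forall>\<^sub>F k in sequentially. a k = 0" if "a \<in> A" "a \<longlonglongrightarrow> 0" for a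
    using D(7)[OF that(1)] limI[OF that(2)] by simp
  have "\<forall>\<^sub>F k in sequentially. s x k = 0 \<longleftrightarrow> x = 0" if "x \<in> C" for x
  proof (cases "x = 0")
    case True
    then show ?thesis using ev[OF s(1)[OF that]] s(2)[OF that] by (auto elim: eventually_mono)
  next
    case False
    then show ?thesis using tendsto_imp_eventually_ne[OF s(2)[OF that]] by (auto elim: eventually_mono)
  qed
  then have 1: "\<forall>\<^sub>F k in sequentially. \<forall>x\<in>C. s x k = 0 \<longleftrightarrow> x = 0"
    using assms by (intro eventually_ball_finite) auto
  have "\<forall>\<^sub>F k in sequentially. x + y \<in> C \<longrightarrow> s (x + y) k = s x k + s y k" if "x \<in> C" "y \<in> C" for x y
  proof (cases "x + y \<in> C")
    case True
    have "(\<lambda>k. s (x + y) k - (s x k + s y k)) \<longlonglongrightarrow> (x + y) - (x + y)"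
      by (intro tendsto_intros s that True)
    then have "\<forall>\<^sub>F k in sequentially. (s (x + y) - (s x + s y)) k = 0"
      using D(2,3) s(1) that True by (intro ev) (auto simp: fun_diff_def plus_fun_def)
    then show ?thesis by (auto elim: eventually_mono)
  qed auto
  then have 2: "\<forall>\<^sub>F k in sequentially. \<forall>x\<in>C. \<forall>y\<in>C. x + y \<in> C \<longrightarrow> s (x + y) k = s x k + s y k"
    using assms by (intro eventually_ball_finite ballI) auto
  have "\<forall>\<^sub>F k in sequentially. x * y \<in> C \<longrightarrow> s (x * y) k = s x k * s y k" if "x \<in> C" "y \<in> C" for x y
  proof (cases "x * y \<in> C")
    case True
    have "(\<lambda>k. s (x * y) k - (s x k * s y k)) \<longlonglongrightarrow> (x * y) - (x * y)"
      by (intro tendsto_intros s that True)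
    then have "\<forall>\<^sub>F k in sequentially. (s (x * y) - (s x * s y)) k = 0"
      using D(3,4) s(1) that True by (intro ev) (auto simp: fun_diff_def times_fun_def)
    then show ?thesis by (auto elim: eventually_mono)
  qed auto
  then have 3: "\<forall>\<^sub>F k in sequentially. \<forall>x\<in>C. \<forall>y\<in>C. x * y \<in> C \<longrightarrow> s (x * y) k = s x k * s y k"
    using assms by (intro eventually_ball_finite ballI) auto
  from 1 2 3 have "\<forall>\<^sub>F k in sequentially. (\<forall>x\<in>C. s x k = 0 \<longleftrightarrow> x = 0) \<and>
     (\<forall>x\<in>C. \<forall>y\<in>C. x + y \<in> C \<longrightarrow> s (x + y) k = s x k + s y k) \<and>
     (\<forall>x\<in>C. \<forall>y\<in>C. x * y \<in> C \<longrightarrow> s (x * y) k = s x k * s y k)"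
    by (simp add: eventually_conj_iff)
  then obtain k where "(\<forall>x\<in>C. s x k = 0 \<longleftrightarrow> x = 0) \<and>
     (\<forall>x\<in>C. \<forall>y\<in>C. x + y \<in> C \<longrightarrow> s (x + y) k = s x k + s y k) \<and>
     (\<forall>x\<in>C. \<forall>y\<in>C. x * y \<in> C \<longrightarrow> s (x * y) k = s x k * s y k)"
    using eventually_happens by force
  then show ?thesis by (intro exI[of _ "\<lambda>x. s x k"]) (use s(1) D(5) in blast)
qed

section \<open>Subspaces over a conjugation-closed subfield\<close>

interpretation cvs: vector_space vsmul
  by unfold_locales (simp_all add: vsmul_def fun_eq_iff algebra_simps)

lemma vadd_eq_plus: "vadd x y = x + y"
  by (simp add: vadd_def plus_fun_def)

lemma vzero_eq_0: "vzero = 0"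
  by (simp add: vzero_def zero_fun_def)

lemma vsmul_apply [simp]: "vsmul c x i = c * x i"
  by (simp add: vsmul_def)

lemma vinner_add_left: "vinner d (x + y) z = vinner d x z + vinner d y z"
  by (simp add: vinner_def sum.distrib algebra_simps)

lemma vinner_diff_left: "vinner d (x - y) z = vinner d x z - vinner d y z"
  by (simp add: vinner_def sum_subtractf algebra_simps)

lemma vinner_scale_left: "vinner d (vsmul c x) z = c * vinner d x z"
  by (simp add: vinner_def sum_distrib_left algebra_simps)

lemma vinner_sum_left: "vinner d (\<Sum>b\<in>B. f b) z = (\<Sum>b\<in>B. vinner d (f b) z)"
  by (simp add: vinner_def fun_sum_apply sum_distrib_right) (rule sum.swap)

lemma vinner_cnj: "cnj (vinner d x y) = vinner d y x"
  by (simp add: vinner_def mult.commute)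

lemma vinner_sym_0: "vinner d x y = 0 \<longleftrightarrow> vinner d y x = 0"
  by (metis complex_cnj_zero_iff vinner_cnj)

lemma vinner_0 [simp]: "vinner d 0 y = 0" "vinner d x 0 = 0"
  by (simp_all add: vinner_def)

lemma vinner_self: "vinner d x x = of_real (\<Sum>i<d. (cmod (x i))\<^sup>2)"
  by (simp add: vinner_def complex_norm_square del: of_real_power)

lemma vinner_self_eq_0:
  assumes "vinner d x x = 0" and "\<And>i. i \<ge> d \<Longrightarrow> x i = 0"
  shows "x = 0"
proof
  fix i
  have "(\<Sum>i<d. (cmod (x i))\<^sup>2) = 0"
    using assms(1) by (simp only: vinner_self of_real_eq_0_iff)
  then show "x i = 0 i" using assms(2)[of i] by (cases "i < d") (auto simp: sum_nonneg_eq_0_iff)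
qed

locale conj_subfield =
  fixes F :: "complex set"
  assumes F: "conj_closed_subfield F"
begin

lemma F_closed [simp]:
  "0 \<in> F" "1 \<in> F" "x \<in> F \<Longrightarrow> y \<in> F \<Longrightarrow> x + y \<in> F" "x \<in> F \<Longrightarrow> y \<in> F \<Longrightarrow> x - y \<in> F"
  "x \<in> F \<Longrightarrow> y \<in> F \<Longrightarrow> x * y \<in> F" "x \<in> F \<Longrightarrow> cnj x \<in> F"
  using F by (auto simp: conj_closed_subfield_def)

lemma F_inverse [simp]: "x \<in> F \<Longrightarrow> inverse x \<in> F"
  using F by (cases "x = 0") (auto simp: conj_closed_subfield_def)

lemma F_divide [simp]: "x \<in> F \<Longrightarrow> y \<in> F \<Longrightarrow> x / y \<in> F"
  by (simp add: divide_inverse)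

lemma F_uminus [simp]: "x \<in> F \<Longrightarrow> - x \<in> F"
  using F_closed(4)[of 0 x] by simp

lemma F_sum [simp]: "(\<And>i. i \<in> I \<Longrightarrow> f i \<in> F) \<Longrightarrow> sum f I \<in> F"
  by (induction I rule: infinite_finite_induct) auto

lemma Fvec_closed [simp]:
  "0 \<in> Fvec F d" "x \<in> Fvec F d \<Longrightarrow> y \<in> Fvec F d \<Longrightarrow> x + y \<in> Fvec F d"
  "x \<in> Fvec F d \<Longrightarrow> y \<in> Fvec F d \<Longrightarrow> x - y \<in> Fvec F d"
  "c \<in> F \<Longrightarrow> x \<in> Fvec F d \<Longrightarrow> vsmul c x \<in> Fvec F d"
  by (auto simp: Fvec_def)

lemma vinner_in_F [simp]: "x \<in> Fvec F d \<Longrightarrow> y \<in> Fvec F d' \<Longrightarrow> vinner m x y \<in> F"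
  by (auto simp: Fvec_def vinner_def)

lemma Fvec_vinner_self: "x \<in> Fvec F d \<Longrightarrow> vinner d x x = 0 \<longleftrightarrow> x = 0"
  using vinner_self_eq_0[of d x] by (auto simp: Fvec_def)

lemma subspace_iff: "Fsubspace F d X \<longleftrightarrow> X \<subseteq> Fvec F d \<and> 0 \<in> X \<and>
     (\<forall>x\<in>X. \<forall>y\<in>X. x + y \<in> X) \<and> (\<forall>c\<in>F. \<forall>x\<in>X. vsmul c x \<in> X)"
  by (simp add: Fsubspace_def vadd_eq_plus vzero_eq_0)

lemma subspaceD:
  assumes "Fsubspace F d X"
  shows "X \<subseteq> Fvec F d" "0 \<in> X" "x \<in> X \<Longrightarrow> y \<in> X \<Longrightarrow> x + y \<in> X" "x \<in> X \<Longrightarrow> y \<in> X \<Longrightarrow> x - y \<in> X"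
    "c \<in> F \<Longrightarrow> x \<in> X \<Longrightarrow> vsmul c x \<in> X" "x \<in> X \<Longrightarrow> x \<in> Fvec F d"
proof -
  show "X \<subseteq> Fvec F d" "0 \<in> X" and a: "\<And>x y. x \<in> X \<Longrightarrow> y \<in> X \<Longrightarrow> x + y \<in> X"
    and b: "\<And>c x. c \<in> F \<Longrightarrow> x \<in> X \<Longrightarrow> vsmul c x \<in> X" and "x \<in> X \<Longrightarrow> x \<in> Fvec F d"
    using assms by (auto simp: subspace_iff)
  have eq: "x - y = x + vsmul (-1) y" by (simp add: fun_eq_iff)
  show "x \<in> X \<Longrightarrow> y \<in> X \<Longrightarrow> x - y \<in> X" unfolding eq by (intro a b) auto
qed

lemma subspace_sum:
  assumes "Fsubspace F d X" "\<And>b. b \<in> B \<Longrightarrow> f b \<in> X"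
  shows "sum f B \<in> X"
  using assms(2) by (induction B rule: infinite_finite_induct) (auto intro: subspaceD[OF assms(1)])

lemma ssum_iff: "v \<in> ssum X Y \<longleftrightarrow> (\<exists>x\<in>X. \<exists>y\<in>Y. v = x + y)"
  by (auto simp: ssum_def vadd_eq_plus)

lemma subspace_ssum:
  assumes X: "Fsubspace F d X" and Y: "Fsubspace F d Y"
  shows "Fsubspace F d (ssum X Y)"
  unfolding subspace_iff
proof (intro conjI ballI)
  show "ssum X Y \<subseteq> Fvec F d" using subspaceD(6)[OF X] subspaceD(6)[OF Y] by (auto simp: ssum_iff)
  show "0 \<in> ssum X Y" unfolding ssum_iff
    by (rule bexI[OF _ subspaceD(2)[OF X]], rule bexI[OF _ subspaceD(2)[OF Y]]) simp
next
  fix u v assume "u \<in> ssum X Y" "v \<in> ssum X Y"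
  then obtain a b a' b' where "u = a + b" "v = a' + b'" "a \<in> X" "a' \<in> X" "b \<in> Y" "b' \<in> Y"
    by (auto simp: ssum_iff)
  moreover from this have "u + v = (a + a') + (b + b')" by (simp add: algebra_simps)
  ultimately show "u + v \<in> ssum X Y" unfolding ssum_iff using subspaceD(3) X Y by blast
next
  fix c u assume c: "c \<in> F" and "u \<in> ssum X Y"
  then obtain a b where "u = a + b" "a \<in> X" "b \<in> Y" by (auto simp: ssum_iff)
  moreover from this have "vsmul c u = vsmul c a + vsmul c b" by (simp add: fun_eq_iff algebra_simps)
  ultimately show "vsmul c u \<in> ssum X Y" unfolding ssum_iff using subspaceD(5) X Y c by blast
qed

lemma subspace_Int: "Fsubspace F d X \<Longrightarrow> Fsubspace F d Y \<Longrightarrow> Fsubspace F d (X \<inter> Y)"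
  by (auto simp: subspace_iff)

lemma subspace_0: "Fsubspace F d {0}"
  by (auto simp: subspace_iff fun_eq_iff)

lemma subspace_Fvec: "Fsubspace F d (Fvec F d)"
  by (auto simp: subspace_iff)

lemma subspace_perp: "Fsubspace F d (Fperp F d X)"
proof -
  have "vinner d x (a + b) = 0" if "vinner d x a = 0" "vinner d x b = 0" for x a b
    using that vinner_add_left[of d a b x] by (simp add: vinner_sym_0[of d x])
  moreover have "vinner d x (vsmul c a) = 0" if "vinner d x a = 0" for x a c
    using that vinner_scale_left[of d c a x] by (simp add: vinner_sym_0[of d x])
  ultimately show ?thesis by (auto simp: subspace_iff Fperp_def)
qed

lemma ssum_superset:
  assumes "Fsubspace F d X" "Fsubspace F d Y"
  shows "X \<subseteq> ssum X Y" "Y \<subseteq> ssum X Y"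
  using subspaceD(2)[OF assms(1)] subspaceD(2)[OF assms(2)] unfolding ssum_iff subset_iff
  by (metis add.right_neutral, metis add.left_neutral)

lemma ssum_least:
  assumes "Fsubspace F d Z" "X \<subseteq> Z" "Y \<subseteq> Z"
  shows "ssum X Y \<subseteq> Z"
  using assms subspaceD(3)[OF assms(1)] by (auto simp: ssum_iff subset_iff)

section \<open>Spans and linear independence with coefficients in \<open>F\<close>\<close>

lemma Fspan_finite:
  assumes "finite B"
  shows "v \<in> Fspan F B \<longleftrightarrow> (\<exists>c. (\<forall>b\<in>B. c b \<in> F) \<and> v = (\<Sum>b\<in>B. vsmul (c b) b))"
proof
  assume "v \<in> Fspan F B"
  then obtain T c where T: "finite T" "T \<subseteq> B" "\<forall>x\<in>T. c x \<in> F" "v = (\<lambda>i. \<Sum>x\<in>T. c x * x i)"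
    by (auto simp: Fspan_def)
  define c' where "c' b = (if b \<in> T then c b else 0)" for b
  have "(\<Sum>b\<in>B. vsmul (c' b) b) = (\<Sum>b\<in>T. vsmul (c' b) b)"
    using T assms by (intro sum.mono_neutral_right) (auto simp: c'_def)
  also have "\<dots> = v" by (simp add: T fun_eq_iff fun_sum_apply c'_def)
  finally show "\<exists>c. (\<forall>b\<in>B. c b \<in> F) \<and> v = (\<Sum>b\<in>B. vsmul (c b) b)"
    using T by (intro exI[of _ c']) (auto simp: c'_def)
next
  assume "\<exists>c. (\<forall>b\<in>B. c b \<in> F) \<and> v = (\<Sum>b\<in>B. vsmul (c b) b)"
  then obtain c where "\<forall>b\<in>B. c b \<in> F" "v = (\<Sum>b\<in>B. vsmul (c b) b)" by blast
  then show "v \<in> Fspan F B"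
    unfolding Fspan_def using assms by (auto simp: fun_eq_iff fun_sum_apply intro!: exI[of _ B] exI[of _ c])
qed

lemma Findep_finite:
  assumes "finite B"
  shows "Findep F B \<longleftrightarrow> (\<forall>c. (\<forall>b\<in>B. c b \<in> F) \<longrightarrow> (\<Sum>b\<in>B. vsmul (c b) b) = 0 \<longrightarrow> (\<forall>b\<in>B. c b = 0))"
proof
  assume "Findep F B"
  then show "\<forall>c. (\<forall>b\<in>B. c b \<in> F) \<longrightarrow> (\<Sum>b\<in>B. vsmul (c b) b) = 0 \<longrightarrow> (\<forall>b\<in>B. c b = 0)"
    unfolding Findep_def using assms by (auto simp: fun_eq_iff fun_sum_apply)
next
  assume *: "\<forall>c. (\<forall>b\<in>B. c b \<in> F) \<longrightarrow> (\<Sum>b\<in>B. vsmul (c b) b) = 0 \<longrightarrow> (\<forall>b\<in>B. c b = 0)"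
  show "Findep F B"
    unfolding Findep_def
  proof (intro allI impI ballI)
    fix T c x assume T: "finite T \<and> T \<subseteq> B \<and> (\<forall>x\<in>T. c x \<in> F) \<and> (\<forall>i. (\<Sum>x\<in>T. c x * x i) = 0)"
      and x: "x \<in> T"
    define c' where "c' b = (if b \<in> T then c b else 0)" for b
    have "(\<Sum>b\<in>B. vsmul (c' b) b) = (\<Sum>b\<in>T. vsmul (c' b) b)"
      using T assms by (intro sum.mono_neutral_right) (auto simp: c'_def)
    also have "\<dots> = 0" using T by (simp add: fun_eq_iff fun_sum_apply c'_def)
    finally have "\<forall>b\<in>B. c' b = 0" using *[rule_format, of c'] T by (auto simp: c'_def)
    moreover have "x \<in> B" using x T by blast
    ultimately show "c x = 0" using x by (auto simp: c'_def)
  qed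
qed

lemma subspace_Fspan:
  assumes "finite B" "B \<subseteq> Fvec F d"
  shows "Fsubspace F d (Fspan F B)"
  unfolding subspace_iff
proof (intro conjI ballI subsetI)
  show "0 \<in> Fspan F B"
    unfolding Fspan_finite[OF assms(1)] by (intro exI[of _ "\<lambda>_. 0"]) simp
next
  fix x assume "x \<in> Fspan F B"
  then obtain c where c: "\<forall>b\<in>B. c b \<in> F" "x = (\<Sum>b\<in>B. vsmul (c b) b)"
    by (auto simp: Fspan_finite assms(1))
  then show "x \<in> Fvec F d"
    using assms(2) by (auto intro!: subspace_sum[OF subspace_Fvec])
  fix r assume "r \<in> F"
  with c show "vsmul r x \<in> Fspan F B"
    unfolding Fspan_finite[OF assms(1)]
    by (intro exI[of _ "\<lambda>b. r * c b"]) (auto simp: fun_eq_iff fun_sum_apply sum_distrib_left mult.assoc)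
next
  fix x y assume "x \<in> Fspan F B" "y \<in> Fspan F B"
  then obtain c c' where "\<forall>b\<in>B. c b \<in> F" "x = (\<Sum>b\<in>B. vsmul (c b) b)"
     "\<forall>b\<in>B. c' b \<in> F" "y = (\<Sum>b\<in>B. vsmul (c' b) b)"
    by (auto simp: Fspan_finite assms(1))
  then show "x + y \<in> Fspan F B"
    unfolding Fspan_finite[OF assms(1)]
    by (intro exI[of _ "\<lambda>b. c b + c' b"]) (auto simp: cvs.scale_left_distrib sum.distrib)
qed

lemma Fspan_superset: "B \<subseteq> Fspan F B"
proof
  fix b assume "b \<in> B"
  then show "b \<in> Fspan F B"
    unfolding Fspan_def by (auto intro!: exI[of _ "{b}"] exI[of _ "\<lambda>_. 1"])
qed

lemma Fspan_least:
  assumes "finite B" "Fsubspace F d X" "B \<subseteq> X"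
  shows "Fspan F B \<subseteq> X"
  using assms(3) by (auto simp: Fspan_finite[OF assms(1)] intro!: subspace_sum[OF assms(2)] subspaceD(5)[OF assms(2)])

lemma Fspan_mono: "A \<subseteq> B \<Longrightarrow> Fspan F A \<subseteq> Fspan F B"
  unfolding Fspan_def by blast

text \<open>Orthogonal sets are independent over the complex numbers as well as over
  \<open>F\<close>. Passing to the complex span therefore makes the usual exchange bound available
  for spans over \<open>F\<close>.\<close>

lemma Fspan_sub_span: "finite B \<Longrightarrow> Fspan F B \<subseteq> cvs.span B"
  by (auto simp: Fspan_finite intro!: cvs.span_sum cvs.span_scale intro: cvs.span_base)

section \<open>Orthogonal bases and orthogonal complements\<close>

definition orth_set :: "nat \<Rightarrow> (nat \<Rightarrow> complex) set \<Rightarrow> bool" where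
  "orth_set d B \<longleftrightarrow> finite B \<and> B \<subseteq> Fvec F d \<and> 0 \<notin> B \<and>
     (\<forall>a\<in>B. \<forall>b\<in>B. a \<noteq> b \<longrightarrow> vinner d a b = 0)"

lemma orth_set_finite: "orth_set d B \<Longrightarrow> finite B"
  by (simp add: orth_set_def)

lemma orth_set_inner_sum:
  assumes "orth_set d B" "b \<in> B"
  shows "vinner d (\<Sum>a\<in>B. vsmul (c a) a) b = c b * vinner d b b"
proof -
  have "vinner d (\<Sum>a\<in>B. vsmul (c a) a) b = (\<Sum>a\<in>B. if a = b then c b * vinner d b b else 0)"
    unfolding vinner_sum_left vinner_scale_left using assms
    by (intro sum.cong) (auto simp: orth_set_def)
  then show ?thesis using assms by (simp add: orth_set_def)
qed

lemma orth_set_norm: "orth_set d B \<Longrightarrow> b \<in> B \<Longrightarrow> vinner d b b \<noteq> 0"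
  using Fvec_vinner_self by (auto simp: orth_set_def)

lemma orth_set_coeffs_0:
  assumes "orth_set d B" "(\<Sum>a\<in>B. vsmul (c a) a) = 0" "b \<in> B"
  shows "c b = 0"
  using orth_set_inner_sum[OF assms(1,3), of c] orth_set_norm[OF assms(1,3)] assms(2) by simp

lemma orth_set_independent: "orth_set d B \<Longrightarrow> cvs.independent B"
  using orth_set_coeffs_0 by (auto simp: cvs.dependent_finite orth_set_finite)

lemma orth_set_Findep: "orth_set d B \<Longrightarrow> Findep F B"
  using orth_set_coeffs_0 by (auto simp: Findep_finite orth_set_finite)

definition unit_vec :: "nat \<Rightarrow> nat \<Rightarrow> complex" where
  "unit_vec i = (\<lambda>j. if j = i then 1 else 0)"

lemma orth_set_unit: "orth_set d (unit_vec ` {..<d})" and card_unit: "card (unit_vec ` {..<d}) = d"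
proof -
  have inj: "inj unit_vec" by (auto simp: inj_def unit_vec_def fun_eq_iff split: if_splits)
  then show "card (unit_vec ` {..<d}) = d" by (simp add: card_image inj_on_subset)
  have "vinner d (unit_vec i) (unit_vec j) = 0" if "i \<noteq> j" for i j
    using that by (auto simp: vinner_def unit_vec_def intro!: sum.neutral)
  moreover have "unit_vec i \<noteq> 0" for i
  proof
    assume "unit_vec i = 0"
    then have "unit_vec i i = 0" by simp
    then show False by (simp add: unit_vec_def)
  qed
  moreover have "unit_vec i \<in> Fvec F d" if "i < d" for i
    using that by (auto simp: Fvec_def unit_vec_def)
  ultimately show "orth_set d (unit_vec ` {..<d})"
    unfolding orth_set_def by (intro conjI ballI impI) (auto, metis)
qed

lemma Fspan_unit: "Fspan F (unit_vec ` {..<d}) = Fvec F d"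
proof
  show "Fspan F (unit_vec ` {..<d}) \<subseteq> Fvec F d"
    using orth_set_unit[of d] by (intro Fspan_least[OF _ subspace_Fvec]) (auto simp: orth_set_def)
  show "Fvec F d \<subseteq> Fspan F (unit_vec ` {..<d})"
  proof
    fix x assume x: "x \<in> Fvec F d"
    have "x = (\<Sum>i<d. vsmul (x i) (unit_vec i))"
    proof
      fix j
      have "(\<Sum>i<d. vsmul (x i) (unit_vec i)) j = (\<Sum>i<d. if j = i then x i else 0)"
        unfolding fun_sum_apply by (intro sum.cong) (auto simp: unit_vec_def)
      then show "x j = (\<Sum>i<d. vsmul (x i) (unit_vec i)) j" using x by (auto simp: Fvec_def)
    qed
    moreover have "(\<Sum>i<d. vsmul (x i) (unit_vec i)) \<in> Fspan F (unit_vec ` {..<d})"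
    proof (rule subspace_sum[OF subspace_Fspan])
      fix i assume "i \<in> {..<d}"
      then show "vsmul (x i) (unit_vec i) \<in> Fspan F (unit_vec ` {..<d})"
        using x subsetD[OF Fspan_superset, of "unit_vec i" "unit_vec ` {..<d}"] orth_set_unit[of d]
        by (intro subspaceD(5)[OF subspace_Fspan]) (auto simp: orth_set_def Fvec_def)
    qed (use orth_set_unit[of d] in \<open>auto simp: orth_set_def\<close>)
    ultimately show "x \<in> Fspan F (unit_vec ` {..<d})" by simp
  qed
qed

lemma orth_set_card_le: "orth_set d B \<Longrightarrow> card B \<le> d"
proof -
  assume B: "orth_set d B"
  have "B \<subseteq> cvs.span (unit_vec ` {..<d})"
    using Fspan_sub_span[of "unit_vec ` {..<d}"] Fspan_unit B by (auto simp: orth_set_def)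
  then show ?thesis
    using cvs.independent_span_bound[OF _ orth_set_independent[OF B]] card_unit by (metis finite_imageI finite_lessThan)
qed

text \<open>Orthogonal projection onto the span of \<open>B\<close>. Basis vectors are not
  normalised, since \<open>F\<close> need not contain the square roots; the quotients below stay in
  \<open>F\<close>.\<close>

definition proj :: "nat \<Rightarrow> (nat \<Rightarrow> complex) set \<Rightarrow> (nat \<Rightarrow> complex) \<Rightarrow> nat \<Rightarrow> complex" where
  "proj d B x = (\<Sum>b\<in>B. vsmul (vinner d x b / vinner d b b) b)"

lemma proj_in_span:
  assumes "orth_set d B" "x \<in> Fvec F d"
  shows "proj d B x \<in> Fspan F B"
  unfolding Fspan_finite[OF orth_set_finite[OF assms(1)]] proj_def
  using assms by (intro exI[of _ "\<lambda>b. vinner d x b / vinner d b b"]) (auto simp: orth_set_def)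

lemma proj_residual:
  assumes "orth_set d B" "b \<in> B"
  shows "vinner d (x - proj d B x) b = 0"
  using orth_set_norm[OF assms]
  unfolding proj_def vinner_diff_left orth_set_inner_sum[OF assms] by simp

lemma orthogonal_to_span:
  assumes "finite B" "\<And>b. b \<in> B \<Longrightarrow> vinner d b x = 0" "v \<in> Fspan F B"
  shows "vinner d v x = 0"
  using assms(2,3) by (auto simp: Fspan_finite[OF assms(1)] vinner_sum_left vinner_scale_left)

lemma orth_set_insert_residual:
  assumes B: "orth_set d B" and x: "x \<in> Fvec F d" "x \<notin> Fspan F B"
  shows "orth_set d (insert (x - proj d B x) B)" "x - proj d B x \<notin> B"
proof -
  let ?y = "x - proj d B x"
  note S = subspace_Fspan[of B d]
  have pr: "proj d B x \<in> Fspan F B" by (rule proj_in_span[OF B x(1)])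
  have fin: "finite B" "B \<subseteq> Fvec F d" using B by (auto simp: orth_set_def)
  have y: "?y \<noteq> 0" using pr x(2) by auto
  have yV: "?y \<in> Fvec F d" using x(1) subspaceD(6)[OF S[OF fin] pr] by simp
  have o: "vinner d ?y b = 0" "vinner d b ?y = 0" if "b \<in> B" for b
    using proj_residual[OF B that] vinner_sym_0 by auto
  show "?y \<notin> B" using o(1)[of ?y] y yV Fvec_vinner_self by blast
  show "orth_set d (insert ?y B)" using B o y yV by (auto simp: orth_set_def)
qed

text \<open>While the span misses some vector of \<open>X\<close>, its residual enlarges the
  orthogonal set. The bound \<open>d\<close> on the size of orthogonal sets ends the
  process.\<close>

lemma orth_basis_extend:
  assumes X: "Fsubspace F d X" and "orth_set d B0" "B0 \<subseteq> X"
  shows "\<exists>B. orth_set d B \<and> B0 \<subseteq> B \<and> B \<subseteq> X \<and> Fspan F B = X"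
  using assms(2,3)
proof (induction "d - card B0" arbitrary: B0 rule: less_induct)
  case less
  show ?case
  proof (cases "X \<subseteq> Fspan F B0")
    case True
    then show ?thesis using less.prems Fspan_least[OF orth_set_finite X] by blast
  next
    case False
    then obtain x where x: "x \<in> X" "x \<notin> Fspan F B0" by blast
    let ?y = "x - proj d B0 x"
    note y = orth_set_insert_residual[OF less.prems(1) subspaceD(6)[OF X x(1)] x(2)]
    have fin: "finite B0" using less.prems by (simp add: orth_set_finite)
    have "?y \<in> X"
      using proj_in_span[OF less.prems(1) subspaceD(6)[OF X x(1)]] Fspan_least[OF fin X less.prems(2)] x
      by (intro subspaceD(4)[OF X]) auto
    moreover have "d - card (insert ?y B0) < d - card B0"
      using y(2) fin orth_set_card_le[OF y(1)] by simp
    ultimately obtain B where "orth_set d B" "insert ?y B0 \<subseteq> B" "B \<subseteq> X" "Fspan F B = X"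
      using less.hyps[of "insert ?y B0"] y(1) less.prems(2) by auto
    then show ?thesis by blast
  qed
qed

lemma orth_basis_exists:
  assumes "Fsubspace F d X"
  shows "\<exists>B. orth_set d B \<and> Fspan F B = X"
  using orth_basis_extend[OF assms, of "{}"] by (auto simp: orth_set_def)

lemma ssum_perp:
  assumes X: "Fsubspace F d X"
  shows "ssum X (Fperp F d X) = Fvec F d"
proof
  show "ssum X (Fperp F d X) \<subseteq> Fvec F d"
    using subspace_ssum[OF X subspace_perp] subspaceD(1) by blast
  obtain B where B: "orth_set d B" "Fspan F B = X" using orth_basis_exists[OF X] by blast
  show "Fvec F d \<subseteq> ssum X (Fperp F d X)"
  proof
    fix v assume v: "v \<in> Fvec F d"
    have p: "proj d B v \<in> X" using proj_in_span[OF B(1) v] B(2) by simp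
    have "vinner d x (v - proj d B v) = 0" if "x \<in> X" for x
      using orthogonal_to_span[OF orth_set_finite[OF B(1)]] proj_residual[OF B(1)] that B(2)
      by (metis vinner_sym_0)
    then have "v - proj d B v \<in> Fperp F d X" using v subspaceD(6)[OF X p] by (auto simp: Fperp_def)
    then show "v \<in> ssum X (Fperp F d X)" unfolding ssum_iff using p
      by (intro bexI[of _ "proj d B v"] bexI[of _ "v - proj d B v"]) auto
  qed
qed

lemma inter_perp:
  assumes X: "Fsubspace F d X"
  shows "X \<inter> Fperp F d X = {0}"
  using subspaceD(2)[OF X] subspaceD(2)[OF subspace_perp[of d X]] Fvec_vinner_self by (auto simp: Fperp_def)

lemma perp_perp_superset: "X \<subseteq> Fvec F d \<Longrightarrow> X \<subseteq> Fperp F d (Fperp F d X)"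
  by (auto simp: Fperp_def) (metis vinner_sym_0)

text \<open>Split \<open>v\<close> as \<open>x + y\<close> along \<open>X\<close> and its
  complement. Then \<open>y\<close> is orthogonal to both \<open>v\<close> and \<open>x\<close>,
  hence to itself.\<close>

lemma perp_perp:
  assumes X: "Fsubspace F d X"
  shows "Fperp F d (Fperp F d X) = X"
proof
  show "X \<subseteq> Fperp F d (Fperp F d X)" by (rule perp_perp_superset[OF subspaceD(1)[OF X]])
  show "Fperp F d (Fperp F d X) \<subseteq> X"
  proof
    fix v assume v: "v \<in> Fperp F d (Fperp F d X)"
    then have "v \<in> ssum X (Fperp F d X)" using ssum_perp[OF X] by (auto simp: Fperp_def)
    then obtain x y where xy: "x \<in> X" "y \<in> Fperp F d X" "v = x + y" by (auto simp: ssum_iff)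
    have "vinner d v y = 0" using v xy(2) vinner_sym_0 by (auto simp: Fperp_def)
    moreover have "vinner d x y = 0" using xy by (auto simp: Fperp_def)
    ultimately have "vinner d y y = 0" by (simp add: xy(3) vinner_add_left)
    then have "y = 0" using xy(2) Fvec_vinner_self by (auto simp: Fperp_def)
    then show "v \<in> X" using xy by simp
  qed
qed

lemma perp_ssum:
  assumes X: "Fsubspace F d X" and Y: "Fsubspace F d Y"
  shows "Fperp F d (ssum X Y) = Fperp F d X \<inter> Fperp F d Y"
  using ssum_superset[OF X Y] by (auto simp: Fperp_def ssum_iff vinner_add_left)

lemma perp_Int:
  assumes X: "Fsubspace F d X" and Y: "Fsubspace F d Y"
  shows "Fperp F d (X \<inter> Y) = ssum (Fperp F d X) (Fperp F d Y)"
  using perp_perp[OF subspace_ssum[OF subspace_perp subspace_perp], of d X Y]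
  by (simp add: perp_ssum[OF subspace_perp subspace_perp] perp_perp[OF X] perp_perp[OF Y])

text \<open>\<open>Fdim\<close> refers to arbitrary bases. Replacing one by an orthogonal set of
  equal size and span lets sizes be compared through complex independence.\<close>

lemma gram_schmidt:
  assumes "finite B" "B \<subseteq> Fvec F d" "Findep F B"
  shows "\<exists>C. orth_set d C \<and> card C = card B \<and> Fspan F C = Fspan F B"
  using assms
proof (induction B rule: finite_induct)
  case empty
  then show ?case by (intro exI[of _ "{}"]) (auto simp: orth_set_def)
next
  case (insert x B)
  have "Findep F B" using insert.prems(2) unfolding Findep_def by (meson subset_insertI2)
  then obtain C where C: "orth_set d C" "card C = card B" "Fspan F C = Fspan F B"
    using insert by auto
  have x: "x \<in> Fvec F d" and B: "B \<subseteq> Fvec F d" using insert.prems by auto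
  have nx: "x \<notin> Fspan F C"
  proof
    assume "x \<in> Fspan F C"
    then obtain c where c: "\<forall>b\<in>B. c b \<in> F" "x = (\<Sum>b\<in>B. vsmul (c b) b)"
      unfolding C(3) Fspan_finite[OF insert.hyps(1)] by blast
    \<comment> \<open>Bringing \<open>x\<close> to the other side turns its expansion in
      \<open>B\<close> into a dependence of \<open>insert x B\<close>.\<close>
    define c' where "c' = c(x := -1)"
    have "(\<Sum>b\<in>B. vsmul (c' b) b) = (\<Sum>b\<in>B. vsmul (c b) b)"
      using insert.hyps by (intro sum.cong) (auto simp: c'_def)
    then have "(\<Sum>b\<in>insert x B. vsmul (c' b) b) = vsmul (-1) x + x"
      using insert.hyps c(2) by (simp add: c'_def)
    also have "\<dots> = 0" by (simp add: fun_eq_iff)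
    finally have "c' x = 0"
      by (intro insert.prems(2)[unfolded Findep_finite[OF finite.insertI[OF insert.hyps(1)]], rule_format])
        (use c(1) in \<open>auto simp: c'_def\<close>)
    then show False by (simp add: c'_def)
  qed
  let ?y = "x - proj d C x"
  note y = orth_set_insert_residual[OF C(1) x nx]
  have p: "proj d C x \<in> Fspan F C" by (rule proj_in_span[OF C(1) x])
  have fin: "finite (insert x B)" "insert x B \<subseteq> Fvec F d" "finite (insert ?y C)" "insert ?y C \<subseteq> Fvec F d"
    using insert y(1) by (auto simp: orth_set_def)
  note S1 = subspace_Fspan[OF fin(1,2)] and S2 = subspace_Fspan[OF fin(3,4)]
  have CC: "C \<subseteq> Fspan F B" "B \<subseteq> Fspan F C" using Fspan_superset C(3) by auto
  have "insert ?y C \<subseteq> Fspan F (insert x B)"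
    using p C(3) CC Fspan_mono[of B "insert x B"] Fspan_superset[of "insert x B"]
    by (auto intro!: subspaceD(4)[OF S1])
  then have 1: "Fspan F (insert ?y C) \<subseteq> Fspan F (insert x B)" by (rule Fspan_least[OF fin(3) S1])
  have "x = ?y + proj d C x" by simp
  also have "\<dots> \<in> Fspan F (insert ?y C)"
    using p Fspan_mono[of C "insert ?y C"] Fspan_superset[of "insert ?y C"]
    by (intro subspaceD(3)[OF S2]) auto
  finally have "insert x B \<subseteq> Fspan F (insert ?y C)"
    using CC Fspan_mono[of C "insert ?y C"] by auto
  then have 2: "Fspan F (insert x B) \<subseteq> Fspan F (insert ?y C)" by (rule Fspan_least[OF fin(1) S2])
  show ?case
    by (rule exI[of _ "insert ?y C"]) (use y C insert.hyps 1 2 orth_set_finite[OF C(1)] in auto)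
qed

section \<open>Dimension over \<open>F\<close>\<close>

lemma orth_basis_card_unique:
  assumes "orth_set d B" "orth_set d C" "Fspan F B = Fspan F C"
  shows "card B = card C"
proof -
  have "B \<subseteq> cvs.span C" "C \<subseteq> cvs.span B"
    using Fspan_superset assms Fspan_sub_span[OF orth_set_finite] by blast+
  then show ?thesis
    using cvs.independent_span_bound[OF orth_set_finite orth_set_independent] assms
    by (simp add: le_antisym)
qed

text \<open>All bases have the size of an orthogonal one, so the least value in the definition of
  \<open>Fdim\<close> ranges over a single number.\<close>

lemma Fdim_basis:
  assumes "finite B" "B \<subseteq> Fvec F d" "Findep F B" "Fspan F B = X"
  shows "Fdim F X = card B"
proof -
  have eq: "card B' = card B" if B': "finite B'" "B' \<subseteq> X" "Findep F B'" "Fspan F B' = X" for B'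
  proof -
    have "X \<subseteq> Fvec F d" using subspaceD(1)[OF subspace_Fspan] assms by blast
    then have "B' \<subseteq> Fvec F d" using B' by blast
    then obtain C where "orth_set d C" "card C = card B'" "Fspan F C = X"
      using gram_schmidt[of B' d] B' by blast
    moreover obtain C' where "orth_set d C'" "card C' = card B" "Fspan F C' = X"
      using gram_schmidt[of B d] assms by blast
    ultimately show ?thesis using orth_basis_card_unique[of d C C'] by simp
  qed
  have "B \<subseteq> X" using Fspan_superset assms(4) by blast
  then have "\<exists>B'. finite B' \<and> card B' = card B \<and> B' \<subseteq> X \<and> Findep F B' \<and> Fspan F B' = X"
    using assms by blast
  then show ?thesis unfolding Fdim_def
    by (rule Least_equality) (metis eq order_refl)
qed

lemma Fdim_orth: "orth_set d B \<Longrightarrow> Fspan F B = X \<Longrightarrow> Fdim F X = card B"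
  by (rule Fdim_basis[where d = d]) (simp_all add: orth_set_Findep, simp_all add: orth_set_def)

lemma Fdim_Fvec: "Fdim F (Fvec F d) = d"
  using Fdim_orth[OF orth_set_unit Fspan_unit] card_unit by simp

lemma Fdim_0: "Fdim F {0} = 0"
proof -
  have "orth_set 0 {}" "Fspan F {} = {0}" by (auto simp: orth_set_def Fspan_finite)
  then show ?thesis using Fdim_orth by force
qed

lemma Fdim_mono:
  assumes "Fsubspace F d X" "Fsubspace F d Y" "X \<subseteq> Y"
  shows "Fdim F X \<le> Fdim F Y" and "Fdim F X = Fdim F Y \<Longrightarrow> X = Y"
proof -
  obtain B where B: "orth_set d B" "Fspan F B = X" using orth_basis_exists[OF assms(1)] by blast
  then have "B \<subseteq> Y" using Fspan_superset assms(3) by blast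
  then obtain C where C: "orth_set d C" "B \<subseteq> C" "Fspan F C = Y"
    using orth_basis_extend[OF assms(2) B(1)] by blast
  note dims = Fdim_orth[OF B] Fdim_orth[OF C(1,3)]
  show "Fdim F X \<le> Fdim F Y" using dims C by (simp add: card_mono orth_set_finite)
  show "X = Y" if "Fdim F X = Fdim F Y"
    using card_subset_eq[OF orth_set_finite[OF C(1)] C(2)] that dims B(2) C(3) by simp
qed

text \<open>An orthogonal basis \<open>C\<close> of the intersection is extended to bases
  \<open>B1\<close> of \<open>X\<close> and \<open>B2\<close> of \<open>Y\<close>. The union of
  \<open>B1\<close> with \<open>E = B2 - C\<close> is a basis of the sum. It is in general not
  orthogonal, so independence needs an argument of its own.\<close>

lemma Fdim_modular:
  assumes X: "Fsubspace F d X" and Y: "Fsubspace F d Y"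
  shows "Fdim F (ssum X Y) + Fdim F (X \<inter> Y) = Fdim F X + Fdim F Y"
proof -
  obtain C where C: "orth_set d C" "Fspan F C = X \<inter> Y"
    using orth_basis_exists[OF subspace_Int[OF X Y]] by blast
  then have CXY: "C \<subseteq> X" "C \<subseteq> Y" using Fspan_superset by blast+
  obtain B1 where B1: "orth_set d B1" "C \<subseteq> B1" "B1 \<subseteq> X" "Fspan F B1 = X"
    using orth_basis_extend[OF X C(1) CXY(1)] by blast
  obtain B2 where B2: "orth_set d B2" "C \<subseteq> B2" "B2 \<subseteq> Y" "Fspan F B2 = Y"
    using orth_basis_extend[OF Y C(1) CXY(2)] by blast
  define E where "E = B2 - C"
  have fin: "finite B1" "finite E" "finite C" "finite B2"
    using B1 B2 C orth_set_finite by (auto simp: E_def)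
  have sub: "B1 \<subseteq> Fvec F d" "E \<subseteq> Fvec F d" using B1 B2 by (auto simp: orth_set_def E_def)
  \<comment> \<open>Such a \<open>w\<close> lies in the span of \<open>C\<close> and in that of
    \<open>E\<close>; these are orthogonal, so \<open>w\<close> is orthogonal to itself.\<close>
  have key: "w = 0" if wX: "w \<in> X" and wE: "w \<in> Fspan F E" for w
  proof -
    have "w \<in> Y" using wE Fspan_mono[of E B2] B2(4) by (auto simp: E_def)
    then have wC: "w \<in> Fspan F C" using wX C(2) by simp
    have CE: "vinner d e b = 0" if "b \<in> C" "e \<in> E" for b e
    proof -
      have "b \<in> B2" "e \<in> B2" "e \<noteq> b" using that B2(2) by (auto simp: E_def)
      then show ?thesis using B2(1) by (simp add: orth_set_def)
    qed
    have "vinner d b w = 0" if "b \<in> C" for b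
      using orthogonal_to_span[OF fin(2) CE[OF that] wE] vinner_sym_0[of d b w] by simp
    from orthogonal_to_span[OF fin(3) this wC] have "vinner d w w = 0" .
    then show "w = 0" using Fvec_vinner_self subspaceD(6)[OF X wX] by blast
  qed
  have disj: "B1 \<inter> E = {}"
    using key B1(1,3) Fspan_superset[of E] by (auto simp: orth_set_def)
  have E_orth: "orth_set d E" using B2(1) by (auto simp: orth_set_def E_def)
  have "Findep F (B1 \<union> E)"
    unfolding Findep_finite[OF finite_UnI[OF fin(1,2)]]
  proof (intro allI impI)
    fix c assume c: "\<forall>b\<in>B1 \<union> E. c b \<in> F" and z: "(\<Sum>b\<in>B1 \<union> E. vsmul (c b) b) = 0"
    let ?u = "\<Sum>b\<in>B1. vsmul (c b) b" and ?w = "\<Sum>b\<in>E. vsmul (c b) b"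
    have uw: "?u + ?w = 0" using z sum.union_disjoint[OF fin(1,2) disj, of "\<lambda>b. vsmul (c b) b"] by simp
    have "?u \<in> X" using c Fspan_finite[OF fin(1), of ?u] B1(4) by auto
    moreover have "?w = 0 - ?u" using uw by (simp add: eq_neg_iff_add_eq_0 add.commute)
    ultimately have "?w \<in> X" using subspaceD(2,4)[OF X] by metis
    moreover have "?w \<in> Fspan F E" using c Fspan_finite[OF fin(2), of ?w] by auto
    ultimately have w0: "?w = 0" using key by blast
    then have "?u = 0" using uw by simp
    then show "\<forall>b\<in>B1 \<union> E. c b = 0"
      using orth_set_coeffs_0[OF B1(1)] orth_set_coeffs_0[OF E_orth] w0 by blast
  qed
  moreover have "Fspan F (B1 \<union> E) = ssum X Y"
  proof
    show "Fspan F (B1 \<union> E) \<subseteq> ssum X Y"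
      by (rule Fspan_least[OF finite_UnI[OF fin(1,2)] subspace_ssum[OF X Y]])
        (use B1 B2 ssum_superset[OF X Y] in \<open>auto simp: E_def\<close>)
    have "B2 \<subseteq> B1 \<union> E" using B1(2) by (auto simp: E_def)
    then show "ssum X Y \<subseteq> Fspan F (B1 \<union> E)"
      using sub fin B1(4) B2(4) Fspan_mono[of B1 "B1 \<union> E"] Fspan_mono[of B2 "B1 \<union> E"]
      by (intro ssum_least[OF subspace_Fspan[of _ d]]) auto
  qed
  ultimately have "Fdim F (ssum X Y) = card (B1 \<union> E)"
    using fin sub by (intro Fdim_basis[of _ d]) auto
  moreover have "card (B1 \<union> E) = card B1 + card E" by (rule card_Un_disjoint[OF fin(1,2) disj])
  moreover have "card E + card C = card B2"
    using B2(2) fin by (simp add: E_def card_Diff_subset card_mono)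
  ultimately show ?thesis
    using Fdim_orth[OF C] Fdim_orth[OF B1(1,4)] Fdim_orth[OF B2(1,4)] by simp
qed

lemma Fdim_perp:
  assumes "Fsubspace F d X"
  shows "Fdim F X + Fdim F (Fperp F d X) = d"
  using Fdim_modular[OF assms subspace_perp, of X] ssum_perp[OF assms] inter_perp[OF assms] Fdim_Fvec Fdim_0
  by simp

end

section \<open>Identities as vector configurations\<close>

text \<open>Membership of \<open>v\<close> in a term (\<open>b\<close> true) or in its complement (\<open>b\<close> false), after pushing
  complements to the variables: the sets \<open>U i\<close> and \<open>W i\<close> supply vectors of the \<open>i\<close>-th
  subspace and of its orthogonal complement, and all intermediate vectors lie in \<open>S\<close>.\<close>

primrec witnessed :: "(nat \<Rightarrow> complex) set \<Rightarrow> (nat \<Rightarrow> (nat \<Rightarrow> complex) set) \<Rightarrow>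
    (nat \<Rightarrow> (nat \<Rightarrow> complex) set) \<Rightarrow> olterm \<Rightarrow> bool \<Rightarrow> (nat \<Rightarrow> complex) \<Rightarrow> bool" where
  "witnessed S U W (OVar i) b v \<longleftrightarrow> v \<in> S \<and> v \<in> (if b then U i else W i)"
| "witnessed S U W (OJoin s t) b v \<longleftrightarrow> v \<in> S \<and>
     (if b then \<exists>x y. v = x + y \<and> witnessed S U W s b x \<and> witnessed S U W t b y
      else witnessed S U W s b v \<and> witnessed S U W t b v)"
| "witnessed S U W (OMeet s t) b v \<longleftrightarrow> v \<in> S \<and>
     (if b then witnessed S U W s b v \<and> witnessed S U W t b v
      else \<exists>x y. v = x + y \<and> witnessed S U W s b x \<and> witnessed S U W t b y)"
| "witnessed S U W (OCompl s) b v \<longleftrightarrow> witnessed S U W s (\<not> b) v"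
| "witnessed S U W OZero b v \<longleftrightarrow> v \<in> S \<and> (b \<longrightarrow> v = 0)"
| "witnessed S U W OOne b v \<longleftrightarrow> v \<in> S \<and> (\<not> b \<longrightarrow> v = 0)"

lemma witnessed_in: "witnessed S U W t b v \<Longrightarrow> v \<in> S"
  by (induction t arbitrary: b) auto

lemma witnessed_split:
  assumes "v \<in> S" "v = x + y" "witnessed S U W s b x" "witnessed S U W t b y"
  shows "b \<Longrightarrow> witnessed S U W (OJoin s t) b v" "\<not> b \<Longrightarrow> witnessed S U W (OMeet s t) b v"
  unfolding witnessed.simps using assms by (simp_all only: if_True if_False simp_thms) blast+

text \<open>\<open>witnessed\<close> involves addition only, and only of vectors in \<open>S\<close>
  with sum in \<open>S\<close>. Hence a partially additive \<open>\<Psi>\<close>, as obtained from a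
  specialization of coordinates, is enough.\<close>

lemma witnessed_transfer:
  assumes "\<And>x. x \<in> S \<Longrightarrow> \<Psi> x \<in> S'"
    and add: "\<And>x y. x \<in> S \<Longrightarrow> y \<in> S \<Longrightarrow> x + y \<in> S \<Longrightarrow> \<Psi> (x + y) = \<Psi> x + \<Psi> y"
    and "\<Psi> 0 = 0"
    and "\<And>i x. x \<in> S \<Longrightarrow> x \<in> U i \<Longrightarrow> \<Psi> x \<in> U' i"
    and "\<And>i x. x \<in> S \<Longrightarrow> x \<in> W i \<Longrightarrow> \<Psi> x \<in> W' i"
  shows "witnessed S U W t b v \<Longrightarrow> witnessed S' U' W' t b (\<Psi> v)"
proof (induction t arbitrary: b v)
  case (OJoin s t)
  show ?case
  proof (cases b)
    case True
    then obtain x y where xy: "v = x + y" "witnessed S U W s b x" "witnessed S U W t b y" and v: "v \<in> S"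
      using OJoin.prems by auto
    have "\<Psi> v = \<Psi> x + \<Psi> y" unfolding xy(1)
      by (rule add[OF witnessed_in[OF xy(2)] witnessed_in[OF xy(3)]]) (use v xy(1) in simp)
    from witnessed_split(1)[OF assms(1)[OF v] this OJoin.IH(1)[OF xy(2)] OJoin.IH(2)[OF xy(3)] True] show ?thesis .
  qed (use OJoin assms(1) in auto)
next
  case (OMeet s t)
  show ?case
  proof (cases b)
    case False
    then obtain x y where xy: "v = x + y" "witnessed S U W s b x" "witnessed S U W t b y" and v: "v \<in> S"
      using OMeet.prems by auto
    have "\<Psi> v = \<Psi> x + \<Psi> y" unfolding xy(1)
      by (rule add[OF witnessed_in[OF xy(2)] witnessed_in[OF xy(3)]]) (use v xy(1) in simp)
    from witnessed_split(2)[OF assms(1)[OF v] this OMeet.IH(1)[OF xy(2)] OMeet.IH(2)[OF xy(3)] False] show ?thesis .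
  qed (use OMeet assms(1) in auto)
qed (use assms in auto)

lemma witnessed_mono:
  assumes "witnessed S U W t b v" "S \<subseteq> S'" "\<And>i. U i \<subseteq> U' i" "\<And>i. W i \<subseteq> W' i"
  shows "witnessed S' U' W' t b v"
  using witnessed_transfer[of S "\<lambda>x. x" S' U U' W W' t b v] assms by blast

text \<open>Membership is established by a finite tree of decompositions; \<open>S'\<close> collects
  the vectors at its nodes.\<close>

lemma witnessed_finite:
  "witnessed S U W t b v \<Longrightarrow> \<exists>S'. finite S' \<and> S' \<subseteq> S \<and> witnessed S' U W t b v"
proof (induction t arbitrary: b v)
  case (OVar i)
  then show ?case by (intro exI[of _ "{v}"]) auto
next
  case (OJoin s t)
  \<comment> \<open>Both polarities are handled together: \<open>x\<close> and \<open>y\<close> are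
    either summands of \<open>v\<close> or both equal to \<open>v\<close>.\<close>
  obtain x y where xy: "if b then v = x + y else v = x \<and> v = y"
      "witnessed S U W s b x" "witnessed S U W t b y" and v: "v \<in> S"
    using OJoin.prems by (cases b) auto
  obtain S1 S2 where S: "finite S1" "S1 \<subseteq> S" "witnessed S1 U W s b x"
      "finite S2" "S2 \<subseteq> S" "witnessed S2 U W t b y"
    using OJoin.IH xy by metis
  let ?S = "insert v (S1 \<union> S2)"
  have "witnessed ?S U W s b x" "witnessed ?S U W t b y"
    by (rule witnessed_mono[OF S(3)], auto) (rule witnessed_mono[OF S(6)], auto)
  then have "witnessed ?S U W (OJoin s t) b v"
    using xy(1) by (cases b) (auto intro: witnessed_split(1)[of _ _ x y])
  then show ?case using S v by (intro exI[of _ ?S]) auto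
next
  case (OMeet s t)
  obtain x y where xy: "if b then v = x \<and> v = y else v = x + y"
      "witnessed S U W s b x" "witnessed S U W t b y" and v: "v \<in> S"
    using OMeet.prems by (cases b) auto
  obtain S1 S2 where S: "finite S1" "S1 \<subseteq> S" "witnessed S1 U W s b x"
      "finite S2" "S2 \<subseteq> S" "witnessed S2 U W t b y"
    using OMeet.IH xy by metis
  let ?S = "insert v (S1 \<union> S2)"
  have "witnessed ?S U W s b x" "witnessed ?S U W t b y"
    by (rule witnessed_mono[OF S(3)], auto) (rule witnessed_mono[OF S(6)], auto)
  then have "witnessed ?S U W (OMeet s t) b v"
    using xy(1) by (cases b) (auto intro: witnessed_split(2)[of _ _ x y])
  then show ?case using S v by (intro exI[of _ ?S]) auto
next
  case OZero
  then show ?case by (intro exI[of _ "{v}"]) auto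
next
  case OOne
  then show ?case by (intro exI[of _ "{v}"]) auto
qed auto

text \<open>\<open>U\<close> and \<open>W\<close> are mere families of mutually orthogonal sets, not
  complementary subspaces. In this weak form the condition passes to images under
  orthogonality-preserving maps.\<close>

definition nontrivially_witnessed :: "complex set \<Rightarrow> nat \<Rightarrow> olterm \<Rightarrow> bool" where
  "nontrivially_witnessed F d t \<longleftrightarrow> (\<exists>U W v.
     (\<forall>i. \<forall>x\<in>U i. \<forall>y\<in>W i. vinner d x y = 0) \<and> witnessed (Fvec F d) U W t True v \<and> v \<noteq> 0)"

definition term_diff :: "olterm \<times> olterm \<Rightarrow> olterm" where
  "term_diff e = OMeet (OJoin (fst e) (snd e)) (OCompl (OMeet (fst e) (snd e)))"

text \<open>Padding by zeros changes neither sums nor inner products, and the unit of the lattice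
  only demands membership in the ambient space, which grows.\<close>

lemma nontrivially_witnessed_mono:
  assumes "nontrivially_witnessed F d t" "F \<subseteq> G" "d \<le> m"
  shows "nontrivially_witnessed G m t"
proof -
  obtain U W v where *: "\<forall>i. \<forall>x\<in>U i. \<forall>y\<in>W i. vinner d x y = 0"
    "witnessed (Fvec F d) U W t True v" "v \<noteq> 0"
    using assms(1) by (auto simp: nontrivially_witnessed_def)
  have sub: "Fvec F d \<subseteq> Fvec G m" using assms by (auto simp: Fvec_def)
  have in_eq: "vinner m x y = vinner d x y" if "x \<in> Fvec F d" for x y
    unfolding vinner_def using that assms(3) by (intro sum.mono_neutral_right) (auto simp: Fvec_def)
  \<comment> \<open>Cutting \<open>U i\<close> down to \<open>Fvec F d\<close> makes inner products
    of length \<open>m\<close> agree with those of length \<open>d\<close>: one argument without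
    further coordinates is enough.\<close>
  have "witnessed (Fvec G m) (\<lambda>i. U i \<inter> Fvec F d) W t True v"
    using witnessed_transfer[OF _ _ _ _ _ *(2), of "\<lambda>x. x" "Fvec G m" "\<lambda>i. U i \<inter> Fvec F d" W] sub by auto
  then show ?thesis unfolding nontrivially_witnessed_def
    by (rule_tac exI[of _ "\<lambda>i. U i \<inter> Fvec F d"]) (use *(1,3) in_eq in auto)
qed

context conj_subfield
begin

lemma LF_simps [simp]:
  "ocarrier (LF F d) = {X. Fsubspace F d X}" "ojoin (LF F d) = ssum" "omeet (LF F d) = (\<inter>)"
  "ocompl (LF F d) = Fperp F d" "ozero (LF F d) = {0}" "oone (LF F d) = Fvec F d"
  by (simp_all add: LF_def vzero_eq_0)

lemma oeval_LF_subspace: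
  "(\<And>i. Fsubspace F d (a i)) \<Longrightarrow> Fsubspace F d (oeval (LF F d) a t)"
  by (induction t) (auto intro: subspace_ssum subspace_Int subspace_perp subspace_0 subspace_Fvec)

lemma perp_0: "Fperp F d {0} = Fvec F d"
  by (auto simp: Fperp_def)

lemma perp_Fvec: "Fperp F d (Fvec F d) = {0}"
  using perp_perp[OF subspace_0] by (simp add: perp_0)

text \<open>The two polarities follow the De Morgan laws. The sum decomposition for a complemented
  meet rests on \<open>perp_Int\<close>, that is, on double complements being trivial.\<close>

lemma witnessed_iff_oeval:
  assumes a: "\<And>i. Fsubspace F d (a i)"
  shows "witnessed (Fvec F d) a (\<lambda>i. Fperp F d (a i)) t b v \<longleftrightarrow>
    v \<in> (if b then oeval (LF F d) a t else Fperp F d (oeval (LF F d) a t))"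
proof (induction t arbitrary: b v)
  case (OVar i)
  then show ?case using subspaceD(6)[OF a] subspaceD(6)[OF subspace_perp] by auto
next
  case (OJoin s t)
  let ?s = "oeval (LF F d) a s" and ?t = "oeval (LF F d) a t"
  have S: "Fsubspace F d ?s" "Fsubspace F d ?t" by (rule oeval_LF_subspace, rule a)+
  show ?case
  proof (cases b)
    case True
    then show ?thesis using subspaceD(6)[OF subspace_ssum[OF S]]
      by (simp add: OJoin.IH ssum_iff) blast
  next
    case False
    then show ?thesis using subspaceD(6)[OF subspace_perp, of v]
      by (auto simp: OJoin.IH perp_ssum[OF S])
  qed
next
  case (OMeet s t)
  let ?s = "oeval (LF F d) a s" and ?t = "oeval (LF F d) a t"
  have S: "Fsubspace F d ?s" "Fsubspace F d ?t" by (rule oeval_LF_subspace, rule a)+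
  show ?case
  proof (cases b)
    case True
    then show ?thesis using subspaceD(6)[OF S(1), of v] by (auto simp: OMeet.IH)
  next
    case False
    then show ?thesis using subspaceD(6)[OF subspace_ssum[OF subspace_perp subspace_perp], of _ d ?s ?t]
      by (simp add: OMeet.IH ssum_iff perp_Int[OF S]) blast
  qed
next
  case (OCompl t)
  have "Fsubspace F d (oeval (LF F d) a t)" by (rule oeval_LF_subspace) (rule a)
  then show ?case by (simp add: OCompl perp_perp)
next
  case OZero
  then show ?case by (auto simp: perp_0)
next
  case OOne
  then show ?case by (auto simp: perp_Fvec)
qed

lemma nontrivially_witnessed_iff:
  "nontrivially_witnessed F d t \<longleftrightarrow> \<not> holds_in (LF F d) (t, OZero)"
proof
  assume "nontrivially_witnessed F d t"
  then obtain U W v where UW: "\<forall>i. \<forall>x\<in>U i. \<forall>y\<in>W i. vinner d x y = 0"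
    "witnessed (Fvec F d) U W t True v" "v \<noteq> 0"
    by (auto simp: nontrivially_witnessed_def)
  \<comment> \<open>The complement of \<open>W i\<close> is a subspace containing
    \<open>U i\<close>, and its own complement contains \<open>W i\<close>; so \<open>a\<close> can
    only enlarge the sets that supply vectors.\<close>
  define a where "a i = Fperp F d (W i \<inter> Fvec F d)" for i
  have a: "Fsubspace F d (a i)" for i by (simp add: a_def subspace_perp)
  have U: "x \<in> a i" if "x \<in> Fvec F d" "x \<in> U i" for x i
    using that UW(1) vinner_sym_0 unfolding a_def Fperp_def by blast
  have W: "x \<in> Fperp F d (a i)" if "x \<in> Fvec F d" "x \<in> W i" for x i
    using that perp_perp_superset[of "W i \<inter> Fvec F d" d] by (auto simp: a_def)
  have "witnessed (Fvec F d) a (\<lambda>i. Fperp F d (a i)) t True v"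
    using witnessed_transfer[OF _ _ _ _ _ UW(2), of "\<lambda>x. x" "Fvec F d" a "\<lambda>i. Fperp F d (a i)"] U W by auto
  then have "v \<in> oeval (LF F d) a t" using witnessed_iff_oeval[OF a, where t = t and b = True] by simp
  then show "\<not> holds_in (LF F d) (t, OZero)" using a UW(3) by (auto simp: holds_in_def)
next
  assume "\<not> holds_in (LF F d) (t, OZero)"
  then obtain a where a: "\<And>i. Fsubspace F d (a i)" "oeval (LF F d) a t \<noteq> {0}"
    by (auto simp: holds_in_def)
  have "Fsubspace F d (oeval (LF F d) a t)" by (rule oeval_LF_subspace) (rule a)
  then obtain v where "v \<in> oeval (LF F d) a t" "v \<noteq> 0"
    using subspaceD(2) a(2) by blast
  moreover have "\<forall>i. \<forall>x\<in>a i. \<forall>y\<in>Fperp F d (a i). vinner d x y = 0" by (auto simp: Fperp_def)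
  moreover from calculation have "witnessed (Fvec F d) a (\<lambda>i. Fperp F d (a i)) t True v"
    using witnessed_iff_oeval[of d a t True v] a(1) by simp
  ultimately show "nontrivially_witnessed F d t"
    unfolding nontrivially_witnessed_def
    by (intro exI[of _ a] exI[of _ "\<lambda>i. Fperp F d (a i)"] exI[of _ v] conjI)
qed

lemma QL_LF_iff: "e \<in> QL (LF F d) \<longleftrightarrow> \<not> nontrivially_witnessed F d (term_diff e)"
proof -
  have "ssum X Y \<inter> Fperp F d (X \<inter> Y) = {0} \<longleftrightarrow> X = Y" (is "?l \<longleftrightarrow> _")
    if X: "Fsubspace F d X" and Y: "Fsubspace F d Y" for X Y
  proof
    assume l: ?l
    have "ssum X Y \<subseteq> X \<inter> Y"
    proof
      fix v assume v: "v \<in> ssum X Y"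
      \<comment> \<open>Orthomodular argument: the part of \<open>v\<close> orthogonal to the
        intersection still lies in the sum, hence vanishes by \<open>?l\<close>.\<close>
      then have "v \<in> ssum (X \<inter> Y) (Fperp F d (X \<inter> Y))"
        using ssum_perp[OF subspace_Int[OF X Y]] subspaceD(6)[OF subspace_ssum[OF X Y]] by simp
      then obtain p q where pq: "p \<in> X \<inter> Y" "q \<in> Fperp F d (X \<inter> Y)" "v = p + q" by (auto simp: ssum_iff)
      have "v - p \<in> ssum X Y"
        using v pq(1) ssum_superset(1)[OF X Y] by (intro subspaceD(4)[OF subspace_ssum[OF X Y]]) auto
      then have "q = 0" using l pq by auto
      then show "v \<in> X \<inter> Y" using pq by simp
    qed
    then show "X = Y" using ssum_superset[OF X Y] by blast
  next
    assume "X = Y"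
    then have "ssum X Y = X" using ssum_superset(1)[OF X X] ssum_least[OF X] by blast
    then show ?l using inter_perp[OF X] \<open>X = Y\<close> by simp
  qed
  then show ?thesis
    unfolding nontrivially_witnessed_iff QL_def holds_in_def
    by (auto simp: term_diff_def oeval_LF_subspace)
qed

end

interpretation UNIV_field: conj_subfield UNIV
  by unfold_locales (auto simp: conj_closed_subfield_def)

section \<open>From complex to real algebraic coordinates\<close>

definition realify :: "nat \<Rightarrow> (nat \<Rightarrow> complex) \<Rightarrow> nat \<Rightarrow> real" where
  "realify d v i = (if i < d then Re (v i) else if i < 2 * d then Im (v (i - d)) else 0)"

lemma realify_add: "realify d (x + y) i = realify d x i + realify d y i"
  by (simp add: realify_def)

lemma sum_split_double:
  fixes d :: nat
  shows "(\<Sum>i<2 * d. f i) = (\<Sum>i<d. f i) + (\<Sum>i<d. f (i + d) :: 'a :: comm_monoid_add)"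
proof -
  have "(\<Sum>i<d + d. f i) = (\<Sum>i<d. f i) + (\<Sum>i\<in>{d..<d + d}. f i)"
    using sum.atLeastLessThan_concat[of 0 d "d + d" f] by (simp add: lessThan_atLeast0)
  also have "(\<Sum>i\<in>{d..<d + d}. f i) = (\<Sum>i<d. f (i + d))"
    using sum.shift_bounds_nat_ivl[of f 0 d d] by (simp add: lessThan_atLeast0)
  finally show ?thesis by (simp add: mult_2)
qed

text \<open>The Euclidean product sees only the real part of the Hermitian one. This suffices
  because orthogonality is carried from the complex to the real side only.\<close>

lemma realify_inner: "(\<Sum>i<2 * d. realify d x i * realify d y i) = Re (vinner d x y)"
  unfolding sum_split_double by (simp add: realify_def vinner_def sum.distrib)

lemma nontrivially_witnessed_specialize:
  assumes "nontrivially_witnessed UNIV d t" and F: "conj_closed_subfield F"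
    and alg: "{x :: complex. algebraic x} \<inter> \<real> \<subseteq> F"
  shows "nontrivially_witnessed F (2 * d) t"
proof -
  obtain U W v where UW: "\<forall>i. \<forall>x\<in>U i. \<forall>y\<in>W i. vinner d x y = 0"
    "witnessed (Fvec UNIV d) U W t True v" "v \<noteq> 0"
    using assms(1) by (auto simp: nontrivially_witnessed_def)
  obtain S where S: "finite S" "S \<subseteq> Fvec UNIV d" "witnessed S U W t True v"
    using witnessed_finite[OF UW(2)] by blast
  have vS: "v \<in> S" by (rule witnessed_in[OF S(3)])
  let ?r = "realify d"
  \<comment> \<open>\<open>\<psi>\<close> respects a sum of two numbers only if the sum is in
    \<open>C\<close> too. An inner product is therefore added up term by term, with every partial
    sum placed in \<open>C\<close>.\<close>
  define psum where "psum x y k = (\<Sum>i<k. ?r x i * ?r y i)" for x y k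
  \<comment> \<open>The element 0 makes \<open>\<psi>\<close> vanish at 0, so that coordinates from
    \<open>2 * d\<close> on remain zero.\<close>
  define C where "C = insert 0 ((\<lambda>(x, i). ?r x i) ` (S \<times> {..<2 * d})
     \<union> (\<lambda>(x, y, i). ?r x i * ?r y i) ` (S \<times> S \<times> {..<2 * d})
     \<union> (\<lambda>(x, y, k). psum x y k) ` (S \<times> S \<times> {..2 * d}))"
  have "finite C" using S(1) by (simp add: C_def)
  from finite_real_specialization[OF this] obtain \<psi> :: "real \<Rightarrow> real" where
    "\<forall>x\<in>C. algebraic (\<psi> x)" "\<forall>x\<in>C. \<psi> x = 0 \<longleftrightarrow> x = 0"
    "\<forall>x\<in>C. \<forall>y\<in>C. x + y \<in> C \<longrightarrow> \<psi> (x + y) = \<psi> x + \<psi> y"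
    "\<forall>x\<in>C. \<forall>y\<in>C. x * y \<in> C \<longrightarrow> \<psi> (x * y) = \<psi> x * \<psi> y"
    by (elim exE conjE)
  note \<psi> = this[rule_format]
  have C0: "0 \<in> C" by (simp add: C_def)
  have Cr: "?r x i \<in> C" if "x \<in> S" for x i
    using that by (cases "i < 2 * d") (force simp: C_def, simp add: realify_def C_def)
  have Cp: "?r x i * ?r y i \<in> C" if "x \<in> S" "y \<in> S" "i < 2 * d" for x y i
    using that unfolding C_def by force
  have Cs: "psum x y k \<in> C" if "x \<in> S" "y \<in> S" "k \<le> 2 * d" for x y k
    using that unfolding C_def by force
  define \<Psi> where "\<Psi> x = (\<lambda>i. complex_of_real (\<psi> (?r x i)))" for x
  have \<psi>0: "\<psi> 0 = 0" using \<psi>(2)[OF C0] by simp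
  have inF: "\<Psi> x \<in> Fvec F (2 * d)" if "x \<in> S" for x
  proof -
    have "complex_of_real (\<psi> (?r x i)) \<in> F" for i using alg \<psi>(1)[OF Cr[OF that, of i]] by auto
    moreover have "?r x i = 0" if "i \<ge> 2 * d" for i using that by (simp add: realify_def)
    ultimately show ?thesis using \<psi>0 by (simp add: Fvec_def \<Psi>_def)
  qed
  have orth: "vinner (2 * d) (\<Psi> x) (\<Psi> y) = 0" if xS: "x \<in> S" and yS: "y \<in> S" and xy: "vinner d x y = 0" for x y
  proof -
    have "(\<Sum>i<k. \<psi> (?r x i) * \<psi> (?r y i)) = \<psi> (psum x y k)" if "k \<le> 2 * d" for k
      using that
    proof (induction k)
      case 0
      then show ?case by (simp add: psum_def \<psi>0)
    next
      case (Suc k)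
      have "psum x y (Suc k) = psum x y k + ?r x k * ?r y k" by (simp add: psum_def)
      then have "\<psi> (psum x y (Suc k)) = \<psi> (psum x y k) + \<psi> (?r x k * ?r y k)"
        using \<psi>(3)[OF Cs[OF xS yS, of k] Cp[OF xS yS, of k]] Cs[OF xS yS, of "Suc k"] Suc.prems by simp
      also have "\<psi> (?r x k * ?r y k) = \<psi> (?r x k) * \<psi> (?r y k)"
        using \<psi>(4)[OF Cr[OF xS] Cr[OF yS] Cp[OF xS yS, of k]] Suc.prems by simp
      finally show ?case using Suc by simp
    qed
    then have "(\<Sum>i<2 * d. \<psi> (?r x i) * \<psi> (?r y i)) = 0"
      using xy \<psi>0 by (simp add: psum_def realify_inner)
    then have "complex_of_real (\<Sum>i<2 * d. \<psi> (?r x i) * \<psi> (?r y i)) = 0" by (simp only: of_real_0)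
    then show ?thesis by (simp add: vinner_def \<Psi>_def)
  qed
  have "\<Psi> v \<noteq> 0"
  proof
    assume z: "\<Psi> v = 0"
    have r0: "?r v i = 0" for i
      using fun_cong[OF z, of i] \<psi>(2)[OF Cr[OF vS]] by (simp add: \<Psi>_def)
    have "v i = 0" for i
    proof (cases "i < d")
      case True
      then show ?thesis using r0[of i] r0[of "i + d"] by (simp add: realify_def complex_eq_iff)
    next
      case False
      then show ?thesis using vS S(2) by (auto simp: Fvec_def)
    qed
    then show False using UW(3) by auto
  qed
  moreover have "witnessed (Fvec F (2 * d)) (\<lambda>i. \<Psi> ` (U i \<inter> S)) (\<lambda>i. \<Psi> ` (W i \<inter> S)) t True (\<Psi> v)"
  proof (rule witnessed_transfer[OF _ _ _ _ _ S(3)])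
    show "\<Psi> (x + y) = \<Psi> x + \<Psi> y" if "x \<in> S" "y \<in> S" "x + y \<in> S" for x y
      using that \<psi>(3)[OF Cr[OF that(1)] Cr[OF that(2)]] Cr[OF that(3)]
      by (auto simp: \<Psi>_def realify_add)
    show "\<Psi> 0 = 0" by (simp add: \<Psi>_def realify_def \<psi>0 fun_eq_iff)
  qed (use inF in auto)
  ultimately show ?thesis unfolding nontrivially_witnessed_def using UW(1) orth
    by (intro exI[of _ "\<lambda>i. \<Psi> ` (U i \<inter> S)"] exI[of _ "\<lambda>i. \<Psi> ` (W i \<inter> S)"] exI[of _ "\<Psi> v"]) auto
qed

lemma QL_LF_all_iff:
  assumes "conj_closed_subfield F"
  shows "e \<in> (\<Inter>d. QL (LF F d)) \<longleftrightarrow> (\<forall>d. \<not> nontrivially_witnessed F d (term_diff e))"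
  using conj_subfield.QL_LF_iff[of F e] assms by (simp add: conj_subfield_def)

text \<open>Enlarging the field keeps the dimension, but the way back doubles it; hence the
  comparison of intersections over all dimensions.\<close>

lemma QL_LF_field_independent:
  assumes "conj_closed_subfield F" "{x :: complex. algebraic x} \<inter> \<real> \<subseteq> F"
  shows "(\<Inter>d. QL (LF UNIV d)) = (\<Inter>d. QL (LF F d))"
proof -
  have "(\<exists>d. nontrivially_witnessed UNIV d t) \<longleftrightarrow> (\<exists>d. nontrivially_witnessed F d t)" for t
    using nontrivially_witnessed_specialize[OF _ assms] nontrivially_witnessed_mono[of F _ t UNIV]
    by blast
  then show ?thesis
    unfolding set_eq_iff QL_LF_all_iff[OF assms(1)] QL_LF_all_iff[OF UNIV_field.F] by blast
qed

text \<open>A failure in dimension \<open>d\<close> would persist in all larger ones, so cofinally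
  many dimensions decide. It serves direct limits as well as the dimensions
  \<open>2 ^ n\<close>.\<close>

lemma QL_LF_unbounded:
  assumes F: "conj_closed_subfield F" and "\<And>d. \<exists>m\<ge>d. e \<in> QL (LF F m)"
  shows "e \<in> (\<Inter>d. QL (LF F d))"
proof -
  interpret conj_subfield F by unfold_locales (rule F)
  show ?thesis unfolding QL_LF_all_iff[OF F]
    using assms(2) nontrivially_witnessed_mono[of F _ _ F] QL_LF_iff by blast
qed

section \<open>Variables of a term and direct limits\<close>

primrec ovars :: "olterm \<Rightarrow> nat set" where
  "ovars (OVar i) = {i}"
| "ovars (OJoin s t) = ovars s \<union> ovars t"
| "ovars (OMeet s t) = ovars s \<union> ovars t"
| "ovars (OCompl s) = ovars s"
| "ovars OZero = {}"
| "ovars OOne = {}"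

lemma finite_ovars: "finite (ovars t)"
  by (induction t) auto

lemma oeval_cong: "(\<And>i. i \<in> ovars t \<Longrightarrow> a i = b i) \<Longrightarrow> oeval L a t = oeval L b t"
  by (induction t) auto

lemma hom_oeval:
  assumes "ol_hom L M f" "\<And>t. oeval L a t \<in> ocarrier L"
  shows "oeval M (\<lambda>i. f (a i)) t = f (oeval L a t)"
proof (induction t)
  case (OJoin s t)
  then show ?case using assms(1) assms(2)[of s] assms(2)[of t] by (simp add: ol_hom_def)
next
  case (OMeet s t)
  then show ?case using assms(1) assms(2)[of s] assms(2)[of t] by (simp add: ol_hom_def)
next
  case (OCompl t)
  then show ?case using assms(1) assms(2)[of t] by (simp add: ol_hom_def)
qed (use assms(1) in \<open>simp_all add: ol_hom_def\<close>)

lemma direct_limit_lift: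
  assumes "is_LF_direct_limit F d f L \<phi>" "X \<in> ocarrier (LF F (d n))" "n \<le> N"
  shows "\<exists>Y\<in>ocarrier (LF F (d N)). \<phi> N Y = \<phi> n X"
  using assms(3)
proof (induction N rule: dec_induct)
  case base
  then show ?case using assms(2) by blast
next
  case (step N)
  then obtain Y where Y: "Y \<in> ocarrier (LF F (d N))" "\<phi> N Y = \<phi> n X" by blast
  then have "f N Y \<in> ocarrier (LF F (d (Suc N)))" "\<phi> (Suc N) (f N Y) = \<phi> N Y"
    using assms(1) by (auto simp: is_LF_direct_limit_def ol_emb_def ol_hom_def)
  then show ?case using Y(2) by auto
qed

text \<open>The values of the finitely many variables of an identity come from one common level.
  Conversely each level embeds into \<open>L\<close>, and the dimensions of the levels are
  unbounded.\<close>

lemma QL_direct_limit: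
  assumes F: "conj_closed_subfield F" and d: "filterlim d at_top sequentially"
    and L: "is_LF_direct_limit F d f L \<phi>"
  shows "(\<Inter>d. QL (LF F d)) = QL L"
proof
  interpret conj_subfield F by unfold_locales (rule F)
  have hom: "ol_hom (LF F (d n)) L (\<phi> n)" and inj: "inj_on (\<phi> n) {X. Fsubspace F (d n) X}" for n
    using L by (auto simp: is_LF_direct_limit_def ol_emb_def)
  show "(\<Inter>d. QL (LF F d)) \<subseteq> QL L"
  proof
    fix e assume e: "e \<in> (\<Inter>d. QL (LF F d))"
    show "e \<in> QL L"
      unfolding QL_def holds_in_def
    proof (intro CollectI allI impI)
      fix a assume a: "\<forall>i :: nat. a i \<in> ocarrier L"
      have "ocarrier L = (\<Union>n. \<phi> n ` ocarrier (LF F (d n)))"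
        using L by (simp only: is_LF_direct_limit_def)
      then have "\<forall>i. \<exists>n X. X \<in> ocarrier (LF F (d n)) \<and> a i = \<phi> n X"
        using a by fast
      then obtain n X where X: "\<And>i. X i \<in> ocarrier (LF F (d (n i)))" "\<And>i. a i = \<phi> (n i) (X i)"
        by metis
      define V where "V = ovars (fst e) \<union> ovars (snd e)"
      \<comment> \<open>The inserted 0 covers identities without variables, where \<open>V\<close>
        is empty.\<close>
      define N where "N = Max (insert 0 (n ` V))"
      have "finite V" by (simp add: V_def finite_ovars)
      then have N: "n i \<le> N" if "i \<in> V" for i using that by (simp add: N_def)
      \<comment> \<open>Values of variables outside \<open>V\<close> may come from arbitrarily high
        levels; the zero subspace replaces them.\<close>
      have "\<exists>Y. Y \<in> ocarrier (LF F (d N)) \<and> (i \<in> V \<longrightarrow> \<phi> N Y = a i)" for i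
      proof (cases "i \<in> V")
        case True
        then show ?thesis using direct_limit_lift[OF L X(1) N, of i] X(2)[of i] by auto
      next
        case False
        then show ?thesis using subspace_0 by auto
      qed
      then obtain Y where Y: "\<And>i. Y i \<in> ocarrier (LF F (d N))" "\<And>i. i \<in> V \<Longrightarrow> \<phi> N (Y i) = a i"
        by metis
      have c: "oeval (LF F (d N)) Y t \<in> ocarrier (LF F (d N))" for t
        using Y(1) oeval_LF_subspace by simp
      have "oeval L a t = \<phi> N (oeval (LF F (d N)) Y t)" if "ovars t \<subseteq> V" for t
        using hom_oeval[OF hom c, of t] oeval_cong[of t a "\<lambda>i. \<phi> N (Y i)" L] Y(2) that by (simp add: subset_iff)
      moreover have "oeval (LF F (d N)) Y (fst e) = oeval (LF F (d N)) Y (snd e)"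
        using e Y(1) by (auto simp: QL_def holds_in_def)
      ultimately show "oeval L a (fst e) = oeval L a (snd e)" by (simp add: V_def)
    qed
  qed
  show "QL L \<subseteq> (\<Inter>d. QL (LF F d))"
  proof
    fix e assume e: "e \<in> QL L"
    have n: "e \<in> QL (LF F (d n))" for n
      unfolding QL_def holds_in_def
    proof (intro CollectI allI impI)
      fix a assume a: "\<forall>i :: nat. a i \<in> ocarrier (LF F (d n))"
      then have c: "oeval (LF F (d n)) a t \<in> ocarrier (LF F (d n))" for t
        using oeval_LF_subspace by simp
      have "\<forall>i. \<phi> n (a i) \<in> ocarrier L" using hom a by (auto simp: ol_hom_def)
      then have "\<phi> n (oeval (LF F (d n)) a (fst e)) = \<phi> n (oeval (LF F (d n)) a (snd e))"
        unfolding hom_oeval[OF hom c, symmetric]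
        using e[unfolded QL_def holds_in_def, THEN CollectD, rule_format, of "\<lambda>i. \<phi> n (a i)"] by simp
      then show "oeval (LF F (d n)) a (fst e) = oeval (LF F (d n)) a (snd e)"
        using inj_onD[OF inj] c by simp
    qed
    have "\<exists>m\<ge>k. e \<in> QL (LF F m)" for k
      using filterlim_at_top[THEN iffD1, OF d, rule_format, of k] n
      by (auto simp: eventually_sequentially)
    then show "e \<in> (\<Inter>d. QL (LF F d))" by (rule QL_LF_unbounded[OF F])
  qed
qed

section \<open>The dimension metric\<close>

definition lower_half :: "nat \<Rightarrow> (nat \<Rightarrow> complex) \<Rightarrow> nat \<Rightarrow> complex" where
  "lower_half N v = (\<lambda>i. if i < N then v i else 0)"

definition upper_half :: "nat \<Rightarrow> (nat \<Rightarrow> complex) \<Rightarrow> nat \<Rightarrow> complex" where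
  "upper_half N v = (\<lambda>i. if i < N then v (i + N) else 0)"

definition vcat :: "nat \<Rightarrow> (nat \<Rightarrow> complex) \<Rightarrow> (nat \<Rightarrow> complex) \<Rightarrow> nat \<Rightarrow> complex" where
  "vcat N x y = (\<lambda>i. if i < N then x i else y (i - N))"

lemma half_linear:
  "lower_half N (x + y) = lower_half N x + lower_half N y"
  "upper_half N (x + y) = upper_half N x + upper_half N y"
  "lower_half N (vsmul c x) = vsmul c (lower_half N x)"
  "upper_half N (vsmul c x) = vsmul c (upper_half N x)"
  "lower_half N 0 = 0" "upper_half N 0 = 0"
  by (auto simp: lower_half_def upper_half_def fun_eq_iff)

lemma vcat_linear:
  "vcat N (x + x') (y + y') = vcat N x y + vcat N x' y'"
  "vcat N (vsmul c x) (vsmul c y) = vsmul c (vcat N x y)"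
  "vcat N 0 0 = 0"
  by (auto simp: vcat_def fun_eq_iff)

lemma vinner_halves:
  "vinner (2 * N) u v = vinner N (lower_half N u) (lower_half N v) + vinner N (upper_half N u) (upper_half N v)"
  unfolding vinner_def sum_split_double by (simp add: lower_half_def upper_half_def)

context conj_subfield
begin

section \<open>The doubling map as an ortholattice homomorphism\<close>

lemma half_in_Fvec:
  assumes "v \<in> Fvec F (2 * N)"
  shows "lower_half N v \<in> Fvec F N" "upper_half N v \<in> Fvec F N"
  using assms by (auto simp: Fvec_def lower_half_def upper_half_def)

lemma vcat_in_Fvec: "x \<in> Fvec F N \<Longrightarrow> y \<in> Fvec F N \<Longrightarrow> vcat N x y \<in> Fvec F (2 * N)"
  by (auto simp: Fvec_def vcat_def)

lemma half_vcat:
  assumes "x \<in> Fvec F N" "y \<in> Fvec F N"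
  shows "lower_half N (vcat N x y) = x" "upper_half N (vcat N x y) = y"
  using assms by (auto simp: Fvec_def lower_half_def upper_half_def vcat_def fun_eq_iff)

lemma vcat_halves: "v \<in> Fvec F (2 * N) \<Longrightarrow> vcat N (lower_half N v) (upper_half N v) = v"
  by (auto simp: Fvec_def lower_half_def upper_half_def vcat_def fun_eq_iff)

lemma dbl_iff: "v \<in> dbl F n X \<longleftrightarrow>
    v \<in> Fvec F (2 * 2 ^ n) \<and> lower_half (2 ^ n) v \<in> X \<and> upper_half (2 ^ n) v \<in> X"
  by (simp add: dbl_def lower_half_def upper_half_def)

lemma vcat_in_dbl:
  assumes "Fsubspace F (2 ^ n) X" "x \<in> X" "y \<in> X"
  shows "vcat (2 ^ n) x y \<in> dbl F n X"
  using assms subspaceD(6)[OF assms(1)] by (simp add: dbl_iff vcat_in_Fvec half_vcat)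

lemma subspace_dbl: "Fsubspace F (2 ^ n) X \<Longrightarrow> Fsubspace F (2 ^ Suc n) (dbl F n X)"
  by (auto simp: subspace_iff dbl_iff half_linear)

lemma dbl_Int: "dbl F n (X \<inter> Y) = dbl F n X \<inter> dbl F n Y"
  by (auto simp: dbl_iff)

lemma dbl_ssum:
  assumes X: "Fsubspace F (2 ^ n) X" and Y: "Fsubspace F (2 ^ n) Y"
  shows "dbl F n (ssum X Y) = ssum (dbl F n X) (dbl F n Y)"
proof
  show "dbl F n (ssum X Y) \<subseteq> ssum (dbl F n X) (dbl F n Y)"
  proof
    fix v assume v: "v \<in> dbl F n (ssum X Y)"
    then obtain x1 y1 x2 y2 where xy: "lower_half (2 ^ n) v = x1 + y1" "upper_half (2 ^ n) v = x2 + y2"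
      "x1 \<in> X" "x2 \<in> X" "y1 \<in> Y" "y2 \<in> Y"
      by (auto simp: dbl_iff ssum_iff)
    have "v = vcat (2 ^ n) (x1 + y1) (x2 + y2)"
      using vcat_halves[of v "2 ^ n"] v xy(1,2) by (simp add: dbl_iff)
    then have "v = vcat (2 ^ n) x1 x2 + vcat (2 ^ n) y1 y2" by (simp add: vcat_linear)
    then show "v \<in> ssum (dbl F n X) (dbl F n Y)"
      unfolding ssum_iff using vcat_in_dbl[OF X xy(3,4)] vcat_in_dbl[OF Y xy(5,6)] by blast
  qed
  show "ssum (dbl F n X) (dbl F n Y) \<subseteq> dbl F n (ssum X Y)"
  proof
    fix v assume "v \<in> ssum (dbl F n X) (dbl F n Y)"
    then obtain x y where xy: "x \<in> dbl F n X" "y \<in> dbl F n Y" "v = x + y" by (auto simp: ssum_iff)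
    have "v \<in> Fvec F (2 * 2 ^ n)" using xy by (simp add: dbl_iff)
    moreover have "lower_half (2 ^ n) v \<in> ssum X Y" "upper_half (2 ^ n) v \<in> ssum X Y"
      unfolding ssum_iff xy(3) half_linear using xy(1,2) by (auto simp: dbl_iff)
    ultimately show "v \<in> dbl F n (ssum X Y)" by (simp add: dbl_iff)
  qed
qed

lemma dbl_perp:
  assumes X: "Fsubspace F (2 ^ n) X"
  shows "dbl F n (Fperp F (2 ^ n) X) = Fperp F (2 ^ Suc n) (dbl F n X)"
proof
  show "dbl F n (Fperp F (2 ^ n) X) \<subseteq> Fperp F (2 ^ Suc n) (dbl F n X)"
    by (auto simp: dbl_iff Fperp_def vinner_halves)
  show "Fperp F (2 ^ Suc n) (dbl F n X) \<subseteq> dbl F n (Fperp F (2 ^ n) X)"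
  proof
    fix v assume "v \<in> Fperp F (2 ^ Suc n) (dbl F n X)"
    then have v: "v \<in> Fvec F (2 * 2 ^ n)" "\<And>u. u \<in> dbl F n X \<Longrightarrow> vinner (2 * 2 ^ n) u v = 0"
      by (auto simp: Fperp_def)
    have "vinner (2 ^ n) x (lower_half (2 ^ n) v) = 0 \<and> vinner (2 ^ n) x (upper_half (2 ^ n) v) = 0"
      if x: "x \<in> X" for x
    proof -
      \<comment> \<open>Pairing \<open>v\<close> with the vectors \<open>(x, 0)\<close> and
        \<open>(0, x)\<close> isolates its two halves.\<close>
      note x0 = x subspaceD(2)[OF X]
      show ?thesis
        using v(2)[OF vcat_in_dbl[OF X x0]] v(2)[OF vcat_in_dbl[OF X x0(2,1)]]
          half_vcat subspaceD(6)[OF X] x0 by (simp add: vinner_halves half_vcat)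
    qed
    then show "v \<in> dbl F n (Fperp F (2 ^ n) X)"
      using v(1) half_in_Fvec[OF v(1)] by (auto simp: dbl_iff Fperp_def)
  qed
qed

lemma dbl_hom: "ol_hom (LF F (2 ^ n)) (LF F (2 ^ Suc n)) (dbl F n)"
proof -
  have "v = 0" if "v \<in> dbl F n {0}" for v
    using vcat_halves[of v "2 ^ n"] that vcat_linear(3)[of "2 ^ n"] by (simp add: dbl_iff)
  moreover have "0 \<in> dbl F n {0}" by (simp add: dbl_iff half_linear)
  ultimately have z: "dbl F n {0} = {0}" by blast
  have o: "dbl F n (Fvec F (2 ^ n)) = Fvec F (2 ^ Suc n)"
    unfolding set_eq_iff dbl_iff using half_in_Fvec[of _ "2 ^ n"] by auto
  show ?thesis
    unfolding ol_hom_def LF_simps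
    by (intro conjI ballI) (simp_all add: subspace_dbl dbl_ssum dbl_Int dbl_perp z o del: power_Suc)
qed

text \<open>An isometry carries an orthogonal basis to an orthogonal set of the same size, whose
  span is the image.\<close>

lemma Fdim_image_isometry:
  assumes X: "Fsubspace F d X"
    and T: "\<And>x y. x \<in> Fvec F d \<Longrightarrow> y \<in> Fvec F d \<Longrightarrow> vinner d' (T x) (T y) = vinner d x y"
    and im: "\<And>x. x \<in> Fvec F d \<Longrightarrow> T x \<in> Fvec F d'"
    and lin: "\<And>x y. T (x + y) = T x + T y" "\<And>c x. T (vsmul c x) = vsmul c (T x)" "T 0 = 0"
  shows "Fsubspace F d' (T ` X)" "Fdim F (T ` X) = Fdim F X"
proof -
  obtain B where B: "orth_set d B" "Fspan F B = X" using orth_basis_exists[OF X] by blast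
  have BV: "finite B" "B \<subseteq> Fvec F d" using B(1) by (auto simp: orth_set_def)
  have inj: "inj_on T B"
  proof (rule inj_onI, rule ccontr)
    fix a b assume ab: "a \<in> B" "b \<in> B" "T a = T b" "a \<noteq> b"
    then have "vinner d a b = vinner d a a" using T BV(2) by (metis subsetD)
    then show False using ab B(1) orth_set_norm[OF B(1) ab(1)] by (simp add: orth_set_def)
  qed
  have ortho: "orth_set d' (T ` B)"
  proof -
    have "T b \<noteq> 0" if "b \<in> B" for b
      using orth_set_norm[OF B(1) that] T[of b b] that BV(2) by auto
    moreover have "vinner d' (T a) (T b) = 0" if "a \<in> B" "b \<in> B" "T a \<noteq> T b" for a b
    proof -
      have "a \<noteq> b" "a \<in> Fvec F d" "b \<in> Fvec F d" using that BV(2) by auto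
      then show ?thesis using that T B(1) by (simp add: orth_set_def)
    qed
    moreover have "T b \<in> Fvec F d'" if "b \<in> B" for b using that im BV(2) by auto
    ultimately show ?thesis unfolding orth_set_def using BV(1) by fastforce
  qed
  have Tsum: "T (\<Sum>b\<in>I. f b) = (\<Sum>b\<in>I. T (f b))" for f and I :: "(nat \<Rightarrow> complex) set"
    by (induction I rule: infinite_finite_induct)
      (simp_all only: sum.infinite sum.empty sum.insert lin not_False_eq_True)
  have "Fspan F (T ` B) = T ` X"
  proof
    show "Fspan F (T ` B) \<subseteq> T ` X"
    proof
      fix v assume "v \<in> Fspan F (T ` B)"
      then obtain c where c: "\<forall>b\<in>T ` B. c b \<in> F" "v = (\<Sum>b\<in>T ` B. vsmul (c b) b)"
        using Fspan_finite[OF finite_imageI[OF BV(1)]] by blast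
      have "v = T (\<Sum>b\<in>B. vsmul (c (T b)) b)"
        unfolding c(2) by (simp add: sum.reindex[OF inj] Tsum lin)
      moreover have "(\<Sum>b\<in>B. vsmul (c (T b)) b) \<in> X"
        unfolding B(2)[symmetric] Fspan_finite[OF BV(1)]
        by (rule exI[of _ "\<lambda>b. c (T b)"]) (use c(1) in auto)
      ultimately show "v \<in> T ` X" by blast
    qed
    show "T ` X \<subseteq> Fspan F (T ` B)"
    proof
      fix v assume "v \<in> T ` X"
      then obtain x where x: "x \<in> Fspan F B" "v = T x" using B(2) by blast
      then obtain c where c: "\<forall>b\<in>B. c b \<in> F" "v = T (\<Sum>b\<in>B. vsmul (c b) b)"
        unfolding Fspan_finite[OF BV(1)] by metis
      have "v = (\<Sum>b\<in>T ` B. vsmul (c (inv_into B T b)) b)"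
        unfolding c(2) by (simp add: sum.reindex[OF inj] Tsum lin inv_into_f_f[OF inj])
      then show "v \<in> Fspan F (T ` B)"
        unfolding Fspan_finite[OF finite_imageI[OF BV(1)]]
        by (intro exI[of _ "\<lambda>b. c (inv_into B T b)"]) (use c(1) inv_into_f_f[OF inj] in auto)
    qed
  qed
  then show "Fdim F (T ` X) = Fdim F X" "Fsubspace F d' (T ` X)"
    using Fdim_orth[OF ortho] Fdim_orth[OF B] card_image[OF inj] subspace_Fspan[of "T ` B" d'] ortho
    by (auto simp: orth_set_def)
qed

text \<open>The doubled subspace is the sum of two isometric copies of \<open>X\<close> meeting in
  0, so the modular law gives the factor 2. The division by \<open>2 ^ k\<close> in
  \<open>delta\<close> compensates for it.\<close>

lemma Fdim_dbl:
  assumes X: "Fsubspace F (2 ^ n) X"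
  shows "Fdim F (dbl F n X) = 2 * Fdim F X"
proof -
  let ?N = "2 ^ n" and ?A = "(\<lambda>x. vcat (2 ^ n) x 0) ` X" and ?B = "(\<lambda>x. vcat (2 ^ n) 0 x) ` X"
  have lin: "vcat ?N (x + y) 0 = vcat ?N x 0 + vcat ?N y 0" "vcat ?N 0 (x + y) = vcat ?N 0 x + vcat ?N 0 y"
    "vcat ?N (vsmul c x) 0 = vsmul c (vcat ?N x 0)" "vcat ?N 0 (vsmul c x) = vsmul c (vcat ?N 0 x)" for c x y
    by (auto simp: vcat_def fun_eq_iff)
  have A: "Fsubspace F (2 * ?N) ?A" "Fdim F ?A = Fdim F X"
    by (rule Fdim_image_isometry[OF X, where d' = "2 * ?N"];
        simp add: lin vcat_linear vcat_in_Fvec vinner_halves half_vcat)+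
  have B: "Fsubspace F (2 * ?N) ?B" "Fdim F ?B = Fdim F X"
    by (rule Fdim_image_isometry[OF X, where d' = "2 * ?N"];
        simp add: lin vcat_linear vcat_in_Fvec vinner_halves half_vcat)+
  have "dbl F n X = ssum ?A ?B"
  proof
    show "ssum ?A ?B \<subseteq> dbl F n X"
      using vcat_in_dbl[OF X] subspaceD(2)[OF X]
      by (intro ssum_least[OF subspace_dbl[OF X]]) auto
    show "dbl F n X \<subseteq> ssum ?A ?B"
    proof
      fix v assume v: "v \<in> dbl F n X"
      \<comment> \<open>The explicit zero summands bring the vector into the shape in which
        \<open>vcat_linear\<close> splits it.\<close>
      then have "v = vcat ?N (lower_half ?N v + 0) (0 + upper_half ?N v)" using vcat_halves by (simp add: dbl_iff)
      then have "v = vcat ?N (lower_half ?N v) 0 + vcat ?N 0 (upper_half ?N v)" by (simp only: vcat_linear)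
      then show "v \<in> ssum ?A ?B" unfolding ssum_iff using v by (auto simp: dbl_iff)
    qed
  qed
  moreover have "?A \<inter> ?B = {0}"
  proof -
    have "v = 0" if "v \<in> ?A" "v \<in> ?B" for v
    proof -
      obtain x y where "v = vcat ?N x 0" "v = vcat ?N 0 y" "x \<in> X" "y \<in> X" 
        using \<open>v \<in> ?A\<close> \<open>v \<in> ?B\<close> by blast
      then have "x = 0" using half_vcat(1)[of x ?N 0] half_vcat(1)[of 0 ?N y] subspaceD(6)[OF X] by auto
      then show ?thesis using \<open>v = vcat ?N x 0\<close> vcat_linear(3) by simp
    qed
    then show ?thesis using subspaceD(2)[OF A(1)] subspaceD(2)[OF B(1)] by blast
  qed
  ultimately show ?thesis using Fdim_modular[OF A(1) B(1)] A(2) B(2) Fdim_0 by simp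
qed

lemma liftk_props:
  assumes "Fsubspace F (2 ^ n) X"
  shows "Fsubspace F (2 ^ (n + k)) (liftk F n k X)" "Fdim F (liftk F n k X) = 2 ^ k * Fdim F X"
proof -
  have "Fsubspace F (2 ^ (n + k)) (liftk F n k X) \<and> Fdim F (liftk F n k X) = 2 ^ k * Fdim F X"
  proof (induction k)
    case 0
    then show ?case using assms by simp
  next
    case (Suc k)
    then show ?case using subspace_dbl[of "n + k" "liftk F n k X"] Fdim_dbl[of "n + k" "liftk F n k X"] by simp
  qed
  then show "Fsubspace F (2 ^ (n + k)) (liftk F n k X)" "Fdim F (liftk F n k X) = 2 ^ k * Fdim F X" by auto
qed

lemma liftk_hom: "ol_hom (LF F (2 ^ n)) (LF F (2 ^ (n + k))) (liftk F n k)"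
proof (induction k)
  case 0
  then show ?case by (simp add: ol_hom_def subspace_ssum subspace_Int subspace_perp)
next
  case (Suc k)
  then show ?case using dbl_hom[of "n + k"] unfolding ol_hom_def by simp
qed

lemma liftk_add: "liftk F n (a + b) X = liftk F (n + a) b (liftk F n a X)"
  by (induction b) (auto simp: add.assoc)

lemma up_props:
  assumes "p \<in> Linf_pts F" "fst p \<le> m"
  shows "Fsubspace F (2 ^ m) (up F m p)" "Fdim F (up F m p) = 2 ^ (m - fst p) * Fdim F (snd p)"
  using liftk_props[of "fst p" "snd p" "m - fst p"] assms by (auto simp: Linf_pts_def up_def)

lemma up_self: "up F (fst p) p = snd p" "up F n (n, X) = X"
  by (simp_all add: up_def)

lemma up_up: "fst p \<le> k \<Longrightarrow> k \<le> m \<Longrightarrow> up F m (k, up F k p) = up F m p"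
  using liftk_add[of "fst p" "k - fst p" "m - k" "snd p"] by (simp add: up_def)

lemma up_ops:
  assumes "k \<le> m" "Fsubspace F (2 ^ k) X" "Fsubspace F (2 ^ k) Y"
  shows "up F m (k, ssum X Y) = ssum (up F m (k, X)) (up F m (k, Y))"
    "up F m (k, X \<inter> Y) = up F m (k, X) \<inter> up F m (k, Y)"
    "up F m (k, Fperp F (2 ^ k) X) = Fperp F (2 ^ m) (up F m (k, X))"
    "up F m (k, {0}) = {0}" "up F m (k, Fvec F (2 ^ k)) = Fvec F (2 ^ m)"
  using liftk_hom[of k "m - k"] assms by (auto simp: ol_hom_def up_def)

section \<open>The height metric of the subspace lattice\<close>

definition gap :: "(nat \<Rightarrow> complex) set \<Rightarrow> (nat \<Rightarrow> complex) set \<Rightarrow> real" where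
  "gap A B = real (Fdim F (ssum A B)) - real (Fdim F (A \<inter> B))"

lemma ssum_commute: "ssum A B = ssum B A"
  unfolding set_eq_iff ssum_iff by (metis add.commute)

lemma gap_commute: "gap A B = gap B A"
  by (simp add: gap_def ssum_commute Int_commute)

lemma ssum_idem: "Fsubspace F d A \<Longrightarrow> ssum A A = A"
  using ssum_superset(1) ssum_least by blast

lemma gap_self: "Fsubspace F d A \<Longrightarrow> gap A A = 0"
  by (simp add: gap_def ssum_idem)

lemma gap_nonneg:
  assumes "Fsubspace F d A" "Fsubspace F d B"
  shows "0 \<le> gap A B"
  using Fdim_mono(1)[OF subspace_Int[OF assms] subspace_ssum[OF assms]] ssum_superset[OF assms]
  by (auto simp: gap_def)

lemma gap_eq_0:
  assumes "Fsubspace F d A" "Fsubspace F d B" "gap A B = 0"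
  shows "A = B"
  using Fdim_mono(2)[OF subspace_Int[OF assms(1,2)] subspace_ssum[OF assms(1,2)]]
    ssum_superset[OF assms(1,2)] assms(3)
  by (auto simp: gap_def)

text \<open>The modular law for \<open>A + B\<close> and \<open>B + C\<close> gives
  \<open>dim (A + C) + dim B \<le> dim (A + B) + dim (B + C)\<close>, and dually for the
  intersections. In the difference of the two estimates \<open>dim B\<close> cancels.\<close>

lemma gap_triangle:
  assumes A: "Fsubspace F d A" and B: "Fsubspace F d B" and C: "Fsubspace F d C"
  shows "gap A C \<le> gap A B + gap B C"
proof -
  note AB = subspace_ssum[OF A B] and BC = subspace_ssum[OF B C] and AC = subspace_ssum[OF A C]
  note iAB = subspace_Int[OF A B] and iBC = subspace_Int[OF B C] and iAC = subspace_Int[OF A C]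
  have "Fdim F B \<le> Fdim F (ssum A B \<inter> ssum B C)"
    using ssum_superset[OF A B] ssum_superset[OF B C] by (intro Fdim_mono(1)[OF B subspace_Int[OF AB BC]]) auto
  moreover have "Fdim F (ssum A C) \<le> Fdim F (ssum (ssum A B) (ssum B C))"
    using ssum_superset[OF A B] ssum_superset[OF B C] ssum_superset[OF AB BC]
    by (intro Fdim_mono(1)[OF AC subspace_ssum[OF AB BC]] ssum_least[OF subspace_ssum[OF AB BC]]) auto
  moreover have "Fdim F (ssum (A \<inter> B) (B \<inter> C)) \<le> Fdim F B"
    by (intro Fdim_mono(1)[OF subspace_ssum[OF iAB iBC] B] ssum_least[OF B]) auto
  moreover have "Fdim F ((A \<inter> B) \<inter> (B \<inter> C)) \<le> Fdim F (A \<inter> C)"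
    by (intro Fdim_mono(1)[OF subspace_Int[OF iAB iBC] iAC]) auto
  ultimately show ?thesis
    using Fdim_modular[OF AB BC] Fdim_modular[OF iAB iBC] unfolding gap_def by linarith
qed

text \<open>Both sums lie between \<open>?P + B\<close> and \<open>?Q + B\<close>. By the modular
  law the dimensions of these bounds differ by at most those of \<open>?P\<close> and
  \<open>?Q\<close>, as \<open>?P \<inter> B\<close> is contained in
  \<open>?Q \<inter> B\<close>.\<close>

lemma gap_ssum_left:
  assumes A: "Fsubspace F d A" and A': "Fsubspace F d A'" and B: "Fsubspace F d B"
  shows "gap (ssum A B) (ssum A' B) \<le> gap A A'"
proof -
  let ?P = "A \<inter> A'" and ?Q = "ssum A A'"
  note P = subspace_Int[OF A A'] and Q = subspace_ssum[OF A A']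
  note AB = subspace_ssum[OF A B] and A'B = subspace_ssum[OF A' B]
  note PB = subspace_ssum[OF P B] and QB = subspace_ssum[OF Q B]
  have "Fdim F (ssum (ssum A B) (ssum A' B)) \<le> Fdim F (ssum ?Q B)"
    using ssum_superset[OF A A'] ssum_superset[OF Q B]
    by (intro Fdim_mono(1)[OF subspace_ssum[OF AB A'B] QB] ssum_least[OF QB]) auto
  moreover have "Fdim F (ssum ?P B) \<le> Fdim F (ssum A B \<inter> ssum A' B)"
    using ssum_superset[OF A B] ssum_superset[OF A' B]
    by (intro Fdim_mono(1)[OF PB subspace_Int[OF AB A'B]] ssum_least[OF subspace_Int[OF AB A'B]]) auto
  moreover have "Fdim F (?P \<inter> B) \<le> Fdim F (?Q \<inter> B)"
    using ssum_superset[OF A A'] by (intro Fdim_mono(1)[OF subspace_Int[OF P B] subspace_Int[OF Q B]]) auto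
  ultimately show ?thesis
    using Fdim_modular[OF P B] Fdim_modular[OF Q B] unfolding gap_def by linarith
qed

lemma gap_Int_left:
  assumes A: "Fsubspace F d A" and A': "Fsubspace F d A'" and B: "Fsubspace F d B"
  shows "gap (A \<inter> B) (A' \<inter> B) \<le> gap A A'"
proof -
  let ?P = "A \<inter> A'" and ?Q = "ssum A A'"
  note P = subspace_Int[OF A A'] and Q = subspace_ssum[OF A A']
  note AB = subspace_Int[OF A B] and A'B = subspace_Int[OF A' B]
  have "Fdim F (ssum (A \<inter> B) (A' \<inter> B)) \<le> Fdim F (?Q \<inter> B)"
    using ssum_superset[OF A A']
    by (intro Fdim_mono(1)[OF subspace_ssum[OF AB A'B] subspace_Int[OF Q B]] ssum_least[OF subspace_Int[OF Q B]]) auto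
  moreover have "Fdim F (?P \<inter> B) = Fdim F ((A \<inter> B) \<inter> (A' \<inter> B))"
    by (rule arg_cong[of _ _ "Fdim F"]) auto
  moreover have "Fdim F (ssum ?P B) \<le> Fdim F (ssum ?Q B)"
    using ssum_superset[OF A A'] ssum_superset[OF Q B]
    by (intro Fdim_mono(1)[OF subspace_ssum[OF P B] subspace_ssum[OF Q B]] ssum_least[OF subspace_ssum[OF Q B]]) auto
  ultimately show ?thesis
    using Fdim_modular[OF P B] Fdim_modular[OF Q B] unfolding gap_def by linarith
qed

lemma gap_ssum:
  assumes A: "Fsubspace F d A" and A': "Fsubspace F d A'" and B: "Fsubspace F d B" and B': "Fsubspace F d B'"
  shows "gap (ssum A B) (ssum A' B') \<le> gap A A' + gap B B'"
  using gap_triangle[OF subspace_ssum[OF A B] subspace_ssum[OF A' B] subspace_ssum[OF A' B']]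
    gap_ssum_left[OF A A' B] gap_ssum_left[OF B B' A'] by (simp add: ssum_commute)

lemma gap_Int:
  assumes A: "Fsubspace F d A" and A': "Fsubspace F d A'" and B: "Fsubspace F d B" and B': "Fsubspace F d B'"
  shows "gap (A \<inter> B) (A' \<inter> B') \<le> gap A A' + gap B B'"
  using gap_triangle[OF subspace_Int[OF A B] subspace_Int[OF A' B] subspace_Int[OF A' B']]
    gap_Int_left[OF A A' B] gap_Int_left[OF B B' A'] by (simp add: Int_commute)

text \<open>Complementation exchanges sum and intersection and sends dimension \<open>k\<close> to
  \<open>d - k\<close>, so the two effects cancel.\<close>

lemma gap_perp:
  assumes A: "Fsubspace F d A" and B: "Fsubspace F d B"
  shows "gap (Fperp F d A) (Fperp F d B) = gap A B"
  using Fdim_perp[OF subspace_Int[OF A B]] Fdim_perp[OF subspace_ssum[OF A B]]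
  unfolding gap_def perp_Int[OF A B, symmetric] perp_ssum[OF A B, symmetric] by linarith

text \<open>Lifting multiplies dimension and normalisation by the same power of 2. Any common level
  may therefore be used, which turns inequalities for \<open>gap\<close> into inequalities for
  \<open>delta\<close>.\<close>

lemma delta_level:
  assumes p: "p \<in> Linf_pts F" "fst p \<le> m" and q: "q \<in> Linf_pts F" "fst q \<le> m"
  shows "delta F p q = gap (up F m p) (up F m q) / 2 ^ m"
proof -
  let ?k = "max (fst p) (fst q)"
  have k: "fst p \<le> ?k" "fst q \<le> ?k" "?k \<le> m" using p q by auto
  note S = up_props(1)[OF p(1) k(1)] up_props(1)[OF q(1) k(2)]
  have dim: "Fdim F (up F m (?k, X)) = 2 ^ (m - ?k) * Fdim F X" if "Fsubspace F (2 ^ ?k) X" for X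
    using up_props(2)[of "(?k, X)" m] that k by (simp add: Linf_pts_def)
  have "gap (up F m p) (up F m q) = 2 ^ (m - ?k) * gap (up F ?k p) (up F ?k q)"
    unfolding gap_def up_up[OF k(1,3), symmetric] up_up[OF k(2,3), symmetric]
    unfolding up_ops(1,2)[OF k(3) S, symmetric] dim[OF subspace_ssum[OF S]] dim[OF subspace_Int[OF S]]
    by (simp add: algebra_simps)
  moreover have "(2::real) ^ m = 2 ^ (m - ?k) * 2 ^ ?k" using k by (simp flip: power_add)
  ultimately show ?thesis by (simp add: delta_def Let_def gap_def)
qed

end

section \<open>The continuous geometry\<close>

context conj_subfield
begin

lemma delta_self: "p \<in> Linf_pts F \<Longrightarrow> delta F p p = 0"
  using delta_level[of p "fst p" p] gap_self[of "2 ^ fst p" "snd p"] by (simp add: up_self Linf_pts_def)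

lemma delta_commute:
  assumes "p \<in> Linf_pts F" "q \<in> Linf_pts F"
  shows "delta F p q = delta F q p"
  using delta_level[of p "max (fst p) (fst q)" q] delta_level[of q "max (fst p) (fst q)" p] assms
  by (simp add: gap_commute)

lemma delta_nonneg:
  assumes "p \<in> Linf_pts F" "q \<in> Linf_pts F"
  shows "0 \<le> delta F p q"
proof -
  let ?m = "max (fst p) (fst q)"
  have m: "fst p \<le> ?m" "fst q \<le> ?m" by auto
  show ?thesis
    using delta_level[OF assms(1) m(1) assms(2) m(2)] gap_nonneg[OF up_props(1)[OF assms(1) m(1)] up_props(1)[OF assms(2) m(2)]]
    by simp
qed

lemma delta_triangle:
  assumes p: "p \<in> Linf_pts F" and q: "q \<in> Linf_pts F" and r: "r \<in> Linf_pts F"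
  shows "delta F p r \<le> delta F p q + delta F q r"
proof -
  define m where "m = max (fst p) (max (fst q) (fst r))"
  have m: "fst p \<le> m" "fst q \<le> m" "fst r \<le> m" by (auto simp: m_def)
  have "gap (up F m p) (up F m r) \<le> gap (up F m p) (up F m q) + gap (up F m q) (up F m r)"
    by (rule gap_triangle[OF up_props(1)[OF p m(1)] up_props(1)[OF q m(2)] up_props(1)[OF r m(3)]])
  then show ?thesis
    unfolding delta_level[OF p m(1) q m(2)] delta_level[OF q m(2) r m(3)] delta_level[OF p m(1) r m(3)]
    by (simp add: divide_right_mono flip: add_divide_distrib)
qed

lemma delta_eq_0:
  assumes p: "p \<in> Linf_pts F" "fst p \<le> m" and q: "q \<in> Linf_pts F" "fst q \<le> m"
  shows "delta F p q = 0 \<longleftrightarrow> up F m p = up F m q"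
  unfolding delta_level[OF p q]
  using gap_eq_0[OF up_props(1)[OF p] up_props(1)[OF q]] gap_self[OF up_props(1)[OF p]] by auto

lemma pjoin_props:
  assumes p: "p \<in> Linf_pts F" and q: "q \<in> Linf_pts F"
  shows "pjoin F p q \<in> Linf_pts F" "fst (pjoin F p q) = max (fst p) (fst q)"
    "fst p \<le> m \<Longrightarrow> fst q \<le> m \<Longrightarrow> up F m (pjoin F p q) = ssum (up F m p) (up F m q)"
proof -
  let ?k = "max (fst p) (fst q)"
  have k: "fst p \<le> ?k" "fst q \<le> ?k" by auto
  note S = up_props(1)[OF p k(1)] up_props(1)[OF q k(2)]
  show "pjoin F p q \<in> Linf_pts F" using subspace_ssum[OF S] by (simp add: pjoin_def Let_def Linf_pts_def)
  show "fst (pjoin F p q) = ?k" by (simp add: pjoin_def Let_def)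
  show "up F m (pjoin F p q) = ssum (up F m p) (up F m q)" if "fst p \<le> m" "fst q \<le> m"
    using up_ops(1)[OF _ S, of m] that up_up[OF k(1), of m] up_up[OF k(2), of m] by (simp add: pjoin_def Let_def)
qed

lemma pmeet_props:
  assumes p: "p \<in> Linf_pts F" and q: "q \<in> Linf_pts F"
  shows "pmeet F p q \<in> Linf_pts F" "fst (pmeet F p q) = max (fst p) (fst q)"
    "fst p \<le> m \<Longrightarrow> fst q \<le> m \<Longrightarrow> up F m (pmeet F p q) = up F m p \<inter> up F m q"
proof -
  let ?k = "max (fst p) (fst q)"
  have k: "fst p \<le> ?k" "fst q \<le> ?k" by auto
  note S = up_props(1)[OF p k(1)] up_props(1)[OF q k(2)]
  show "pmeet F p q \<in> Linf_pts F" using subspace_Int[OF S] by (simp add: pmeet_def Let_def Linf_pts_def)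
  show "fst (pmeet F p q) = ?k" by (simp add: pmeet_def Let_def)
  show "up F m (pmeet F p q) = up F m p \<inter> up F m q" if "fst p \<le> m" "fst q \<le> m"
    using up_ops(2)[OF _ S, of m] that up_up[OF k(1), of m] up_up[OF k(2), of m] by (simp add: pmeet_def Let_def)
qed

lemma pcompl_props:
  assumes p: "p \<in> Linf_pts F"
  shows "pcompl F p \<in> Linf_pts F" "fst (pcompl F p) = fst p"
    "fst p \<le> m \<Longrightarrow> up F m (pcompl F p) = Fperp F (2 ^ m) (up F m p)"
proof -
  have S: "Fsubspace F (2 ^ fst p) (snd p)" using p by (simp add: Linf_pts_def)
  show "pcompl F p \<in> Linf_pts F" by (simp add: pcompl_def Linf_pts_def subspace_perp)
  show "fst (pcompl F p) = fst p" by (simp add: pcompl_def)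
  show "up F m (pcompl F p) = Fperp F (2 ^ m) (up F m p)" if "fst p \<le> m"
    using up_ops(3)[OF that S S] by (simp only: pcompl_def prod.collapse)
qed

lemma pzero_props: "pzero \<in> Linf_pts F" "fst pzero = 0" "up F m pzero = {0}"
proof -
  show "pzero \<in> Linf_pts F" by (simp add: pzero_def Linf_pts_def vzero_eq_0 subspace_0)
  show "fst pzero = 0" by (simp add: pzero_def)
  show "up F m pzero = {0}"
    using up_ops(4)[OF le0 subspace_0 subspace_0] by (simp only: pzero_def vzero_eq_0)
qed

lemma pone_props: "pone F \<in> Linf_pts F" "fst (pone F) = 0" "up F m (pone F) = Fvec F (2 ^ m)"
proof -
  show "pone F \<in> Linf_pts F" using subspace_Fvec[of 1] by (simp add: pone_def Linf_pts_def)
  show "fst (pone F) = 0" by (simp add: pone_def)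
  show "up F m (pone F) = Fvec F (2 ^ m)"
    using up_ops(5)[OF le0 subspace_0 subspace_0] by (simp only: pone_def power_0)
qed

lemma delta_pjoin:
  assumes p: "p \<in> Linf_pts F" "p' \<in> Linf_pts F" and q: "q \<in> Linf_pts F" "q' \<in> Linf_pts F"
  shows "delta F (pjoin F p q) (pjoin F p' q') \<le> delta F p p' + delta F q q'"
proof -
  define m where "m = max (max (fst p) (fst q)) (max (fst p') (fst q'))"
  have m: "fst p \<le> m" "fst p' \<le> m" "fst q \<le> m" "fst q' \<le> m" by (auto simp: m_def)
  have j: "fst (pjoin F p q) \<le> m" "fst (pjoin F p' q') \<le> m"
    using pjoin_props(2)[OF p(1) q(1)] pjoin_props(2)[OF p(2) q(2)] m by auto
  have "gap (ssum (up F m p) (up F m q)) (ssum (up F m p') (up F m q'))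
      \<le> gap (up F m p) (up F m p') + gap (up F m q) (up F m q')"
    by (rule gap_ssum[OF up_props(1)[OF p(1) m(1)] up_props(1)[OF p(2) m(2)]
          up_props(1)[OF q(1) m(3)] up_props(1)[OF q(2) m(4)]])
  then show ?thesis
    unfolding delta_level[OF pjoin_props(1)[OF p(1) q(1)] j(1) pjoin_props(1)[OF p(2) q(2)] j(2)]
      delta_level[OF p(1) m(1) p(2) m(2)] delta_level[OF q(1) m(3) q(2) m(4)]
      pjoin_props(3)[OF p(1) q(1) m(1,3)] pjoin_props(3)[OF p(2) q(2) m(2,4)]
    by (simp add: divide_right_mono flip: add_divide_distrib)
qed

lemma delta_pmeet:
  assumes p: "p \<in> Linf_pts F" "p' \<in> Linf_pts F" and q: "q \<in> Linf_pts F" "q' \<in> Linf_pts F"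
  shows "delta F (pmeet F p q) (pmeet F p' q') \<le> delta F p p' + delta F q q'"
proof -
  define m where "m = max (max (fst p) (fst q)) (max (fst p') (fst q'))"
  have m: "fst p \<le> m" "fst p' \<le> m" "fst q \<le> m" "fst q' \<le> m" by (auto simp: m_def)
  have j: "fst (pmeet F p q) \<le> m" "fst (pmeet F p' q') \<le> m"
    using pmeet_props(2)[OF p(1) q(1)] pmeet_props(2)[OF p(2) q(2)] m by auto
  have "gap (up F m p \<inter> up F m q) (up F m p' \<inter> up F m q')
      \<le> gap (up F m p) (up F m p') + gap (up F m q) (up F m q')"
    by (rule gap_Int[OF up_props(1)[OF p(1) m(1)] up_props(1)[OF p(2) m(2)]
          up_props(1)[OF q(1) m(3)] up_props(1)[OF q(2) m(4)]])
  then show ?thesis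
    unfolding delta_level[OF pmeet_props(1)[OF p(1) q(1)] j(1) pmeet_props(1)[OF p(2) q(2)] j(2)]
      delta_level[OF p(1) m(1) p(2) m(2)] delta_level[OF q(1) m(3) q(2) m(4)]
      pmeet_props(3)[OF p(1) q(1) m(1,3)] pmeet_props(3)[OF p(2) q(2) m(2,4)]
    by (simp add: divide_right_mono flip: add_divide_distrib)
qed

lemma delta_pcompl:
  assumes p: "p \<in> Linf_pts F" and q: "q \<in> Linf_pts F"
  shows "delta F (pcompl F p) (pcompl F q) = delta F p q"
proof -
  define m where "m = max (fst p) (fst q)"
  have m: "fst p \<le> m" "fst q \<le> m" by (auto simp: m_def)
  have c: "fst (pcompl F p) \<le> m" "fst (pcompl F q) \<le> m"
    using pcompl_props(2)[OF p] pcompl_props(2)[OF q] m by auto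
  show ?thesis
    unfolding delta_level[OF pcompl_props(1)[OF p] c(1) pcompl_props(1)[OF q] c(2)]
      delta_level[OF p m(1) q m(2)] pcompl_props(3)[OF p m(1)] pcompl_props(3)[OF q m(2)]
      gap_perp[OF up_props(1)[OF p m(1)] up_props(1)[OF q m(2)]] ..
qed

text \<open>Representatives of the direct limit; equality in the limit is distance \<open>0\<close>, so this structure
  satisfies the ortholattice axioms only up to that relation.\<close>

definition pre_limit :: "lpt ortholattice" where
  "pre_limit = \<lparr> ocarrier = Linf_pts F, ojoin = pjoin F, omeet = pmeet F, ocompl = pcompl F,
     ozero = pzero, oone = pone F \<rparr>"

lemma pre_limit_simps [simp]:
  "ojoin pre_limit = pjoin F" "omeet pre_limit = pmeet F" "ocompl pre_limit = pcompl F"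
  "ozero pre_limit = pzero" "oone pre_limit = pone F"
  by (simp_all add: pre_limit_def)

lemma oeval_pre_limit_in:
  "(\<And>i. p i \<in> Linf_pts F) \<Longrightarrow> oeval pre_limit p t \<in> Linf_pts F"
  by (induction t) (simp_all add: pjoin_props(1) pmeet_props(1) pcompl_props(1) pzero_props(1) pone_props(1))

text \<open>Lifting to a level above all values commutes with evaluation, so terms in
  representatives are governed by the single ortholattice \<open>LF F (2 ^ m)\<close>.\<close>

lemma oeval_pre_limit_up:
  assumes p: "\<And>i. p i \<in> Linf_pts F" "\<And>i. fst (p i) \<le> m"
  shows "fst (oeval pre_limit p t) \<le> m \<and>
     up F m (oeval pre_limit p t) = oeval (LF F (2 ^ m)) (\<lambda>i. up F m (p i)) t"
proof -
  have E: "oeval pre_limit p t \<in> Linf_pts F" for t by (rule oeval_pre_limit_in) (rule p)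
  show ?thesis
  proof (induction t)
    case (OJoin s t)
    then show ?case using pjoin_props(2)[OF E[of s] E[of t]] pjoin_props(3)[OF E[of s] E[of t], of m] by simp
  next
    case (OMeet s t)
    then show ?case using pmeet_props(2)[OF E[of s] E[of t]] pmeet_props(3)[OF E[of s] E[of t], of m] by simp
  next
    case (OCompl t)
    then show ?case using pcompl_props(2)[OF E[of t]] pcompl_props(3)[OF E[of t], of m] by simp
  qed (use p pzero_props pone_props in auto)
qed

section \<open>Cauchy sequences up to vanishing distance\<close>

lemma dcauchy_in: "dcauchy F s \<Longrightarrow> s k \<in> Linf_pts F"
  by (simp add: dcauchy_def)

lemma dcauchy_const: "p \<in> Linf_pts F \<Longrightarrow> dcauchy F (\<lambda>k. p)"
  by (simp add: dcauchy_def delta_self)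

lemma dclass_self: "dcauchy F s \<Longrightarrow> s \<in> dclass F s"
  by (simp add: dclass_def delta_self dcauchy_in[of s])

lemma drep_props:
  assumes "dcauchy F s"
  shows "dcauchy F (drep (dclass F s))" "(\<lambda>k. delta F (s k) (drep (dclass F s) k)) \<longlonglongrightarrow> 0"
proof -
  have "drep (dclass F s) \<in> dclass F s"
    unfolding drep_def using dclass_self[OF assms] by (rule someI[where P = "\<lambda>x. x \<in> dclass F s"])
  then show "dcauchy F (drep (dclass F s))" "(\<lambda>k. delta F (s k) (drep (dclass F s) k)) \<longlonglongrightarrow> 0"
    by (auto simp: dclass_def)
qed

lemma delta_tendsto_trans:
  assumes r: "dcauchy F r" and s: "dcauchy F s" and t: "dcauchy F t"
    and 1: "(\<lambda>k. delta F (r k) (s k)) \<longlonglongrightarrow> 0" and 2: "(\<lambda>k. delta F (s k) (t k)) \<longlonglongrightarrow> 0"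
  shows "(\<lambda>k. delta F (r k) (t k)) \<longlonglongrightarrow> 0"
proof (rule tendsto_sandwich[OF _ _ tendsto_const])
  show "(\<lambda>k. delta F (r k) (s k) + delta F (s k) (t k)) \<longlonglongrightarrow> 0" using tendsto_add[OF 1 2] by simp
qed (auto intro!: always_eventually delta_nonneg delta_triangle dcauchy_in[OF r] dcauchy_in[OF s] dcauchy_in[OF t])

lemma dclass_eq_iff:
  assumes s: "dcauchy F s" and t: "dcauchy F t"
  shows "dclass F s = dclass F t \<longleftrightarrow> (\<lambda>k. delta F (s k) (t k)) \<longlonglongrightarrow> 0"
proof
  assume "dclass F s = dclass F t"
  then have "t \<in> dclass F s" using dclass_self[OF t] by simp
  then show "(\<lambda>k. delta F (s k) (t k)) \<longlonglongrightarrow> 0" by (simp add: dclass_def)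
next
  assume st: "(\<lambda>k. delta F (s k) (t k)) \<longlonglongrightarrow> 0"
  then have ts: "(\<lambda>k. delta F (t k) (s k)) \<longlonglongrightarrow> 0"
    by (simp add: delta_commute[OF dcauchy_in[OF s] dcauchy_in[OF t]])
  show "dclass F s = dclass F t"
    unfolding dclass_def
    using delta_tendsto_trans[OF s t _ st] delta_tendsto_trans[OF t s _ ts] by (intro Collect_cong) blast
qed

text \<open>The Lipschitz bound yields both claims: images of Cauchy sequences are Cauchy, and the
  class of the result does not depend on the representatives picked by \<open>drep\<close>.\<close>

lemma dcauchy_binary:
  assumes s: "dcauchy F s" and t: "dcauchy F t"
    and op: "\<And>p q. p \<in> Linf_pts F \<Longrightarrow> q \<in> Linf_pts F \<Longrightarrow> op p q \<in> Linf_pts F"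
    and lip: "\<And>p p' q q'. p \<in> Linf_pts F \<Longrightarrow> p' \<in> Linf_pts F \<Longrightarrow> q \<in> Linf_pts F \<Longrightarrow> q' \<in> Linf_pts F \<Longrightarrow>
       delta F (op p q) (op p' q') \<le> delta F p p' + delta F q q'"
  shows "dcauchy F (\<lambda>k. op (s k) (t k))"
    "dclass F (\<lambda>k. op (drep (dclass F s) k) (drep (dclass F t) k)) = dclass F (\<lambda>k. op (s k) (t k))"
proof -
  have c: "dcauchy F (\<lambda>k. op (s k) (t k))" if s: "dcauchy F s" and t: "dcauchy F t" for s t
    unfolding dcauchy_def
  proof (intro conjI allI impI)
    show "op (s k) (t k) \<in> Linf_pts F" for k by (intro op dcauchy_in s t)
    fix e :: real assume "e > 0"
    then have e2: "e / 2 > 0" by simp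
    obtain N where N: "\<forall>i\<ge>N. \<forall>j\<ge>N. delta F (s i) (s j) < e / 2"
      using s e2 unfolding dcauchy_def by blast
    obtain M where M: "\<forall>i\<ge>M. \<forall>j\<ge>M. delta F (t i) (t j) < e / 2"
      using t e2 unfolding dcauchy_def by blast
    show "\<exists>N. \<forall>i\<ge>N. \<forall>j\<ge>N. delta F (op (s i) (t i)) (op (s j) (t j)) < e"
    proof (intro exI[of _ "max N M"] allI impI)
      fix i j assume ij: "max N M \<le> i" "max N M \<le> j"
      have "delta F (s i) (s j) < e / 2" "delta F (t i) (t j) < e / 2" using N M ij by auto
      moreover have "delta F (op (s i) (t i)) (op (s j) (t j)) \<le> delta F (s i) (s j) + delta F (t i) (t j)"
        by (intro lip dcauchy_in s t)
      ultimately show "delta F (op (s i) (t i)) (op (s j) (t j)) < e" by linarith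
    qed
  qed
  show "dcauchy F (\<lambda>k. op (s k) (t k))" by (rule c[OF s t])
  let ?s = "drep (dclass F s)" and ?t = "drep (dclass F t)"
  note S = drep_props[OF s] and T = drep_props[OF t]
  note mem = dcauchy_in[OF s] dcauchy_in[OF t] dcauchy_in[OF S(1)] dcauchy_in[OF T(1)]
  have "(\<lambda>k. delta F (op (s k) (t k)) (op (?s k) (?t k))) \<longlonglongrightarrow> 0"
  proof (rule tendsto_sandwich[OF _ _ tendsto_const])
    show "(\<lambda>k. delta F (s k) (?s k) + delta F (t k) (?t k)) \<longlonglongrightarrow> 0" using tendsto_add[OF S(2) T(2)] by simp
  qed (auto intro!: always_eventually delta_nonneg lip op mem)
  then show "dclass F (\<lambda>k. op (?s k) (?t k)) = dclass F (\<lambda>k. op (s k) (t k))"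
    using dclass_eq_iff[OF c[OF s t] c[OF S(1) T(1)]] by simp
qed

lemma dcauchy_pcompl:
  assumes s: "dcauchy F s"
  shows "dcauchy F (\<lambda>k. pcompl F (s k))"
    "dclass F (\<lambda>k. pcompl F (drep (dclass F s) k)) = dclass F (\<lambda>k. pcompl F (s k))"
proof -
  \<comment> \<open>The complement is treated as a binary operation that ignores its second
    argument.\<close>
  have lip: "delta F (pcompl F p) (pcompl F p') \<le> delta F p p' + delta F q q'"
    if "p \<in> Linf_pts F" "p' \<in> Linf_pts F" "q \<in> Linf_pts F" "q' \<in> Linf_pts F" for p p' q q'
    using that by (simp add: delta_pcompl delta_nonneg)
  note b = dcauchy_binary[OF s s, of "\<lambda>p q. pcompl F p", OF pcompl_props(1) lip]
  show "dcauchy F (\<lambda>k. pcompl F (s k))" by (rule b(1))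
  show "dclass F (\<lambda>k. pcompl F (drep (dclass F s) k)) = dclass F (\<lambda>k. pcompl F (s k))" by (rule b(2))
qed

lemma CG_simps [simp]:
  "ocarrier (CG F) = {dclass F s | s. dcauchy F s}"
  "ojoin (CG F) A B = dclass F (\<lambda>k. pjoin F (drep A k) (drep B k))"
  "omeet (CG F) A B = dclass F (\<lambda>k. pmeet F (drep A k) (drep B k))"
  "ocompl (CG F) A = dclass F (\<lambda>k. pcompl F (drep A k))"
  "ozero (CG F) = dclass F (\<lambda>k. pzero)" "oone (CG F) = dclass F (\<lambda>k. pone F)"
  by (simp_all add: CG_def)

text \<open>Operations on classes can be computed on sequences only once these are known to be
  Cauchy, hence the joint induction.\<close>

lemma oeval_CG:
  assumes s: "\<And>i. dcauchy F (s i)"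
  shows "dcauchy F (\<lambda>k. oeval pre_limit (\<lambda>i. s i k) t) \<and>
    oeval (CG F) (\<lambda>i. dclass F (s i)) t = dclass F (\<lambda>k. oeval pre_limit (\<lambda>i. s i k) t)"
proof (induction t)
  case (OVar i)
  then show ?case using s by simp
next
  case (OJoin t u)
  note IH = OJoin.IH(1)[THEN conjunct1] OJoin.IH(2)[THEN conjunct1]
  show ?case using dcauchy_binary[OF IH pjoin_props(1) delta_pjoin] OJoin.IH by simp
next
  case (OMeet t u)
  note IH = OMeet.IH(1)[THEN conjunct1] OMeet.IH(2)[THEN conjunct1]
  show ?case using dcauchy_binary[OF IH pmeet_props(1) delta_pmeet] OMeet.IH by simp
next
  case (OCompl t)
  then show ?case using dcauchy_pcompl by simp
next
  case OZero
  then show ?case using dcauchy_const[OF pzero_props(1)] by simp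
next
  case OOne
  then show ?case using dcauchy_const[OF pone_props(1)] by simp
qed

text \<open>The levels of the representatives may grow without bound along the sequences. At each
  single index there is a common level, and there the two sides have distance 0.\<close>

lemma QL_CG_subset: "(\<Inter>d. QL (LF F d)) \<subseteq> QL (CG F)"
proof
  fix e assume e: "e \<in> (\<Inter>d. QL (LF F d))"
  have zero: "delta F (oeval pre_limit p (fst e)) (oeval pre_limit p (snd e)) = 0"
    if p: "\<And>i. p i \<in> Linf_pts F" for p
  proof -
    define V where "V = ovars (fst e) \<union> ovars (snd e)"
    \<comment> \<open>Only variables in \<open>V\<close> matter; \<open>pzero\<close>, of level 0,
      keeps all other values below \<open>m\<close>.\<close>
    define q where "q i = (if i \<in> V then p i else pzero)" for i
    define m where "m = Max (insert 0 ((\<lambda>i. fst (p i)) ` V))"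
    have "finite V" by (simp add: V_def finite_ovars)
    then have "fst (p i) \<le> m" if "i \<in> V" for i using that by (simp add: m_def)
    then have q: "\<And>i. fst (q i) \<le> m" "\<And>i. q i \<in> Linf_pts F"
      using p pzero_props by (auto simp: q_def)
    have eq: "oeval pre_limit p (fst e) = oeval pre_limit q (fst e)"
      "oeval pre_limit p (snd e) = oeval pre_limit q (snd e)"
      by (rule oeval_cong, simp add: q_def V_def)+
    have Q: "oeval pre_limit q t \<in> Linf_pts F" for t by (rule oeval_pre_limit_in) (rule q)
    note U = oeval_pre_limit_up[of q m, OF q(2,1)]
    have "e \<in> QL (LF F (2 ^ m))" using e by blast
    then have "oeval (LF F (2 ^ m)) (\<lambda>i. up F m (q i)) (fst e) = oeval (LF F (2 ^ m)) (\<lambda>i. up F m (q i)) (snd e)"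
      using up_props(1)[OF q(2,1)] by (simp add: QL_def holds_in_def)
    then show ?thesis
      unfolding eq using delta_eq_0[OF Q _ Q, of "fst e" m "snd e"] U by simp
  qed
  show "e \<in> QL (CG F)"
    unfolding QL_def holds_in_def
  proof (intro CollectI allI impI)
    fix a assume "\<forall>i :: nat. a i \<in> ocarrier (CG F)"
    then have "\<forall>i. \<exists>s. dcauchy F s \<and> a i = dclass F s" by auto
    then obtain s where s: "\<And>i. dcauchy F (s i)" "\<And>i. a i = dclass F (s i)" by metis
    have a: "a = (\<lambda>i. dclass F (s i))" using s(2) by auto
    note E = oeval_CG[of s, OF s(1)]
    show "oeval (CG F) a (fst e) = oeval (CG F) a (snd e)"
      unfolding a E[THEN conjunct2] dclass_eq_iff[OF E[THEN conjunct1] E[THEN conjunct1]]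
      using zero dcauchy_in[OF s(1)] by simp
  qed
qed

text \<open>Constant sequences place each \<open>LF F (2 ^ n)\<close> inside the completion. A
  constant distance tending to 0 is 0, and at level \<open>n\<close> this means equality.\<close>

lemma QL_CG_superset: "QL (CG F) \<subseteq> (\<Inter>d. QL (LF F d))"
proof
  fix e assume e: "e \<in> QL (CG F)"
  have n: "e \<in> QL (LF F (2 ^ n))" for n
    unfolding QL_def holds_in_def
  proof (intro CollectI allI impI)
    fix a assume a: "\<forall>i :: nat. a i \<in> ocarrier (LF F (2 ^ n))"
    define p where "p i = (n, a i)" for i
    have p: "\<And>i. p i \<in> Linf_pts F" "\<And>i. fst (p i) \<le> n" using a by (auto simp: p_def Linf_pts_def)
    have c: "dcauchy F (\<lambda>k. p i)" for i by (rule dcauchy_const) (rule p)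
    have P: "oeval pre_limit p t \<in> Linf_pts F" for t by (rule oeval_pre_limit_in) (rule p)
    note E = oeval_CG[of "\<lambda>i k. p i", OF c]
    have "oeval (CG F) (\<lambda>i. dclass F (\<lambda>k. p i)) (fst e) = oeval (CG F) (\<lambda>i. dclass F (\<lambda>k. p i)) (snd e)"
      using e[unfolded QL_def holds_in_def, THEN CollectD, rule_format, of "\<lambda>i. dclass F (\<lambda>k. p i)"] c by auto
    then have "(\<lambda>k::nat. delta F (oeval pre_limit p (fst e)) (oeval pre_limit p (snd e))) \<longlonglongrightarrow> 0"
      unfolding E[THEN conjunct2] dclass_eq_iff[OF E[THEN conjunct1] E[THEN conjunct1]] .
    then have "delta F (oeval pre_limit p (fst e)) (oeval pre_limit p (snd e)) = 0"
      by (simp add: LIMSEQ_const_iff)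
    then have "up F n (oeval pre_limit p (fst e)) = up F n (oeval pre_limit p (snd e))"
      using delta_eq_0[OF P _ P] oeval_pre_limit_up[of p n, OF p] by blast
    then show "oeval (LF F (2 ^ n)) a (fst e) = oeval (LF F (2 ^ n)) a (snd e)"
      using oeval_pre_limit_up[of p n, OF p] by (simp add: p_def up_self)
  qed
  have "\<exists>m\<ge>d. e \<in> QL (LF F m)" for d
    using n[of d] less_exp[of d] less_imp_le by blast
  then show "e \<in> (\<Inter>d. QL (LF F d))" by (rule QL_LF_unbounded[OF F])
qed

end

theorem mainTheorem4:
  fixes F :: "complex set"
  assumes "conj_closed_subfield F"
    and "{x :: complex. algebraic x} \<inter> \<real> \<subseteq> F"
  shows "(\<Inter>d. QL (LF UNIV d)) = (\<Inter>d. QL (LF F d)) \<and>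
         (\<forall>(d :: nat \<Rightarrow> nat) f (L :: 'b ortholattice) \<phi>.
           filterlim d at_top sequentially \<and> is_LF_direct_limit F d f L \<phi> \<longrightarrow>
           (\<Inter>d. QL (LF UNIV d)) = QL L) \<and>
         (\<Inter>d. QL (LF UNIV d)) = QL (CG F)"
proof -
  interpret conj_subfield F by unfold_locales (rule assms(1))
  have 1: "(\<Inter>d. QL (LF UNIV d)) = (\<Inter>d. QL (LF F d))"
    by (rule QL_LF_field_independent[OF assms])
  have 3: "(\<Inter>d. QL (LF F d)) = QL (CG F)"
    using QL_CG_subset QL_CG_superset by (rule equalityI)
  show ?thesis
    unfolding 1
  proof (intro conjI allI impI)
    fix d :: "nat \<Rightarrow> nat" and f and L :: "'b ortholattice" and \<phi>
    assume "filterlim d at_top sequentially \<and> is_LF_direct_limit F d f L \<phi>"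
    then show "(\<Inter>d. QL (LF F d)) = QL L" by (elim conjE) (rule QL_direct_limit[OF assms(1)])
  qed (simp_all add: 3)
qed

end
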